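(* Let $K$ be a field, let $R=K[X_1,\dots,X_n]$ be the standard graded polynomial ring, and let $I_1,\dots,I_w$ be homogeneous ideals of $R$ such that each $I_i$ is generated by elements of a single degree $d_i$. Then the family $I_1,\dots,I_w$ has linear products if and only if $\operatorname{reg}_0(R(I_1,\dots,I_w))=0$.
   Context: Linear products: a family of homogeneous ideals has linear products if every product of members of the family (repetitions allowed) has a linear resolution. Here a homogeneous ideal has a linear resolution if it is generated by elements of constant degree $d$ and all matrices in its minimal graded free resolution over $R$, except the one containing the generators of the ideal, have linear entries. Thus for the family $I_1,\dots,I_w$ the condition is that $I_1^{h_1}\cdots I_w^{h_w}$ has a linear resolution for all $h\in\mathbb{Z}_+^w$. Multi-Rees algebra: $R(I_1,\dots,I_w)=\bigoplus_{a\in\mathbb{Z}_+^w} I_1^{a_1}\cdots I_w^{a_w}T_1^{a_1}\cdots T_w^{a_w}\subseteq R[T_1,\dots,T_w]$, with $T_1,\dots,T_w$ indeterminates over $R$. Let $e_0,\dots,e_w$ be the standard basis of $\mathbb{Z}^{w+1}$. The multi-Rees algebra is $\mathbb{Z}^{w+1}$-graded by giving a homogeneous $x\in R$ of degree $\deg x$ the degree $(\deg x)e_0$ and setting $\deg T_i=-d_ie_0+e_i$. It is then generated over $K$ by elements whose degrees are among $e_0,\dots,e_w$. Presentation: choose generators $f_{i1},\dots,f_{im_i}$ of degree $d_i$ of $I_i$ for $i=1,\dots,w$, let $\mathcal{S}=R[Z_{ij}: 1\le i\le w,\ 1\le j\le m_i]$ be the polynomial ring with $\deg X_k=e_0$,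 $\deg Z_{ij}=e_i$, and regard $R(I_1,\dots,I_w)$ as a graded $\mathcal{S}$-module via the surjective homomorphism $\Phi:\mathcal{S}\to R(I_1,\dots,I_w)$ with $\Phi|_R=\operatorname{id}_R$, $\Phi(Z_{ij})=f_{ij}T_i$. Partial regularity: for a finitely generated $\mathbb{Z}^{w+1}$-graded $\mathcal{S}$-module $M$, $\operatorname{reg}_0(M)=\sup_k\{t_{0k}(M)-k\}$, where $t_{0k}(M)$ is the supremum of the $0$-th coordinates of the degrees of the nonzero homogeneous elements of $\operatorname{Tor}_k^{\mathcal{S}}(K,M)$ ($-\infty$ if this module is zero). *)

theory Defs
  imports
    "HOL-Library.Poly_Mapping"
    "HOL-Library.Function_Algebras"
    "HOL-Library.Extended_Real"
    "HOL-Algebra.Ideal_Product"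
begin

section \<open>Polynomial rings and gradings\<close>

text \<open>All polynomial rings of the statement live in one type: \<open>R\<close> in the variables \<open>X k\<close>,
  \<open>R[T\<^sub>1,\<dots>,T\<^sub>w]\<close> in the \<open>X k\<close> and \<open>T i\<close>, and the presenting ring in the \<open>X k\<close> and \<open>Z i j\<close>.
  Hence \<open>R\<close> is literally a subring of the other two.\<close>

datatype var = X nat | T nat | Z nat nat

type_synonym 'k mpol = "(var \<Rightarrow>\<^sub>0 nat) \<Rightarrow>\<^sub>0 'k"

definition polys :: "var set \<Rightarrow> 'k::zero mpol set" where
  "polys V = {p. \<forall>m\<in>Poly_Mapping.keys p. Poly_Mapping.keys m \<subseteq> V}"

definition poly_ring :: "var set \<Rightarrow> 'k::field mpol ring" where
  "poly_ring V = \<lparr>carrier = polys V, mult = (*), one = 1, zero = 0, add = (+)\<rparr>"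

definition Var :: "var \<Rightarrow> 'k::field mpol" where
  "Var v = Poly_Mapping.single (Poly_Mapping.single v 1) 1"

text \<open>Degrees are integers for the standard grading and functions \<open>nat \<Rightarrow> int\<close> (added pointwise)
  for the multigradings; the factor \<open>of_nat\<close> below is an integer multiple in both cases.\<close>

definition mon_degree :: "(var \<Rightarrow> 'g::comm_ring_1) \<Rightarrow> (var \<Rightarrow>\<^sub>0 nat) \<Rightarrow> 'g" where
  "mon_degree dg m = (\<Sum>v\<in>Poly_Mapping.keys m. of_nat (Poly_Mapping.lookup m v) * dg v)"

text \<open>As usual, \<open>0\<close> is homogeneous of every degree.\<close>

definition homogeneous :: "(var \<Rightarrow> 'g::comm_ring_1) \<Rightarrow> 'g \<Rightarrow> 'k::zero mpol \<Rightarrow> bool" where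
  "homogeneous dg a p \<longleftrightarrow> (\<forall>m\<in>Poly_Mapping.keys p. mon_degree dg m = a)"


section \<open>Graded modules and graded free resolutions\<close>

text \<open>A graded module is given by its underlying set, the action of the polynomial ring, the
  group of degrees, and the homogeneous component of each degree.\<close>

record ('p, 'g, 'm) graded_module =
  mod_carrier :: "'m set"
  mod_act :: "'p \<Rightarrow> 'm \<Rightarrow> 'm"
  mod_degrees :: "'g set"
  mod_comp :: "'g \<Rightarrow> 'm set"

text \<open>The data of a graded free resolution
  \<open>\<dots> \<rightarrow> F\<^sub>2 \<rightarrow> F\<^sub>1 \<rightarrow> F\<^sub>0 \<rightarrow> M \<rightarrow> 0\<close> by free modules of finite rank, with chosen bases:
  \<open>res_shift k j\<close> is the degree of the \<open>j\<close>-th basis element of \<open>F\<^sub>k\<close> (for \<open>j < res_rank k\<close>),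
  \<open>res_mat k i j\<close> is the entry in row \<open>i\<close> and column \<open>j\<close> of the matrix of
  \<open>F\<^bsub>k+1\<^esub> \<rightarrow> F\<^sub>k\<close>, and \<open>res_gen j\<close> is the image in \<open>M\<close> of the \<open>j\<close>-th basis element of \<open>F\<^sub>0\<close>.\<close>

record ('p, 'g, 'm) resolution =
  res_rank :: "nat \<Rightarrow> nat"
  res_shift :: "nat \<Rightarrow> nat \<Rightarrow> 'g"
  res_mat :: "nat \<Rightarrow> nat \<Rightarrow> nat \<Rightarrow> 'p"
  res_gen :: "nat \<Rightarrow> 'm"

definition free_mod :: "var set \<Rightarrow> nat \<Rightarrow> (nat \<Rightarrow> 'k::field mpol) set" where
  "free_mod V r = {x. (\<forall>j<r. x j \<in> polys V) \<and> (\<forall>j\<ge>r. x j = 0)}"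

definition res_diff ::
  "('k::field mpol, 'g, 'm) resolution \<Rightarrow> nat \<Rightarrow> (nat \<Rightarrow> 'k mpol) \<Rightarrow> nat \<Rightarrow> 'k mpol" where
  "res_diff F k x =
     (\<lambda>i. if i < res_rank F k then \<Sum>j<res_rank F (Suc k). res_mat F k i j * x j else 0)"

definition res_aug ::
  "('k::field mpol, 'g, 'm::ab_group_add) graded_module \<Rightarrow> ('k mpol, 'g, 'm) resolution
     \<Rightarrow> (nat \<Rightarrow> 'k mpol) \<Rightarrow> 'm" where
  "res_aug M F x = (\<Sum>j<res_rank F 0. mod_act M (x j) (res_gen F j))"

definition graded_free_resolution ::
  "var set \<Rightarrow> (var \<Rightarrow> 'g::comm_ring_1) \<Rightarrow> ('k::field mpol, 'g, 'm::ab_group_add) graded_module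
     \<Rightarrow> ('k mpol, 'g, 'm) resolution \<Rightarrow> bool" where
  "graded_free_resolution V dg M F \<longleftrightarrow>
     (\<forall>k. \<forall>j<res_rank F k. res_shift F k j \<in> mod_degrees M) \<and>
     (\<forall>j<res_rank F 0. res_gen F j \<in> mod_comp M (res_shift F 0 j)) \<and>
     (\<forall>k. \<forall>i<res_rank F k. \<forall>j<res_rank F (Suc k).
        res_mat F k i j \<in> polys V \<and>
        homogeneous dg (res_shift F (Suc k) j - res_shift F k i) (res_mat F k i j)) \<and>
     res_aug M F ` free_mod V (res_rank F 0) = mod_carrier M \<and>
     {x \<in> free_mod V (res_rank F 0). res_aug M F x = 0}
       = res_diff F 0 ` free_mod V (res_rank F 1) \<and>
     (\<forall>k. {x \<in> free_mod V (res_rank F (Suc k)). res_diff F k x = (\<lambda>_. 0)}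
       = res_diff F (Suc k) ` free_mod V (res_rank F (Suc (Suc k))))"

text \<open>Minimality means that the image of \<open>F\<^bsub>k+1\<^esub>\<close> lies in \<open>\<mm>F\<^sub>k\<close>, where \<open>\<mm>\<close> is generated by the
  variables, i.e. that the matrices have entries without constant term.\<close>

definition minimal_resolution :: "('k::field mpol, 'g, 'm) resolution \<Rightarrow> bool" where
  "minimal_resolution F \<longleftrightarrow>
     (\<forall>k. \<forall>i<res_rank F k. \<forall>j<res_rank F (Suc k). Poly_Mapping.lookup (res_mat F k i j) 0 = 0)"


section \<open>Tor and partial regularity\<close>

text \<open>With \<open>K\<close> the residue field modulo the ideal generated by the variables, \<open>K \<otimes> F\<^sub>k\<close> is the
  vector space \<open>K\<^sup>r\<close>, \<open>r\<close> the rank of \<open>F\<^sub>k\<close>, and \<open>K \<otimes> F\<^bsub>k+1\<^esub> \<rightarrow> K \<otimes> F\<^sub>k\<close> is given by the constant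
  terms of the matrix of \<open>F\<^bsub>k+1\<^esub> \<rightarrow> F\<^sub>k\<close>. Its homology at \<open>k\<close> is \<open>Tor\<^sub>k(K, M)\<close>.\<close>

definition tensor_space :: "('k::field mpol, 'g, 'm) resolution \<Rightarrow> nat \<Rightarrow> (nat \<Rightarrow> 'k) set" where
  "tensor_space F k = {y. \<forall>j\<ge>res_rank F k. y j = 0}"

definition tensor_comp ::
  "('k::field mpol, 'g, 'm) resolution \<Rightarrow> nat \<Rightarrow> 'g \<Rightarrow> (nat \<Rightarrow> 'k) set" where
  "tensor_comp F k a =
     {y \<in> tensor_space F k. \<forall>j<res_rank F k. y j \<noteq> 0 \<longrightarrow> res_shift F k j = a}"

definition tensor_diff ::
  "('k::field mpol, 'g, 'm) resolution \<Rightarrow> nat \<Rightarrow> (nat \<Rightarrow> 'k) \<Rightarrow> nat \<Rightarrow> 'k" where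
  "tensor_diff F k y =
     (\<lambda>i. if i < res_rank F k
          then \<Sum>j<res_rank F (Suc k). Poly_Mapping.lookup (res_mat F k i j) 0 * y j else 0)"

definition tor_cycles :: "('k::field mpol, 'g, 'm) resolution \<Rightarrow> nat \<Rightarrow> (nat \<Rightarrow> 'k) set" where
  "tor_cycles F k =
     (case k of 0 \<Rightarrow> tensor_space F 0
      | Suc l \<Rightarrow> {y \<in> tensor_space F (Suc l). tensor_diff F l y = (\<lambda>_. 0)})"

definition tor_boundaries :: "('k::field mpol, 'g, 'm) resolution \<Rightarrow> nat \<Rightarrow> (nat \<Rightarrow> 'k) set" where
  "tor_boundaries F k = tensor_diff F k ` tensor_space F (Suc k)"

text \<open>\<open>Tor\<close> does not depend on the resolution up to graded isomorphism; one is chosen.\<close>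

definition chosen_resolution ::
  "var set \<Rightarrow> (var \<Rightarrow> 'g::comm_ring_1) \<Rightarrow> ('k::field mpol, 'g, 'm::ab_group_add) graded_module
     \<Rightarrow> ('k mpol, 'g, 'm) resolution" where
  "chosen_resolution V dg M = (SOME F. graded_free_resolution V dg M F)"

text \<open>The degrees of the nonzero homogeneous elements of \<open>Tor\<^sub>k(K, M)\<close>.\<close>

definition tor_degrees ::
  "var set \<Rightarrow> (var \<Rightarrow> 'g::comm_ring_1) \<Rightarrow> ('k::field mpol, 'g, 'm::ab_group_add) graded_module
     \<Rightarrow> nat \<Rightarrow> 'g set" where
  "tor_degrees V dg M k =
     (let F = chosen_resolution V dg M
      in {a. \<exists>y \<in> tensor_comp F k a. y \<in> tor_cycles F k \<and> y \<notin> tor_boundaries F k})"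

definition t0 ::
  "var set \<Rightarrow> (var \<Rightarrow> nat \<Rightarrow> int) \<Rightarrow> ('k::field mpol, nat \<Rightarrow> int, 'm::ab_group_add) graded_module
     \<Rightarrow> nat \<Rightarrow> ereal" where
  "t0 V dg M k = (SUP a \<in> tor_degrees V dg M k. ereal (of_int (a 0)))"

definition reg0 ::
  "var set \<Rightarrow> (var \<Rightarrow> nat \<Rightarrow> int) \<Rightarrow> ('k::field mpol, nat \<Rightarrow> int, 'm::ab_group_add) graded_module
     \<Rightarrow> ereal" where
  "reg0 V dg M = (SUP k. t0 V dg M k - ereal (of_nat k))"


section \<open>Linear resolutions and linear products\<close>

definition X_vars :: "nat \<Rightarrow> var set" where
  "X_vars n = X ` {1..n}"

definition std_degree :: "var \<Rightarrow> int" where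
  "std_degree v = 1"

definition ideal_module :: "'k::field mpol set \<Rightarrow> ('k mpol, int, 'k mpol) graded_module" where
  "ideal_module J =
     \<lparr>mod_carrier = J, mod_act = (*), mod_degrees = UNIV,
      mod_comp = (\<lambda>e. {p \<in> J. homogeneous std_degree e p})\<rparr>"

text \<open>The matrices \<open>res_mat F k\<close> are those of \<open>F\<^bsub>k+1\<^esub> \<rightarrow> F\<^sub>k\<close>; the one containing the generators
  of the ideal is the augmentation \<open>res_gen F\<close> and is not constrained.\<close>

definition linear_resolution :: "nat \<Rightarrow> 'k::field mpol set \<Rightarrow> bool" where
  "linear_resolution n J \<longleftrightarrow>
     (\<exists>d::nat. \<exists>G \<subseteq> polys (X_vars n).
        (\<forall>g\<in>G. homogeneous std_degree (int d) g) \<and> J = Idl\<^bsub>poly_ring (X_vars n)\<^esub> G) \<and>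
     (\<exists>F. graded_free_resolution (X_vars n) std_degree (ideal_module J) F \<and>
        minimal_resolution F \<and>
        (\<forall>k. \<forall>i<res_rank F k. \<forall>j<res_rank F (Suc k).
           homogeneous std_degree 1 (res_mat F k i j)))"

text \<open>\<open>I\<^sub>1\<^bsup>h 1\<^esup> \<cdots> I\<^sub>w\<^bsup>h w\<^esup>\<close>, formed in the monoid of ideals of \<open>R\<close>, whose unit is \<open>R\<close> itself.\<close>

definition prod_ideal ::
  "nat \<Rightarrow> nat \<Rightarrow> (nat \<Rightarrow> 'k::field mpol set) \<Rightarrow> (nat \<Rightarrow> nat) \<Rightarrow> 'k mpol set" where
  "prod_ideal n w I h =
     (let \<I> = ideals_set (poly_ring (X_vars n) :: 'k mpol ring)
      in finprod \<I> (\<lambda>i. I i [^]\<^bsub>\<I>\<^esub> h i) {1..w})"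

definition linear_products :: "nat \<Rightarrow> nat \<Rightarrow> (nat \<Rightarrow> 'k::field mpol set) \<Rightarrow> bool" where
  "linear_products n w I \<longleftrightarrow> (\<forall>h. linear_resolution n (prod_ideal n w I h))"


section \<open>The multi-Rees algebra and its presentation\<close>

definition unit_deg :: "nat \<Rightarrow> nat \<Rightarrow> int" where
  "unit_deg i = (\<lambda>l. if l = i then 1 else 0)"

text \<open>The grading of \<open>R[T\<^sub>1,\<dots>,T\<^sub>w]\<close> by the \<open>X k\<close> and \<open>T i\<close>, and that of the presenting ring by
  the \<open>X k\<close> and \<open>Z i j\<close>; coordinate \<open>l\<close> of a degree is the coefficient of \<open>e\<^sub>l\<close>.\<close>

fun multi_degree :: "(nat \<Rightarrow> nat) \<Rightarrow> var \<Rightarrow> nat \<Rightarrow> int" where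
  "multi_degree d (X k) = unit_deg 0"
| "multi_degree d (T i) = (\<lambda>l. unit_deg i l - int (d i) * unit_deg 0 l)"
| "multi_degree d (Z i j) = unit_deg i"

definition multi_rees ::
  "nat \<Rightarrow> nat \<Rightarrow> (nat \<Rightarrow> 'k::field mpol set) \<Rightarrow> 'k mpol set" where
  "multi_rees n w I =
     {\<Sum>a\<in>A. x a * (\<Prod>i=1..w. Var (T i) ^ a i) | A x.
        finite A \<and> (\<forall>a\<in>A. x a \<in> prod_ideal n w I a)}"

definition S_vars :: "nat \<Rightarrow> nat \<Rightarrow> (nat \<Rightarrow> nat) \<Rightarrow> var set" where
  "S_vars n w m = X_vars n \<union> {Z i j | i j. i \<in> {1..w} \<and> j \<in> {1..m i}}"

text \<open>The images of the variables under \<open>\<Phi>\<close> (the value at \<open>T i\<close> is irrelevant).\<close>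

fun \<Phi>_var :: "(nat \<Rightarrow> nat \<Rightarrow> 'k::field mpol) \<Rightarrow> var \<Rightarrow> 'k mpol" where
  "\<Phi>_var f (X k) = Var (X k)"
| "\<Phi>_var f (Z i j) = f i j * Var (T i)"
| "\<Phi>_var f (T i) = Var (T i)"

definition \<Phi> :: "(nat \<Rightarrow> nat \<Rightarrow> 'k::field mpol) \<Rightarrow> 'k mpol \<Rightarrow> 'k mpol" where
  "\<Phi> f p = (\<Sum>m\<in>Poly_Mapping.keys p. Poly_Mapping.single 0 (Poly_Mapping.lookup p m)
               * (\<Prod>v\<in>Poly_Mapping.keys m. \<Phi>_var f v ^ Poly_Mapping.lookup m v))"

text \<open>\<open>\<int>\<^bsup>w+1\<^esup>\<close> consists of the functions vanishing beyond \<open>w\<close>.\<close>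

definition rees_module ::
  "nat \<Rightarrow> nat \<Rightarrow> (nat \<Rightarrow> 'k::field mpol set) \<Rightarrow> (nat \<Rightarrow> nat) \<Rightarrow> (nat \<Rightarrow> nat \<Rightarrow> 'k mpol)
     \<Rightarrow> ('k mpol, nat \<Rightarrow> int, 'k mpol) graded_module" where
  "rees_module n w I d f =
     \<lparr>mod_carrier = multi_rees n w I, mod_act = (\<lambda>s x. \<Phi> f s * x),
      mod_degrees = {a. \<forall>l>w. a l = 0},
      mod_comp = (\<lambda>a. {p \<in> multi_rees n w I. homogeneous (multi_degree d) a p})\<rparr>"

end

theory Submission
  imports Defs "HOL-Library.Countable"
begin

text \<open>
  Multiplication by \<open>T\<^sup>a = T\<^sub>1\<^bsup>a 1\<^esup> \<cdots> T\<^sub>w\<^bsup>a w\<^esup>\<close> identifies the product ideal \<open>I\<^sup>a\<close>, in standard degree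
  \<open>e\<close>, with the component of the multi-Rees algebra of degree \<open>(e - \<Sum> d i * a i, a)\<close>
  (\<open>rees_comp_eq_J\<close>). Hence the algebra, seen as a module over \<open>R = K[X]\<close>, is the direct sum of all
  product ideals, and the theorem compares \<open>Tor\<close> over \<open>R\<close> with \<open>Tor\<close> over \<open>S = R[Z]\<close>.

  Both are Koszul homology: \<open>Tor\<^sup>R\<close> is \<open>H(X; -)\<close> and \<open>Tor\<^sup>S\<close> is \<open>H(X, Z; -)\<close>. Only vanishing in a
  given degree matters, and \<open>tor_vanishes_iff_exact\<close> obtains it by dimension shifting along the
  syzygies, free modules being Koszul-acyclic because the variables form a regular sequence on them.
  In these terms \<open>reg\<^sub>0 = 0\<close> says that \<open>H\<^sub>k(X, Z; -)\<close> of the algebra vanishes in all degrees \<open>b\<close> with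
  \<open>b 0 > k\<close>; the regularity cannot be negative, as \<open>1\<close> is a minimal generator of degree \<open>0\<close>.
  Linearity of the resolution of every \<open>I\<^sup>a\<close> says the same of \<open>H\<^sub>k(X; -)\<close>, since in a minimal
  resolution the degrees of the basis elements of \<open>F\<^sub>k\<close> are the degrees in which \<open>H\<^sub>k(X; I\<^sup>a)\<close> is not
  zero, and none of them lies below \<open>\<Sum> d i * a i + k\<close>.

  It remains to adjoin the \<open>Z\<close> one at a time. The Koszul complex with one more variable is the mapping
  cone of multiplication by that variable, and the degree of a \<open>Z\<close> has coordinate \<open>0\<close> at the index
  \<open>0\<close>. So vanishing in the degrees with \<open>b 0 > k\<close> passes to the cone by the long exact sequence
  (\<open>exact_add_Z\<close>). Conversely, vanishing for the cone makes multiplication by \<open>Z i j\<close> surjective on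
  the homology in these degrees; as it raises the \<open>i\<close>-th coordinate, which is never negative on the
  algebra, the homology is zero by the argument of Nakayama's lemma (\<open>exact_remove_Z\<close>).

  Two existence results are needed because \<open>Tor\<close> is read off from a chosen resolution and linearity
  asks for a minimal one. Both come from the basis theorem for graded submodules of free modules,
  proved with leading terms and Dickson's lemma, by taking a smallest homogeneous generating family
  at each step (\<open>resolution_tower\<close>).
\<close>


section \<open>Polynomials and their homogeneous parts\<close>

abbreviation coeff :: "('a \<Rightarrow>\<^sub>0 'b::zero) \<Rightarrow> 'a \<Rightarrow> 'b" where "coeff \<equiv> Poly_Mapping.lookup"
abbreviation supp :: "('a \<Rightarrow>\<^sub>0 'b::zero) \<Rightarrow> 'a set" where "supp \<equiv> Poly_Mapping.keys"
abbreviation monom :: "'a \<Rightarrow> 'b::zero \<Rightarrow> 'a \<Rightarrow>\<^sub>0 'b" where "monom \<equiv> Poly_Mapping.single"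

lemma supp_add_nat: "supp (m + m') = supp m \<union> supp m'" for m m' :: "'a \<Rightarrow>\<^sub>0 nat"
  by (auto simp: in_keys_iff lookup_add)

lemma coeff_monom_mult:
  fixes p :: "('a::cancel_comm_monoid_add) \<Rightarrow>\<^sub>0 'b::semiring_0"
  shows "coeff (monom k c * p) (k + m) = c * coeff p m"
  by (simp add: lookup_mult lookup_single when_mult)

lemma coeff_monom_mult_eq_0:
  fixes p :: "('a::cancel_comm_monoid_add) \<Rightarrow>\<^sub>0 'b::semiring_0"
  assumes "\<nexists>q. l = k + q"
  shows "coeff (monom k c * p) l = 0"
  using assms by (simp add: lookup_mult lookup_single when_mult)

lemma supp_monom_mult:
  fixes p :: "('a::cancel_comm_monoid_add) \<Rightarrow>\<^sub>0 'b::semiring_0"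
  shows "supp (monom k c * p) \<subseteq> (+) k ` supp p"
proof
  fix l assume l: "l \<in> supp (monom k c * p)"
  then obtain q where q: "l = k + q"
    using coeff_monom_mult_eq_0[of l k c p] by (auto simp: in_keys_iff)
  with l have "q \<in> supp p" by (auto simp: in_keys_iff coeff_monom_mult)
  with q show "l \<in> (+) k ` supp p" by blast
qed

lemma monom_mult_cancel:
  fixes p q :: "('a::cancel_comm_monoid_add) \<Rightarrow>\<^sub>0 'b::semiring_1"
  assumes "monom k 1 * p = monom k 1 * q"
  shows "p = q"
proof (rule poly_mapping_eqI)
  fix m
  have "coeff (monom k 1 * p) (k + m) = coeff (monom k 1 * q) (k + m)" using assms by simp
  then show "coeff p m = coeff q m" by (simp add: coeff_monom_mult)
qed

text \<open>A sum of two exponents is zero only if both are, so no other product of terms is constant.\<close>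

lemma coeff_mult_0:
  fixes p q :: "'k::field mpol"
  shows "coeff (p * q) 0 = coeff p 0 * coeff q 0"
proof -
  have "(0 = l + q') = (l = 0 \<and> q' = 0)" for l q' :: "var \<Rightarrow>\<^sub>0 nat"
    by (auto simp: poly_mapping_eq_iff fun_eq_iff lookup_add)
  then have *: "(\<Sum>q'. (coeff q q' when 0 = l + q')) = (coeff q 0 when l = 0)" for l
    by (simp add: when_def)
  show ?thesis unfolding lookup_mult * by (simp add: mult_when)
qed

lemma sum_monoms: "(\<Sum>m\<in>supp p. monom m (coeff p m)) = p"
proof (rule poly_mapping_eqI)
  fix k
  have "coeff (\<Sum>m\<in>supp p. monom m (coeff p m)) k = (\<Sum>m\<in>supp p. if m = k then coeff p m else 0)"
    by (simp add: lookup_sum lookup_single when_def)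
  also have "\<dots> = coeff p k" by (simp add: sum.delta in_keys_iff)
  finally show "coeff (\<Sum>m\<in>supp p. monom m (coeff p m)) k = coeff p k" .
qed

definition part :: "('a \<Rightarrow> bool) \<Rightarrow> ('a \<Rightarrow>\<^sub>0 'b::zero) \<Rightarrow> 'a \<Rightarrow>\<^sub>0 'b" where
  "part P = Poly_Mapping.mapp (\<lambda>m c. if P m then c else 0)"

lemma coeff_part: "coeff (part P p) m = (if P m then coeff p m else 0)"
  by (simp add: part_def lookup_mapp in_keys_iff when_def)

lemma supp_part: "supp (part P p) = {m \<in> supp p. P m}"
  by (auto simp: in_keys_iff coeff_part split: if_splits)

lemma part_add: "part P (p + q) = part P p + part P q" for p q :: "'a \<Rightarrow>\<^sub>0 'b::comm_monoid_add"
  by (rule poly_mapping_eqI) (simp add: coeff_part lookup_add)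

lemma part_0 [simp]: "part P 0 = 0"
  by (rule poly_mapping_eqI) (simp add: coeff_part)

lemma part_sum: "part P (\<Sum>i\<in>A. g i) = (\<Sum>i\<in>A. part P (g i))"
  for g :: "'c \<Rightarrow> 'a \<Rightarrow>\<^sub>0 'b::comm_monoid_add"
  by (induction A rule: infinite_finite_induct) (auto simp: part_add)

lemma part_split: "p = part P p + part (\<lambda>m. \<not> P m) p" for p :: "'a \<Rightarrow>\<^sub>0 'b::comm_monoid_add"
  by (rule poly_mapping_eqI) (simp add: coeff_part lookup_add)

lemma part_id: "(\<And>m. m \<in> supp p \<Longrightarrow> P m) \<Longrightarrow> part P p = p"
  by (rule poly_mapping_eqI) (auto simp: coeff_part in_keys_iff)

lemma part_eq_0: "(\<And>m. m \<in> supp p \<Longrightarrow> \<not> P m) \<Longrightarrow> part P p = 0"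
  by (rule poly_mapping_eqI) (auto simp: coeff_part in_keys_iff)

abbreviation hpart :: "(var \<Rightarrow> 'g::comm_ring_1) \<Rightarrow> 'g \<Rightarrow> 'k::zero mpol \<Rightarrow> 'k mpol" where
  "hpart dg a \<equiv> part (\<lambda>m. mon_degree dg m = a)"

subsection \<open>Subrings of polynomials\<close>

lemma polys_0 [simp]: "0 \<in> polys V" and polys_1 [simp]: "1 \<in> polys V"
  by (auto simp: polys_def)

lemma polys_add: "p \<in> polys V \<Longrightarrow> q \<in> polys V \<Longrightarrow> p + q \<in> polys V"
  for p q :: "'k::comm_monoid_add mpol"
  using keys_add[of p q] unfolding polys_def by blast

lemma supp_uminus: "supp (- p) = supp p" for p :: "'a \<Rightarrow>\<^sub>0 'b::ab_group_add"
  by (auto simp: in_keys_iff)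

lemma polys_uminus: "p \<in> polys V \<Longrightarrow> - p \<in> polys V" for p :: "'k::ab_group_add mpol"
  by (simp add: polys_def supp_uminus)

lemma polys_diff: "p \<in> polys V \<Longrightarrow> q \<in> polys V \<Longrightarrow> p - q \<in> polys V" for p q :: "'k::ab_group_add mpol"
  using polys_add[of p V "- q"] polys_uminus[of q V] by simp

lemma polys_sum: "(\<And>i. i \<in> A \<Longrightarrow> g i \<in> polys V) \<Longrightarrow> (\<Sum>i\<in>A. g i) \<in> polys V"
  for g :: "'a \<Rightarrow> 'k::comm_monoid_add mpol"
  by (induction A rule: infinite_finite_induct) (auto simp: polys_add)

lemma polys_mult:
  fixes p q :: "'k::field mpol"
  assumes "p \<in> polys V" "q \<in> polys V"
  shows "p * q \<in> polys V"
  unfolding polys_def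
proof clarify
  fix m v assume "m \<in> supp (p * q)" "v \<in> supp m"
  then obtain a b where "m = a + b" "a \<in> supp p" "b \<in> supp q"
    using keys_mult[of p q] by blast
  with \<open>v \<in> supp m\<close> assms show "v \<in> V" by (auto simp: polys_def supp_add_nat)
qed

lemma polys_monom: "supp m \<subseteq> V \<Longrightarrow> monom m c \<in> polys V"
  by (auto simp: polys_def)

lemma polys_Var: "v \<in> V \<Longrightarrow> Var v \<in> polys V"
  by (simp add: Var_def polys_def)

lemma polys_part: "p \<in> polys V \<Longrightarrow> part P p \<in> polys V"
  by (auto simp: polys_def supp_part)

subsection \<open>Degrees\<close>

lemma mon_degree_superset:
  assumes "finite A" "supp m \<subseteq> A"
  shows "mon_degree dg m = (\<Sum>v\<in>A. of_nat (coeff m v) * dg v)"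
  unfolding mon_degree_def using assms by (intro sum.mono_neutral_left) (auto simp: in_keys_iff)

lemma mon_degree_add: "mon_degree dg (m + m') = mon_degree dg m + mon_degree dg m'"
proof -
  let ?A = "supp m \<union> supp m'"
  have "mon_degree dg (m + m') = (\<Sum>v\<in>?A. of_nat (coeff (m + m') v) * dg v)"
    by (rule mon_degree_superset) (auto simp: supp_add_nat)
  also have "\<dots> = (\<Sum>v\<in>?A. of_nat (coeff m v) * dg v) + (\<Sum>v\<in>?A. of_nat (coeff m' v) * dg v)"
    by (simp add: lookup_add distrib_right sum.distrib)
  also have "\<dots> = mon_degree dg m + mon_degree dg m'"
    by (simp add: mon_degree_superset[of ?A])
  finally show ?thesis .
qed

lemma mon_degree_0 [simp]: "mon_degree dg 0 = 0"
  by (simp add: mon_degree_def)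

lemma mon_degree_single: "mon_degree dg (monom v k) = of_nat k * dg v"
  by (simp add: mon_degree_def)

lemma homogeneous_0 [simp]: "homogeneous dg a 0"
  by (simp add: homogeneous_def)

lemma homogeneous_add: "homogeneous dg a p \<Longrightarrow> homogeneous dg a q \<Longrightarrow> homogeneous dg a (p + q)"
  for p q :: "'k::comm_monoid_add mpol"
  using keys_add[of p q] unfolding homogeneous_def by blast

lemma homogeneous_uminus: "homogeneous dg a p \<Longrightarrow> homogeneous dg a (- p)"
  for p :: "'k::ab_group_add mpol"
  by (simp add: homogeneous_def supp_uminus)

lemma homogeneous_diff: "homogeneous dg a p \<Longrightarrow> homogeneous dg a q \<Longrightarrow> homogeneous dg a (p - q)"
  for p q :: "'k::ab_group_add mpol"
  using homogeneous_add[of dg a p "- q"] homogeneous_uminus[of dg a q] by simp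

lemma homogeneous_sum: "(\<And>i. i \<in> A \<Longrightarrow> homogeneous dg a (g i)) \<Longrightarrow> homogeneous dg a (\<Sum>i\<in>A. g i)"
  for g :: "'a \<Rightarrow> 'k::comm_monoid_add mpol"
  by (induction A rule: infinite_finite_induct) (auto simp: homogeneous_add)

lemma homogeneous_mult:
  fixes p q :: "'k::field mpol"
  assumes "homogeneous dg a' p" "homogeneous dg b' q"
  shows "homogeneous dg (a' + b') (p * q)"
  unfolding homogeneous_def
proof
  fix m assume "m \<in> supp (p * q)"
  then obtain a b where "m = a + b" "a \<in> supp p" "b \<in> supp q"
    using keys_mult[of p q] by blast
  with assms show "mon_degree dg m = a' + b'" by (auto simp: homogeneous_def mon_degree_add)
qed

lemma homogeneous_monom: "homogeneous dg (mon_degree dg m) (monom m c)"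
  by (simp add: homogeneous_def)

lemma homogeneous_Var: "homogeneous dg (dg v) (Var v)"
  by (simp add: homogeneous_def Var_def mon_degree_single)

lemma homogeneous_hpart: "homogeneous dg a (hpart dg a p)"
  by (simp add: homogeneous_def supp_part)

lemma hpart_id: "homogeneous dg a p \<Longrightarrow> hpart dg a p = p"
  by (rule part_id) (auto simp: homogeneous_def)

text \<open>If \<open>p\<close> is split into its part of degree \<open>a - b\<close> and the rest, the product of the rest with \<open>q\<close>
  has no monomial of degree \<open>a\<close>.\<close>

lemma hpart_mult:
  fixes p q :: "'k::field mpol"
  assumes "homogeneous dg b q"
  shows "hpart dg a (p * q) = hpart dg (a - b) p * q"
proof -
  let ?p1 = "hpart dg (a - b) p" and ?p2 = "part (\<lambda>m. mon_degree dg m \<noteq> a - b) p"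
  have p: "p = ?p1 + ?p2" by (rule part_split)
  have "homogeneous dg (a - b + b) (?p1 * q)"
    by (rule homogeneous_mult[OF homogeneous_hpart assms])
  then have 1: "hpart dg a (?p1 * q) = ?p1 * q" by (intro hpart_id) simp
  have 2: "hpart dg a (?p2 * q) = 0"
  proof (rule part_eq_0)
    fix m assume "m \<in> supp (?p2 * q)"
    then obtain x y where "m = x + y" "x \<in> supp ?p2" "y \<in> supp q"
      using keys_mult[of ?p2 q] by blast
    with assms show "mon_degree dg m \<noteq> a"
      by (auto simp: homogeneous_def mon_degree_add supp_part algebra_simps)
  qed
  have "hpart dg a (p * q) = hpart dg a (?p1 * q + ?p2 * q)"
    by (subst p) (simp add: distrib_right)
  then show ?thesis using 1 2 by (simp add: part_add)
qed

section \<open>Koszul complexes\<close>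

text \<open>Chains of the Koszul complex on the variables \<open>vs\<close> are functions of words of booleans as long as
  \<open>vs\<close>; a word marks the variables that occur in a basis element of the exterior algebra. The recursion
  is the mapping cone: \<open>lo x\<close> and \<open>hi x\<close> below are the components of a chain without and with the first
  variable. The action \<open>va\<close> of the variables is a parameter, since the same complex is formed for
  ideals, free modules and the multi-Rees algebra.\<close>

primrec kdiff ::
  "(var \<Rightarrow> 'm \<Rightarrow> 'm) \<Rightarrow> var list \<Rightarrow> (bool list \<Rightarrow> 'm) \<Rightarrow> bool list \<Rightarrow> 'm::ab_group_add" where
  "kdiff va [] x = (\<lambda>l. 0)"
| "kdiff va (v # vs) x =
     (\<lambda>l. case l of [] \<Rightarrow> 0
        | b # l' \<Rightarrow> if b then - kdiff va vs (\<lambda>l. x (True # l)) l'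
                    else kdiff va vs (\<lambda>l. x (False # l)) l' + va v (x (True # l')))"

text \<open>The degree that the coefficient at the word \<open>l\<close> must have in a chain of homological degree \<open>q\<close> and
  internal degree \<open>a\<close>, or \<open>None\<close> where the coefficient must vanish. Homological degrees are integers,
  so that the cone lowers \<open>q\<close> by one without a case distinction at zero.\<close>

primrec slot ::
  "(var \<Rightarrow> 'g) \<Rightarrow> var list \<Rightarrow> int \<Rightarrow> 'g::ab_group_add \<Rightarrow> bool list \<Rightarrow> 'g option" where
  "slot dg [] q a l = (if l = [] \<and> q = 0 then Some a else None)"
| "slot dg (v # vs) q a l =
     (case l of [] \<Rightarrow> None
      | b # l' \<Rightarrow> if b then slot dg vs (q - 1) (a - dg v) l' else slot dg vs q a l')"

definition kchain ::
  "(var \<Rightarrow> 'g) \<Rightarrow> ('g \<Rightarrow> 'm set) \<Rightarrow> var list \<Rightarrow> int \<Rightarrow> 'g::ab_group_add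
     \<Rightarrow> (bool list \<Rightarrow> 'm::ab_group_add) set" where
  "kchain dg C vs q a = {x. \<forall>l. case slot dg vs q a l of None \<Rightarrow> x l = 0 | Some b \<Rightarrow> x l \<in> C b}"

text \<open>Vanishing of the \<open>q\<close>-th Koszul homology in degree \<open>a\<close>.\<close>

definition kexact ::
  "(var \<Rightarrow> 'm \<Rightarrow> 'm) \<Rightarrow> (var \<Rightarrow> 'g) \<Rightarrow> ('g \<Rightarrow> 'm::ab_group_add set) \<Rightarrow> var list \<Rightarrow> int
     \<Rightarrow> 'g::ab_group_add \<Rightarrow> bool" where
  "kexact va dg C vs q a \<longleftrightarrow>
     (\<forall>x\<in>kchain dg C vs q a. kdiff va vs x = 0 \<longrightarrow> (\<exists>y\<in>kchain dg C vs (q + 1) a. kdiff va vs y = x))"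

abbreviation lo :: "(bool list \<Rightarrow> 'm) \<Rightarrow> bool list \<Rightarrow> 'm" where "lo x \<equiv> \<lambda>l. x (False # l)"
abbreviation hi :: "(bool list \<Rightarrow> 'm) \<Rightarrow> bool list \<Rightarrow> 'm" where "hi x \<equiv> \<lambda>l. x (True # l)"

definition cone :: "(bool list \<Rightarrow> 'm) \<Rightarrow> (bool list \<Rightarrow> 'm) \<Rightarrow> bool list \<Rightarrow> 'm::zero" where
  "cone x y = (\<lambda>l. case l of [] \<Rightarrow> 0 | b # l' \<Rightarrow> if b then y l' else x l')"

lemma cone_simps [simp]: "cone x y [] = 0" "cone x y (False # l) = x l" "cone x y (True # l) = y l"
  by (simp_all add: cone_def)

lemma lo_add: "(\<lambda>l. (x + y) (b # l)) = (\<lambda>l. x (b # l)) + (\<lambda>l. y (b # l))"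
  by (simp add: fun_eq_iff)

lemma all_bool_list: "(\<forall>l. P l) \<longleftrightarrow> P [] \<and> (\<forall>l. P (False # l)) \<and> (\<forall>l. P (True # l))"
proof (intro iffI allI; (elim conjE)?)
  fix l assume "P []" "\<forall>l. P (False # l)" "\<forall>l. P (True # l)"
  then show "P l" by (cases l; cases "hd l") auto
qed auto

lemma bool_list_fun_eq: "x = y \<longleftrightarrow> x [] = y [] \<and> lo x = lo y \<and> hi x = hi y"
  for x y :: "bool list \<Rightarrow> 'm"
  using all_bool_list[of "\<lambda>l. x l = y l"] by (simp add: fun_eq_iff)

lemma kchainI:
  assumes "\<And>l b. slot dg vs q a l = Some b \<Longrightarrow> x l \<in> C b" "\<And>l. slot dg vs q a l = None \<Longrightarrow> x l = 0"
  shows "x \<in> kchain dg C vs q a"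
  using assms by (simp add: kchain_def split: option.split)

lemma kchainD:
  assumes "x \<in> kchain dg C vs q a"
  shows "slot dg vs q a l = Some b \<Longrightarrow> x l \<in> C b" "slot dg vs q a l = None \<Longrightarrow> x l = 0"
  using assms by (auto simp: kchain_def dest: spec[of _ l])

lemma kchain_Nil: "x \<in> kchain dg C [] q a \<longleftrightarrow> (if q = 0 then x [] \<in> C a else x [] = 0) \<and> lo x = 0 \<and> hi x = 0"
  using all_bool_list[of "\<lambda>l. case slot dg [] q a l of None \<Rightarrow> x l = 0 | Some b \<Rightarrow> x l \<in> C b"]
  by (simp add: kchain_def fun_eq_iff)

lemma kchain_Cons:
  "x \<in> kchain dg C (v # vs) q a \<longleftrightarrow>
     x [] = 0 \<and> lo x \<in> kchain dg C vs q a \<and> hi x \<in> kchain dg C vs (q - 1) (a - dg v)"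
  using all_bool_list[of "\<lambda>l. case slot dg (v # vs) q a l of None \<Rightarrow> x l = 0 | Some b \<Rightarrow> x l \<in> C b"]
  by (simp add: kchain_def)

lemma cone_kchain:
  "x \<in> kchain dg C vs q a \<Longrightarrow> y \<in> kchain dg C vs (q - 1) (a - dg v)
     \<Longrightarrow> cone x y \<in> kchain dg C (v # vs) q a"
  by (simp add: kchain_Cons)

lemma kdiff_Cons: "kdiff va (v # vs) x = cone (kdiff va vs (lo x) + (\<lambda>l. va v (hi x l))) (- kdiff va vs (hi x))"
  by (auto simp: cone_def fun_eq_iff split: list.splits)

lemma cone_eq_iff: "cone x y = z \<longleftrightarrow> z [] = 0 \<and> x = lo z \<and> y = hi z"
  using bool_list_fun_eq[of "cone x y" z] by auto

lemma cone_eq_cone_iff: "cone x y = cone x' y' \<longleftrightarrow> x = x' \<and> y = y'"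
  by (auto simp: cone_eq_iff)

lemma cone_eq_0_iff: "cone x y = 0 \<longleftrightarrow> x = 0 \<and> y = 0"
  by (simp add: cone_eq_iff zero_fun_def[symmetric])

lemma cone_add: "cone x y + cone x' y' = cone (x + x') (y + y')"
  for x y :: "bool list \<Rightarrow> 'm::ab_group_add"
  by (rule iffD2[OF bool_list_fun_eq]) simp

locale var_action =
  fixes va :: "var \<Rightarrow> 'm::ab_group_add \<Rightarrow> 'm"
  assumes va_add: "va v (x + y) = va v x + va v y"
    and va_commute: "va u (va v x) = va v (va u x)"
begin

lemma va_0 [simp]: "va v 0 = 0"
  using va_add[of v 0 0] by simp

lemma va_uminus: "va v (- x) = - va v x"
  using va_add[of v x "- x"] by (simp add: eq_neg_iff_add_eq_0 add.commute)

lemma va_sum: "va v (\<Sum>i\<in>A. g i) = (\<Sum>i\<in>A. va v (g i))"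
  by (induction A rule: infinite_finite_induct) (auto simp: va_add)

lemma vl_0: "(\<lambda>l. va v 0) = 0"
  by (simp add: fun_eq_iff)

lemma vl_add: "(\<lambda>l. va v ((x + y) (g l))) = (\<lambda>l. va v (x (g l))) + (\<lambda>l. va v (y (g l)))"
  by (simp add: fun_eq_iff va_add)

lemma vl_uminus: "(\<lambda>l. va v ((- x) (g l))) = - (\<lambda>l. va v (x (g l)))"
  by (simp add: fun_eq_iff va_uminus)

lemma kdiff_add: "kdiff va vs (x + y) = kdiff va vs x + kdiff va vs y"
proof (induction vs arbitrary: x y)
  case Nil
  show ?case by (simp add: fun_eq_iff)
next
  case (Cons v vs)
  show ?case
    by (simp only: kdiff_Cons lo_add vl_add Cons cone_add minus_add_distrib add_ac)
qed

lemma kdiff_0 [simp]: "kdiff va vs 0 = 0"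
  using kdiff_add[of vs 0 0] by simp

lemma kdiff_uminus: "kdiff va vs (- x) = - kdiff va vs x"
  using kdiff_add[of vs x "- x"] by (simp add: eq_neg_iff_add_eq_0 add.commute)

lemma kdiff_diff: "kdiff va vs (x - y) = kdiff va vs x - kdiff va vs y"
  using kdiff_add[of vs x "- y"] by (simp add: kdiff_uminus)

lemma kdiff_va: "kdiff va vs (\<lambda>l. va v (x l)) = (\<lambda>l. va v (kdiff va vs x l))"
proof (induction vs arbitrary: x)
  case Nil
  show ?case by (simp add: fun_eq_iff)
next
  case (Cons u vs)
  have "(\<lambda>l. va v (cone y z l)) = cone (\<lambda>l. va v (y l)) (\<lambda>l. va v (z l))" for y z
    by (rule iffD2[OF bool_list_fun_eq]) simp
  then show ?case
    by (simp only: kdiff_Cons Cons vl_add vl_uminus va_commute[of u v])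
qed

lemma kdiff_kdiff: "kdiff va vs (kdiff va vs x) = 0"
proof (induction vs arbitrary: x)
  case Nil
  show ?case by (simp add: fun_eq_iff)
next
  case (Cons v vs)
  have "(\<lambda>l. va v ((- kdiff va vs y) l)) = - (\<lambda>l. va v (kdiff va vs y l))" for y
    by (rule vl_uminus)
  then show ?case
    by (simp only: kdiff_Cons cone_simps Cons kdiff_add kdiff_uminus kdiff_va cone_eq_0_iff) simp
qed

end

locale graded_action = var_action va for va :: "var \<Rightarrow> 'm::ab_group_add \<Rightarrow> 'm" +
  fixes dg :: "var \<Rightarrow> 'g::ab_group_add" and V :: "var set" and C :: "'g \<Rightarrow> 'm set"
  assumes C_0 [simp]: "0 \<in> C a"
    and C_diff: "x \<in> C a \<Longrightarrow> y \<in> C a \<Longrightarrow> x - y \<in> C a"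
    and C_va: "v \<in> V \<Longrightarrow> x \<in> C a \<Longrightarrow> va v x \<in> C (a + dg v)"
begin

lemma C_uminus: "x \<in> C a \<Longrightarrow> - x \<in> C a"
  using C_diff[of 0 a x] by simp

lemma C_add: "x \<in> C a \<Longrightarrow> y \<in> C a \<Longrightarrow> x + y \<in> C a"
  using C_diff[of x a "- y"] C_uminus[of y a] by simp

abbreviation "chain \<equiv> kchain dg C"
abbreviation "exact \<equiv> kexact va dg C"
abbreviation "diff \<equiv> kdiff va"

lemma chain_0 [simp]: "0 \<in> chain vs q a"
  by (auto simp: kchain_def split: option.splits)

lemma chain_add: "x \<in> chain vs q a \<Longrightarrow> y \<in> chain vs q a \<Longrightarrow> x + y \<in> chain vs q a"
  by (rule kchainI) (auto simp: kchainD intro!: C_add dest: kchainD)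

lemma chain_uminus: "x \<in> chain vs q a \<Longrightarrow> - x \<in> chain vs q a"
  by (rule kchainI) (auto simp: kchainD intro!: C_uminus dest: kchainD)

lemma chain_diff: "x \<in> chain vs q a \<Longrightarrow> y \<in> chain vs q a \<Longrightarrow> x - y \<in> chain vs q a"
  by (rule kchainI) (auto simp: kchainD intro!: C_diff dest: kchainD)

lemma slot_add: "slot dg vs q (a + b) l = map_option (\<lambda>c. c + b) (slot dg vs q a l)"
proof (induction vs arbitrary: q a l)
  case (Cons v vs)
  show ?case using Cons[of "q - 1" "a - dg v"] Cons[of q a]
    by (simp add: algebra_simps split: list.splits)
qed simp

lemma chain_va:
  assumes "v \<in> V" "x \<in> chain vs q a"
  shows "(\<lambda>l. va v (x l)) \<in> chain vs q (a + dg v)"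
  using assms by (intro kchainI) (auto simp: slot_add kchainD intro!: C_va)

lemma chain_va':
  assumes "v \<in> V" "x \<in> chain vs q (a - dg v)"
  shows "(\<lambda>l. va v (x l)) \<in> chain vs q a"
  using chain_va[OF assms] by simp

lemma chain_kdiff:
  "set vs \<subseteq> V \<Longrightarrow> x \<in> chain vs q a \<Longrightarrow> diff vs x \<in> chain vs (q - 1) a"
proof (induction vs arbitrary: x q a)
  case Nil
  then show ?case using chain_0[of "[]" "q - 1" a] by (simp add: zero_fun_def)
next
  case (Cons v vs)
  then have "lo x \<in> chain vs q a" "hi x \<in> chain vs (q - 1) (a - dg v)" "v \<in> V" "set vs \<subseteq> V"
    by (auto simp: kchain_Cons)
  then show ?case unfolding kdiff_Cons
    by (intro cone_kchain chain_add chain_uminus chain_va' Cons.IH)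
qed

lemma exact_neg: "q < 0 \<Longrightarrow> exact vs q a"
proof -
  have "slot dg vs q a l = None" if "q < 0" for q a l
    using that by (induction vs arbitrary: q a l) (auto split: list.splits)
  moreover assume "q < 0"
  ultimately have "x = 0" if "x \<in> chain vs q a" for x
    using kchainD(2)[OF that] by (auto simp: fun_eq_iff)
  then show ?thesis
    unfolding kexact_def by (intro ballI impI bexI[of _ 0]) auto
qed

text \<open>The complex on \<open>v # vs\<close> is the mapping cone of multiplication by \<open>v\<close> on the complex on \<open>vs\<close>. The last
  assumption is injectivity of \<open>v\<close> on the homology at \<open>q - 1\<close>; it holds when that homology vanishes, and
  also at \<open>q = 1\<close> when \<open>v\<close> is regular modulo \<open>vs\<close>.\<close>

lemma exact_ConsI:
  assumes "v \<in> V" "set vs \<subseteq> V" "exact vs q a"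
    and hi: "\<And>x y. x \<in> chain vs (q - 1) (a - dg v) \<Longrightarrow> diff vs x = 0 \<Longrightarrow> y \<in> chain vs q a
      \<Longrightarrow> diff vs y + (\<lambda>l. va v (x l)) = 0 \<Longrightarrow> \<exists>z\<in>chain vs q (a - dg v). diff vs z = x"
  shows "exact (v # vs) q a"
  unfolding kexact_def
proof (intro ballI impI)
  fix x assume x: "x \<in> chain (v # vs) q a" and "diff (v # vs) x = 0"
  then have c0: "diff vs (lo x) + (\<lambda>l. va v (hi x l)) = 0" and c1: "diff vs (hi x) = 0"
    by (auto simp: kdiff_Cons cone_eq_0_iff simp del: kdiff.simps)
  from x have x0: "lo x \<in> chain vs q a" and x1: "hi x \<in> chain vs (q - 1) (a - dg v)" and "x [] = 0"
    by (auto simp: kchain_Cons)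
  from hi[OF x1 c1 x0 c0] obtain y1 where y1: "y1 \<in> chain vs q (a - dg v)" "diff vs y1 = hi x"
    by blast
  let ?z = "lo x + (\<lambda>l. va v (y1 l))"
  have "?z \<in> chain vs q a" using x0 y1 assms(1) by (intro chain_add chain_va')
  moreover have "diff vs ?z = 0" using c0 y1(2) by (simp add: kdiff_add kdiff_va fun_eq_iff)
  ultimately obtain y0 where y0: "y0 \<in> chain vs (q + 1) a" "diff vs y0 = ?z"
    using assms(3) unfolding kexact_def by blast
  show "\<exists>y\<in>chain (v # vs) (q + 1) a. diff (v # vs) y = x"
  proof
    show "cone y0 (- y1) \<in> chain (v # vs) (q + 1) a"
      using y0 y1 by (intro cone_kchain chain_uminus) auto
    show "diff (v # vs) (cone y0 (- y1)) = x"
      using y0 y1 \<open>x [] = 0\<close>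
      by (simp only: kdiff_Cons cone_eq_iff cone_simps kdiff_uminus vl_uminus) simp
  qed
qed

lemma exact_Cons:
  assumes "v \<in> V" "set vs \<subseteq> V" "exact vs q a" "exact vs (q - 1) (a - dg v)"
  shows "exact (v # vs) q a"
  using assms(4) by (intro exact_ConsI[OF assms(1-3)]) (simp add: kexact_def)

text \<open>Conversely, exactness of the cone makes \<open>v\<close> act surjectively on the homology of the complex on
  \<open>vs\<close>; if the degrees \<open>a - k * dg v\<close> eventually carry no chains, that homology vanishes.\<close>

lemma exact_ConsD_step:
  assumes "v \<in> V" "set vs \<subseteq> V" "exact (v # vs) q a" "exact vs q (a - dg v)"
  shows "exact vs q a"
  unfolding kexact_def
proof (intro ballI impI)
  fix x assume x: "x \<in> chain vs q a" and c: "diff vs x = 0"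
  have "cone x 0 \<in> chain (v # vs) q a" using x by (intro cone_kchain) auto
  moreover have "diff (v # vs) (cone x 0) = 0"
    using c by (simp add: kdiff_Cons cone_eq_0_iff vl_0 zero_fun_def[symmetric] del: kdiff.simps)
  ultimately obtain y where y: "y \<in> chain (v # vs) (q + 1) a" "diff (v # vs) y = cone x 0"
    using assms(3) unfolding kexact_def by blast
  from y have y': "lo y \<in> chain vs (q + 1) a" "hi y \<in> chain vs q (a - dg v)"
    and d: "diff vs (lo y) + (\<lambda>l. va v (hi y l)) = x" "diff vs (hi y) = 0"
    by (auto simp: kchain_Cons kdiff_Cons cone_eq_cone_iff simp del: kdiff.simps)
  from assms(4) y' d obtain u where u: "u \<in> chain vs (q + 1) (a - dg v)" "diff vs u = hi y"
    unfolding kexact_def by blast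
  show "\<exists>y\<in>chain vs (q + 1) a. diff vs y = x"
  proof
    show "lo y + (\<lambda>l. va v (u l)) \<in> chain vs (q + 1) a"
      using y' u assms(1) by (intro chain_add chain_va')
    show "diff vs (lo y + (\<lambda>l. va v (u l))) = x"
      using d u by (simp add: kdiff_add kdiff_va)
  qed
qed

end

subsection \<open>Maps of complexes\<close>

lemma slot_map:
  assumes "\<And>v a. v \<in> set vs \<Longrightarrow> \<beta> (a - dg v) = \<beta> a - dg' v"
  shows "slot dg' vs q (\<beta> a) l = map_option \<beta> (slot dg vs q a l)"
  using assms
proof (induction vs arbitrary: q a l)
  case (Cons v vs)
  have IH: "slot dg' vs q (\<beta> a) l = map_option \<beta> (slot dg vs q a l)" for q a l
    by (rule Cons.IH) (simp add: Cons.prems)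
  have "\<beta> a - dg' v = \<beta> (a - dg v)" by (simp add: Cons.prems)
  then show ?case by (simp add: IH split: list.split)
qed simp

lemma kdiff_map:
  fixes \<psi> :: "'p::ab_group_add \<Rightarrow> 'm::ab_group_add"
  assumes add: "\<And>x y. \<psi> (x + y) = \<psi> x + \<psi> y"
    and va: "\<And>v x. v \<in> set vs \<Longrightarrow> \<psi> (va v x) = va' v (\<psi> x)"
  shows "kdiff va' vs (\<lambda>l. \<psi> (x l)) = (\<lambda>l. \<psi> (kdiff va vs x l))"
proof -
  have 0: "\<psi> 0 = 0" using add[of 0 0] by simp
  have um: "\<psi> (- y) = - \<psi> y" for y
    using add[of y "- y"] 0 by (simp add: eq_neg_iff_add_eq_0 add.commute)
  show ?thesis using va
  proof (induction vs arbitrary: x)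
    case Nil
    show ?case by (simp add: 0)
  next
    case (Cons v vs)
    have cone: "(\<lambda>l. \<psi> (cone y z l)) = cone (\<lambda>l. \<psi> (y l)) (\<lambda>l. \<psi> (z l))" for y z
      by (rule iffD2[OF bool_list_fun_eq]) (simp add: 0)
    have fadd: "(\<lambda>l. \<psi> ((y + z) l)) = (\<lambda>l. \<psi> (y l)) + (\<lambda>l. \<psi> (z l))"
      and fum: "(\<lambda>l. \<psi> ((- y) l)) = - (\<lambda>l. \<psi> (y l))" for y z :: "bool list \<Rightarrow> 'p"
      by (simp_all add: fun_eq_iff add um)
    have IH: "kdiff va' vs (\<lambda>l. \<psi> (y l)) = (\<lambda>l. \<psi> (kdiff va vs y l))" for y
      by (rule Cons.IH) (simp add: Cons.prems)
    have v: "\<psi> (va v y) = va' v (\<psi> y)" for y by (simp add: Cons.prems)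
    show ?case by (simp only: kdiff_Cons cone fadd fum IH v)
  qed
qed

lemma kchain_map:
  assumes "\<And>v a. v \<in> set vs \<Longrightarrow> \<beta> (a - dg v) = \<beta> a - dg' v"
    and "\<And>b. \<psi> ` C b \<subseteq> C' (\<beta> b)" "\<psi> 0 = 0" and x: "x \<in> kchain dg C vs q a"
  shows "(\<lambda>l. \<psi> (x l)) \<in> kchain dg' C' vs q (\<beta> a)"
proof (rule kchainI)
  fix l b assume "slot dg' vs q (\<beta> a) l = Some b"
  then obtain b' where "slot dg vs q a l = Some b'" "b = \<beta> b'"
    using slot_map[of vs \<beta> dg dg', OF assms(1)] by auto
  then show "\<psi> (x l) \<in> C' b" using kchainD(1)[OF x, of l b'] assms(2)[of b'] by blast
next
  fix l assume "slot dg' vs q (\<beta> a) l = None"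
  then show "\<psi> (x l) = 0"
    using slot_map[of vs \<beta> dg dg', OF assms(1)] kchainD(2)[OF x] assms(3) by auto
qed

lemma kchain_lift:
  assumes "\<And>v a. v \<in> set vs \<Longrightarrow> \<beta> (a - dg v) = \<beta> a - dg' v"
    and "\<And>b. C' (\<beta> b) \<subseteq> \<psi> ` C b" "\<psi> 0 = 0" and y: "y \<in> kchain dg' C' vs q (\<beta> a)"
  shows "\<exists>x\<in>kchain dg C vs q a. (\<lambda>l. \<psi> (x l)) = y"
proof -
  have *: "slot dg' vs q (\<beta> a) l = map_option \<beta> (slot dg vs q a l)" for l
    by (rule slot_map) (rule assms(1))
  have "\<exists>x. (case slot dg vs q a l of None \<Rightarrow> x = 0 | Some b \<Rightarrow> x \<in> C b) \<and> \<psi> x = y l" for l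
  proof (cases "slot dg vs q a l")
    case None
    then show ?thesis using kchainD(2)[OF y, of l] * assms(3) by auto
  next
    case (Some b)
    then have "y l \<in> C' (\<beta> b)" using kchainD(1)[OF y, of l] * by auto
    then obtain z where "z \<in> C b" "\<psi> z = y l" using assms(2)[of b] by (metis imageE subsetD)
    then show ?thesis using Some by auto
  qed
  then obtain x where x: "\<And>l. case slot dg vs q a l of None \<Rightarrow> x l = 0 | Some b \<Rightarrow> x l \<in> C b"
    "\<And>l. \<psi> (x l) = y l" by metis
  then have "x \<in> kchain dg C vs q a" unfolding kchain_def by blast
  with x(2) show ?thesis by auto
qed

text \<open>An injective map that commutes with the variables and maps components onto components along \<open>\<beta>\<close>
  transports cycles and boundaries in both directions. Its use is the comparison of a product ideal with
  a strand of the multi-Rees algebra.\<close>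

lemma kexact_iso:
  fixes \<psi> :: "'p::ab_group_add \<Rightarrow> 'm::ab_group_add"
  assumes \<beta>: "\<And>v a. v \<in> set vs \<Longrightarrow> \<beta> (a - dg v) = \<beta> a - dg' v"
    and C: "\<And>b. \<psi> ` C b = C' (\<beta> b)"
    and inj: "\<And>x. \<psi> x = 0 \<Longrightarrow> x = 0"
    and add: "\<And>x y. \<psi> (x + y) = \<psi> x + \<psi> y"
    and va: "\<And>v x. v \<in> set vs \<Longrightarrow> \<psi> (va v x) = va' v (\<psi> x)"
  shows "kexact va dg C vs q a \<longleftrightarrow> kexact va' dg' C' vs q (\<beta> a)"
proof -
  have 0: "\<psi> 0 = 0" using add[of 0 0] by simp
  have inj': "x = y" if "\<psi> x = \<psi> y" for x y
  proof -
    have "\<psi> (x - y) + \<psi> y = \<psi> y" using that by (simp flip: add)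
    then show ?thesis using inj[of "x - y"] by simp
  qed
  have injf: "x = y" if "(\<lambda>l. \<psi> (x l)) = (\<lambda>l. \<psi> (y l))" for x y :: "bool list \<Rightarrow> 'p"
    by (rule ext) (rule inj', rule fun_cong[OF that])
  let ?\<psi> = "\<lambda>x l. \<psi> (x l)"
  have ch: "kchain dg' C' vs q (\<beta> a) = ?\<psi> ` kchain dg C vs q a" for q
  proof (intro equalityI subsetI)
    fix y assume y: "y \<in> kchain dg' C' vs q (\<beta> a)"
    have "\<exists>x\<in>kchain dg C vs q a. ?\<psi> x = y"
      by (rule kchain_lift[where \<beta>=\<beta> and \<psi>=\<psi> and C=C and C'=C' and dg=dg and dg'=dg' and vs=vs and q=q and a=a, OF _ _ 0 y]) (erule \<beta>, simp only: C subset_refl)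
    then show "y \<in> ?\<psi> ` kchain dg C vs q a" by (elim bexE) (rule image_eqI, erule sym)
  next
    fix y assume "y \<in> ?\<psi> ` kchain dg C vs q a"
    then obtain x where x: "x \<in> kchain dg C vs q a" "y = ?\<psi> x" by (rule imageE)
    show "y \<in> kchain dg' C' vs q (\<beta> a)" unfolding x(2)
      by (rule kchain_map[where \<beta>=\<beta> and \<psi>=\<psi> and C=C and C'=C' and dg=dg and dg'=dg' and vs=vs and q=q and a=a, OF _ _ 0 x(1)]) (erule \<beta>, simp only: C subset_refl)
  qed
  have d: "kdiff va' vs (?\<psi> x) = ?\<psi> (kdiff va vs x)" for x
    by (rule kdiff_map[where \<psi>=\<psi> and va=va and va'=va' and vs=vs and x=x]) (rule add, erule va)
  have dd: "kdiff va' vs (?\<psi> x) = ?\<psi> y \<longleftrightarrow> kdiff va vs x = y" for x y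
    unfolding d by (rule iffI, erule injf, erule arg_cong)
  have d0: "kdiff va' vs (?\<psi> x) = 0 \<longleftrightarrow> kdiff va vs x = 0" for x
    using dd[of x 0] by (simp add: 0 zero_fun_def)
  show ?thesis unfolding kexact_def ch
    by (simp only: ball_simps bex_simps d0 dd)
qed

text \<open>The component of degree \<open>a\<close> of \<open>\<mm> M\<close>, where \<open>\<mm>\<close> is generated by \<open>vs\<close>.\<close>

primrec irrelevant_part ::
  "(var \<Rightarrow> 'm \<Rightarrow> 'm) \<Rightarrow> (var \<Rightarrow> 'g) \<Rightarrow> ('g \<Rightarrow> 'm::ab_group_add set) \<Rightarrow> var list \<Rightarrow> 'g::ab_group_add \<Rightarrow> 'm set"
where
  "irrelevant_part va dg C [] a = {0}"
| "irrelevant_part va dg C (v # vs) a = {x + va v y | x y. x \<in> irrelevant_part va dg C vs a \<and> y \<in> C (a - dg v)}"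

text \<open>The chain of homological degree \<open>0\<close> with coefficient \<open>m\<close>.\<close>

primrec emb :: "'v list \<Rightarrow> 'm \<Rightarrow> bool list \<Rightarrow> 'm::ab_group_add" where
  "emb [] m = (\<lambda>l. if l = [] then m else 0)"
| "emb (v # vs) m = cone (emb vs m) 0"

lemma emb_eq_iff: "emb vs m = emb vs m' \<longleftrightarrow> m = m'"
proof (induction vs)
  case Nil
  show ?case by (auto simp: fun_eq_iff)
qed (simp add: cone_eq_cone_iff)

lemma emb_add: "emb vs (m + m') = emb vs m + emb vs m'"
proof (induction vs)
  case Nil
  show ?case by (simp add: fun_eq_iff)
next
  case (Cons v vs)
  show ?case by (simp only: emb.simps Cons cone_add add_0_left)
qed

context graded_action
begin

lemma chain_neg: "q < 0 \<Longrightarrow> x \<in> chain vs q a \<Longrightarrow> x = 0"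
proof (induction vs arbitrary: q a x)
  case Nil
  then have "x [] = 0" "lo x = 0" "hi x = 0" by (simp_all add: kchain_Nil)
  then show ?case by (intro iffD2[OF bool_list_fun_eq]) (simp add: fun_eq_iff)
next
  case (Cons v vs)
  then have "lo x \<in> chain vs q a" "hi x \<in> chain vs (q - 1) (a - dg v)" "x [] = 0"
    by (simp_all add: kchain_Cons)
  with Cons.IH[of q "lo x" a] Cons.IH[of "q - 1" "hi x" "a - dg v"] Cons.prems(1)
  have "lo x = 0" "hi x = 0" "x [] = 0" by auto
  then show ?case by (intro iffD2[OF bool_list_fun_eq]) (simp add: fun_eq_iff)
qed

lemma va_cone: "(\<lambda>l. va v (cone y z l)) = cone (\<lambda>l. va v (y l)) (\<lambda>l. va v (z l))"
  by (rule iffD2[OF bool_list_fun_eq]) simp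

lemma va_emb: "(\<lambda>l. va v (emb vs m l)) = emb vs (va v m)"
proof (induction vs)
  case Nil
  show ?case by (rule ext) simp
next
  case (Cons u vs)
  show ?case by (simp only: emb.simps va_cone Cons zero_fun_apply va_0) (simp only: zero_fun_def)
qed

lemma chain_0_iff: "x \<in> chain vs 0 a \<longleftrightarrow> (\<exists>m\<in>C a. x = emb vs m)"
proof (induction vs arbitrary: x)
  case Nil
  have "x = emb [] m \<longleftrightarrow> x [] = m \<and> lo x = 0 \<and> hi x = 0" for m
    using bool_list_fun_eq[of x "emb [] m"] by (simp only: emb.simps list.distinct if_True if_False refl zero_fun_def)
  then show ?case unfolding kchain_Nil by auto
next
  case (Cons v vs)
  have "x \<in> chain (v # vs) 0 a \<longleftrightarrow> x [] = 0 \<and> lo x \<in> chain vs 0 a \<and> hi x = 0"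
    using chain_neg[of "-1" "hi x" vs "a - dg v"] unfolding kchain_Cons by auto
  also have "\<dots> \<longleftrightarrow> (\<exists>m\<in>C a. cone (emb vs m) 0 = x)"
    unfolding Cons.IH cone_eq_iff by metis
  finally show ?case unfolding emb.simps by metis
qed

text \<open>In homological degree \<open>0\<close> the Koszul homology is \<open>M / \<mm> M\<close>.\<close>

lemma boundary_emb_iff:
  assumes "set vs \<subseteq> V"
  shows "(\<exists>p\<in>chain vs 1 a. diff vs p = emb vs m) \<longleftrightarrow> m \<in> irrelevant_part va dg C vs a"
  using assms
proof (induction vs arbitrary: a m)
  case Nil
  have "(\<lambda>l. 0) = emb [] m \<longleftrightarrow> m = 0" by (auto simp: fun_eq_iff)
  moreover have "0 \<in> chain [] 1 a" by (rule chain_0)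
  ultimately show ?case unfolding kdiff.simps irrelevant_part.simps by blast
next
  case (Cons v vs)
  have V: "set vs \<subseteq> V" "v \<in> V" using Cons.prems by auto
  show ?case
  proof
    assume "\<exists>p\<in>chain (v # vs) 1 a. diff (v # vs) p = emb (v # vs) m"
    then obtain p where p: "p \<in> chain (v # vs) 1 a" "diff (v # vs) p = emb (v # vs) m" by blast
    then have p0: "lo p \<in> chain vs 1 a" and p1: "hi p \<in> chain vs 0 (a - dg v)"
      and d: "diff vs (lo p) + (\<lambda>l. va v (hi p l)) = emb vs m"
      by (auto simp: kchain_Cons kdiff_Cons cone_eq_cone_iff simp del: kdiff.simps)
    from p1 obtain m1 where m1: "m1 \<in> C (a - dg v)" "hi p = emb vs m1" by (auto simp: chain_0_iff)
    have "diff vs (lo p) \<in> chain vs 0 a" using chain_kdiff[OF V(1) p0] by simp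
    then obtain m0 where m0: "diff vs (lo p) = emb vs m0" by (auto simp: chain_0_iff)
    then have "m0 \<in> irrelevant_part va dg C vs a" using Cons.IH[OF V(1)] p0 by blast
    moreover have "m = m0 + va v m1"
      using d by (simp add: m0 fun_cong[OF m1(2)] va_emb emb_add[symmetric] emb_eq_iff)
    ultimately show "m \<in> irrelevant_part va dg C (v # vs) a" using m1 by auto
  next
    assume "m \<in> irrelevant_part va dg C (v # vs) a"
    then obtain m0 m1 where m: "m = m0 + va v m1" "m0 \<in> irrelevant_part va dg C vs a" "m1 \<in> C (a - dg v)" by auto
    then obtain p0 where p0: "p0 \<in> chain vs 1 a" "diff vs p0 = emb vs m0" using Cons.IH[OF V(1)] by blast
    have m1: "emb vs m1 \<in> chain vs 0 (a - dg v)" using m(3) by (auto simp: chain_0_iff)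
    have "diff vs (emb vs m1) = 0"
      using chain_neg[OF _ chain_kdiff[OF V(1) m1]] by simp
    then have "diff (v # vs) (cone p0 (emb vs m1)) = emb (v # vs) m"
      using p0 m(1) by (simp add: kdiff_Cons va_emb emb_add[symmetric] del: kdiff.simps)
    moreover have "cone p0 (emb vs m1) \<in> chain (v # vs) 1 a"
      using p0 m1 by (intro cone_kchain) auto
    ultimately show "\<exists>p\<in>chain (v # vs) 1 a. diff (v # vs) p = emb (v # vs) m" by blast
  qed
qed

lemma exact_0_iff:
  assumes "set vs \<subseteq> V"
  shows "exact vs 0 a \<longleftrightarrow> C a \<subseteq> irrelevant_part va dg C vs a"
proof -
  have "diff vs x = 0" if "x \<in> chain vs 0 a" for x
    using chain_neg[OF _ chain_kdiff[OF assms that]] by simp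
  then have "exact vs 0 a \<longleftrightarrow> (\<forall>x\<in>chain vs 0 a. \<exists>y\<in>chain vs 1 a. diff vs y = x)"
    by (auto simp: kexact_def)
  also have "\<dots> \<longleftrightarrow> (\<forall>m\<in>C a. \<exists>y\<in>chain vs 1 a. diff vs y = emb vs m)"
    using chain_0_iff[of _ vs a] by metis
  also have "\<dots> \<longleftrightarrow> C a \<subseteq> irrelevant_part va dg C vs a"
    unfolding boundary_emb_iff[OF assms] by blast
  finally show ?thesis .
qed

end

subsection \<open>Short exact sequences\<close>

locale graded_surjection =
  P: graded_action vaP dg V CP + M: graded_action vaM dg V CM
  for vaP :: "var \<Rightarrow> 'p::ab_group_add \<Rightarrow> 'p" and vaM :: "var \<Rightarrow> 'm::ab_group_add \<Rightarrow> 'm"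
    and dg :: "var \<Rightarrow> 'g::ab_group_add" and V :: "var set"
    and CP :: "'g \<Rightarrow> 'p set" and CM :: "'g \<Rightarrow> 'm set" +
  fixes \<pi> :: "'p \<Rightarrow> 'm"
  assumes map_add: "\<pi> (x + y) = \<pi> x + \<pi> y"
    and map_va: "v \<in> V \<Longrightarrow> \<pi> (vaP v x) = vaM v (\<pi> x)"
    and map_surj: "\<pi> ` CP a = CM a"
begin

lemma map_0 [simp]: "\<pi> 0 = 0"
  using map_add[of 0 0] by simp

lemma map_uminus: "\<pi> (- x) = - \<pi> x"
  using map_add[of x "- x"] by (simp add: eq_neg_iff_add_eq_0 add.commute)

lemma map_diff: "\<pi> (x - y) = \<pi> x - \<pi> y"
  using map_add[of x "- y"] by (simp add: map_uminus)

definition ker :: "'g \<Rightarrow> 'p set" where "ker a = {x \<in> CP a. \<pi> x = 0}"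

sublocale N: graded_action vaP dg V ker
  by unfold_locales (auto simp: ker_def map_diff map_va P.C_diff P.C_va)

lemma chain_map: "x \<in> P.chain vs q a \<Longrightarrow> (\<lambda>l. \<pi> (x l)) \<in> M.chain vs q a"
  using kchain_map[of vs id dg dg \<pi> CP CM x q a] map_surj by simp

lemma chain_lift: "y \<in> M.chain vs q a \<Longrightarrow> \<exists>x\<in>P.chain vs q a. (\<lambda>l. \<pi> (x l)) = y"
  using kchain_lift[of vs id dg dg CM \<pi> CP y q a] map_surj by simp

lemma chain_ker_iff: "x \<in> N.chain vs q a \<longleftrightarrow> x \<in> P.chain vs q a \<and> (\<lambda>l. \<pi> (x l)) = 0"
proof safe
  assume x: "x \<in> N.chain vs q a"
  show "x \<in> P.chain vs q a"
    using kchainD[OF x] by (intro kchainI) (auto simp: ker_def)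
  have "\<pi> (x l) = 0" for l
    using kchainD[OF x, of l] by (cases "slot dg vs q a l") (auto simp: ker_def)
  then show "(\<lambda>l. \<pi> (x l)) = 0" by (simp add: fun_eq_iff)
next
  assume x: "x \<in> P.chain vs q a" and "(\<lambda>l. \<pi> (x l)) = 0"
  then have "\<pi> (x l) = 0" for l by (simp add: fun_eq_iff)
  with x show "x \<in> N.chain vs q a" by (intro kchainI) (auto simp: ker_def kchainD)
qed

lemma diff_map: "set vs \<subseteq> V \<Longrightarrow> M.diff vs (\<lambda>l. \<pi> (x l)) = (\<lambda>l. \<pi> (P.diff vs x l))"
  by (rule kdiff_map) (auto simp: map_add map_va)

text \<open>Part of the long exact sequence of \<open>0 \<rightarrow> N \<rightarrow> P \<rightarrow> M \<rightarrow> 0\<close>: if the homology of \<open>P\<close> vanishes at \<open>q + 1\<close>,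
  the connecting map embeds that of \<open>M\<close> into the homology of \<open>N\<close> at \<open>q\<close>, and its image consists of
  the classes that die in \<open>P\<close>. The condition on the right says that there are no such classes but zero.\<close>

lemma exact_Suc_iff:
  assumes V: "set vs \<subseteq> V" and P: "P.exact vs (q + 1) a"
  shows "M.exact vs (q + 1) a \<longleftrightarrow>
    (\<forall>u\<in>N.chain vs q a. (\<exists>p\<in>P.chain vs (q + 1) a. P.diff vs p = u)
        \<longrightarrow> (\<exists>p\<in>N.chain vs (q + 1) a. P.diff vs p = u))" (is "_ \<longleftrightarrow> ?W")
proof
  assume M: "M.exact vs (q + 1) a"
  show ?W
  proof (intro ballI impI, elim bexE)
    fix u p assume u: "u \<in> N.chain vs q a" and p: "p \<in> P.chain vs (q + 1) a" "P.diff vs p = u"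
    let ?x = "\<lambda>l. \<pi> (p l)"
    have "?x \<in> M.chain vs (q + 1) a" using p by (intro chain_map)
    moreover have "M.diff vs ?x = 0" using u p by (simp add: diff_map[OF V] chain_ker_iff)
    ultimately obtain y where y: "y \<in> M.chain vs (q + 1 + 1) a" "M.diff vs y = ?x"
      using M unfolding kexact_def by blast
    obtain z where z: "z \<in> P.chain vs (q + 1 + 1) a" "(\<lambda>l. \<pi> (z l)) = y" using chain_lift[OF y(1)] by blast
    have "P.diff vs z \<in> P.chain vs (q + 1) a" using P.chain_kdiff[OF V z(1)] by (simp only: add_diff_cancel_right')
    then have "p - P.diff vs z \<in> P.chain vs (q + 1) a" using p by (intro P.chain_diff)
    moreover have "(\<lambda>l. \<pi> (P.diff vs z l)) = ?x" using y z by (simp flip: diff_map[OF V])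
    then have "(\<lambda>l. \<pi> ((p - P.diff vs z) l)) = 0" by (simp add: map_diff fun_eq_iff)
    ultimately have "p - P.diff vs z \<in> N.chain vs (q + 1) a" by (simp add: chain_ker_iff)
    moreover have "P.diff vs (p - P.diff vs z) = u" using p by (simp add: P.kdiff_diff P.kdiff_kdiff)
    ultimately show "\<exists>p\<in>N.chain vs (q + 1) a. P.diff vs p = u" by blast
  qed
next
  assume W: ?W
  show "M.exact vs (q + 1) a" unfolding kexact_def
  proof (intro ballI impI)
    fix x assume x: "x \<in> M.chain vs (q + 1) a" "M.diff vs x = 0"
    obtain p where p: "p \<in> P.chain vs (q + 1) a" "(\<lambda>l. \<pi> (p l)) = x" using chain_lift[OF x(1)] by blast
    have "P.diff vs p \<in> P.chain vs q a" using P.chain_kdiff[OF V p(1)] by simp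
    moreover have "(\<lambda>l. \<pi> (P.diff vs p l)) = 0" using x p by (simp flip: diff_map[OF V])
    ultimately have "P.diff vs p \<in> N.chain vs q a" by (simp add: chain_ker_iff)
    then obtain n where n: "n \<in> N.chain vs (q + 1) a" "P.diff vs n = P.diff vs p" using W p(1) by blast
    then have "p - n \<in> P.chain vs (q + 1) a" using p by (intro P.chain_diff) (simp_all add: chain_ker_iff)
    moreover have "P.diff vs (p - n) = 0" using n by (simp add: P.kdiff_diff)
    ultimately obtain y where y: "y \<in> P.chain vs (q + 1 + 1) a" "P.diff vs y = p - n"
      using P unfolding kexact_def by blast
    have "M.diff vs (\<lambda>l. \<pi> (y l)) = (\<lambda>l. \<pi> ((p - n) l))" using y by (simp add: diff_map[OF V])
    also have "\<dots> = x" using n p by (simp add: map_diff chain_ker_iff fun_eq_iff)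
    finally show "\<exists>y\<in>M.chain vs (q + 1 + 1) a. M.diff vs y = x" using chain_map[OF y(1)] by blast
  qed
qed

text \<open>If the homology of \<open>P\<close> vanishes at \<open>q\<close> as well, every class of \<open>N\<close> at \<open>q\<close> dies in \<open>P\<close>, and the
  connecting map is onto.\<close>

lemma exact_shift:
  assumes V: "set vs \<subseteq> V" and P: "P.exact vs q a" "P.exact vs (q + 1) a"
  shows "M.exact vs (q + 1) a \<longleftrightarrow> N.exact vs q a"
  unfolding exact_Suc_iff[OF V P(2)]
proof
  assume *: "\<forall>u\<in>N.chain vs q a. (\<exists>p\<in>P.chain vs (q + 1) a. P.diff vs p = u)
      \<longrightarrow> (\<exists>p\<in>N.chain vs (q + 1) a. P.diff vs p = u)"
  show "N.exact vs q a" unfolding kexact_def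
  proof (intro ballI impI)
    fix x assume "x \<in> N.chain vs q a" "P.diff vs x = 0"
    moreover from this have "\<exists>p\<in>P.chain vs (q + 1) a. P.diff vs p = x"
      using P(1) by (auto simp: kexact_def chain_ker_iff)
    ultimately show "\<exists>y\<in>N.chain vs (q + 1) a. P.diff vs y = x" using * by blast
  qed
next
  assume "N.exact vs q a"
  then show "\<forall>u\<in>N.chain vs q a. (\<exists>p\<in>P.chain vs (q + 1) a. P.diff vs p = u)
      \<longrightarrow> (\<exists>p\<in>N.chain vs (q + 1) a. P.diff vs p = u)"
    using P.kdiff_kdiff by (auto simp: kexact_def)
qed

text \<open>At the lower end \<open>P\<close> has homology in degree \<open>0\<close>, so that a kernel appears instead of all of the
  homology of \<open>N\<close>.\<close>

lemma exact_1_iff: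
  assumes V: "set vs \<subseteq> V" and P: "P.exact vs 1 a"
  shows "M.exact vs 1 a \<longleftrightarrow> ker a \<inter> irrelevant_part vaP dg CP vs a \<subseteq> irrelevant_part vaP dg ker vs a"
proof -
  have "M.exact vs 1 a \<longleftrightarrow> (\<forall>m\<in>ker a. (\<exists>p\<in>P.chain vs 1 a. P.diff vs p = emb vs m)
        \<longrightarrow> (\<exists>p\<in>N.chain vs 1 a. P.diff vs p = emb vs m))"
    using exact_Suc_iff[of vs 0 a] V P N.chain_0_iff[of _ vs a] unfolding add_0_left by metis
  then show ?thesis unfolding P.boundary_emb_iff[OF V] N.boundary_emb_iff[OF V] by blast
qed

lemma irrelevant_part_map:
  "set vs \<subseteq> V \<Longrightarrow> irrelevant_part vaM dg CM vs a = \<pi> ` irrelevant_part vaP dg CP vs a"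
proof (induction vs)
  case (Cons v vs)
  then have IH: "irrelevant_part vaM dg CM vs a = \<pi> ` irrelevant_part vaP dg CP vs a" and v: "v \<in> V" by auto
  have eq: "{x + vaM v y |x y. x \<in> \<pi> ` A \<and> y \<in> \<pi> ` B} = \<pi> ` {x + vaP v y |x y. x \<in> A \<and> y \<in> B}" for A B
  proof (intro equalityI subsetI)
    fix z assume "z \<in> {x + vaM v y |x y. x \<in> \<pi> ` A \<and> y \<in> \<pi> ` B}"
    then obtain x y where "z = \<pi> (x + vaP v y)" "x \<in> A" "y \<in> B" by (auto simp: map_add map_va[OF v])
    then show "z \<in> \<pi> ` {x + vaP v y |x y. x \<in> A \<and> y \<in> B}" by blast
  next
    fix z assume "z \<in> \<pi> ` {x + vaP v y |x y. x \<in> A \<and> y \<in> B}"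
    then obtain x y where "z = \<pi> x + vaM v (\<pi> y)" "x \<in> A" "y \<in> B" by (auto simp: map_add map_va[OF v])
    then show "z \<in> {x + vaM v y |x y. x \<in> \<pi> ` A \<and> y \<in> \<pi> ` B}" by blast
  qed
  show ?case by (simp only: irrelevant_part.simps IH eq[symmetric] map_surj)
qed simp

end

section \<open>Free modules\<close>

definition fcomp ::
  "var set \<Rightarrow> (var \<Rightarrow> 'g::comm_ring_1) \<Rightarrow> nat \<Rightarrow> (nat \<Rightarrow> 'g) \<Rightarrow> 'g \<Rightarrow> (nat \<Rightarrow> 'k::field mpol) set" where
  "fcomp V dg r s a = {x \<in> free_mod V r. \<forall>j<r. homogeneous dg (a - s j) (x j)}"

definition fva :: "var \<Rightarrow> (nat \<Rightarrow> 'k::field mpol) \<Rightarrow> nat \<Rightarrow> 'k mpol" where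
  "fva v x = (\<lambda>j. Var v * x j)"

lemma fcomp_iff:
  "x \<in> fcomp V dg r s a \<longleftrightarrow> (\<forall>j<r. x j \<in> polys V \<and> homogeneous dg (a - s j) (x j)) \<and> (\<forall>j\<ge>r. x j = 0)"
  by (auto simp: fcomp_def free_mod_def)

lemma supp_Var_mult: "supp (Var v * q) = (+) (monom v 1) ` supp q" for q :: "'k::field mpol"
proof
  show "supp (Var v * q) \<subseteq> (+) (monom v 1) ` supp q"
    unfolding Var_def by (rule supp_monom_mult)
  show "(+) (monom v 1) ` supp q \<subseteq> supp (Var v * q)"
    by (auto simp: Var_def in_keys_iff coeff_monom_mult)
qed

lemma polys_Var_multD: "Var v * q \<in> polys V \<Longrightarrow> q \<in> polys V" for q :: "'k::field mpol"
  by (auto simp: polys_def supp_Var_mult supp_add_nat)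

lemma homogeneous_Var_multD: "homogeneous dg a (Var v * q) \<Longrightarrow> homogeneous dg (a - dg v) q"
  for q :: "'k::field mpol"
  by (auto simp: homogeneous_def supp_Var_mult mon_degree_add mon_degree_single)

lemma homogeneous_Var_mult: "homogeneous dg (a - dg v) q \<Longrightarrow> homogeneous dg a (Var v * q)"
  for q :: "'k::field mpol"
  using homogeneous_mult[OF homogeneous_Var[of dg v], of "a - dg v" q] by simp

lemma divide_Var:
  fixes p :: "'k::field mpol"
  assumes "\<And>m. m \<in> supp p \<Longrightarrow> v \<in> supp m"
  shows "\<exists>q. p = Var v * q"
proof
  let ?e = "monom v (1::nat)"
  have "p = (\<Sum>m\<in>supp p. monom m (coeff p m))" by (rule sum_monoms[symmetric])
  also have "\<dots> = (\<Sum>m\<in>supp p. Var v * monom (m - ?e) (coeff p m))"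
  proof (rule sum.cong)
    fix m assume "m \<in> supp p"
    then have "v \<in> supp m" by (rule assms)
    then have "?e + (m - ?e) = m"
      by (intro poly_mapping_eqI) (auto simp: lookup_add lookup_minus lookup_single when_def in_keys_iff)
    then show "monom m (coeff p m) = Var v * monom (m - ?e) (coeff p m)"
      by (simp add: Var_def mult_single)
  qed simp
  also have "\<dots> = Var v * (\<Sum>m\<in>supp p. monom (m - ?e) (coeff p m))"
    by (simp add: sum_distrib_left)
  finally show "p = Var v * (\<Sum>m\<in>supp p. monom (m - ?e) (coeff p m))" .
qed

global_interpretation fva: var_action "fva :: var \<Rightarrow> (nat \<Rightarrow> 'k::field mpol) \<Rightarrow> _"
  by unfold_locales (auto simp: fva_def fun_eq_iff algebra_simps)

lemma graded_action_fcomp: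
  "graded_action fva dg V (fcomp V dg r s :: _ \<Rightarrow> (nat \<Rightarrow> 'k::field mpol) set)"
proof
  fix a and v x and y :: "nat \<Rightarrow> 'k mpol"
  show "0 \<in> fcomp V dg r s a" by (simp add: fcomp_iff)
  show "x - y \<in> fcomp V dg r s a" if "x \<in> fcomp V dg r s a" "y \<in> fcomp V dg r s a"
    using that by (auto simp: fcomp_iff intro!: polys_diff homogeneous_diff)
  show "fva v x \<in> fcomp V dg r s (a + dg v)" if "v \<in> V" "x \<in> fcomp V dg r s a" for x :: "nat \<Rightarrow> 'k mpol"
    using that
    by (auto simp: fcomp_iff fva_def add_diff_eq[symmetric] intro!: polys_mult polys_Var homogeneous_Var_mult)
qed

definition meets :: "var list \<Rightarrow> (var \<Rightarrow>\<^sub>0 nat) \<Rightarrow> bool" where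
  "meets vs m \<longleftrightarrow> supp m \<inter> set vs \<noteq> {}"

text \<open>By induction on \<open>vs\<close>: the terms that involve an old variable go to the first summand, and the
  remaining ones are divisible by the new variable.\<close>

lemma irrelevant_part_fcomp:
  assumes "set vs \<subseteq> V"
  shows "irrelevant_part fva dg (fcomp V dg r s :: _ \<Rightarrow> (nat \<Rightarrow> 'k::field mpol) set) vs a =
     {x \<in> fcomp V dg r s a. \<forall>j. \<forall>m\<in>supp (x j). meets vs m}"
  using assms
proof (induction vs)
  case Nil
  have "(0 :: nat \<Rightarrow> 'k mpol) \<in> fcomp V dg r s a" by (simp add: fcomp_iff)
  then show ?case by (auto simp: meets_def fun_eq_iff)
next
  case (Cons v vs)
  let ?C = "fcomp V dg r s :: _ \<Rightarrow> (nat \<Rightarrow> 'k mpol) set"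
  interpret graded_action fva dg V ?C by (rule graded_action_fcomp)
  have v: "v \<in> V" "set vs \<subseteq> V" using Cons.prems by auto
  note IH = Cons.IH[OF v(2)]
  show ?case
  proof (intro equalityI subsetI)
    fix z assume "z \<in> irrelevant_part fva dg ?C (v # vs) a"
    then obtain x y where z: "z = x + fva v y" and x: "x \<in> ?C a" "\<And>j m. m \<in> supp (x j) \<Longrightarrow> meets vs m"
      and y: "y \<in> ?C (a - dg v)" by (auto simp: IH)
    have "z \<in> ?C a" unfolding z using x(1) C_va[OF v(1) y] by (intro C_add) auto
    moreover have "meets (v # vs) m" if "m \<in> supp (z j)" for j m
    proof -
      have "m \<in> supp (x j) \<or> m \<in> supp (Var v * y j)"
        using that keys_add[of "x j" "Var v * y j"] by (auto simp: z fva_def)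
      then show ?thesis using x(2)[of m j]
        by (auto simp: meets_def supp_Var_mult supp_add_nat)
    qed
    ultimately show "z \<in> {x \<in> ?C a. \<forall>j. \<forall>m\<in>supp (x j). meets (v # vs) m}" by blast
  next
    fix z assume "z \<in> {x \<in> ?C a. \<forall>j. \<forall>m\<in>supp (x j). meets (v # vs) m}"
    then have z: "z \<in> ?C a" "\<And>j m. m \<in> supp (z j) \<Longrightarrow> meets (v # vs) m" by auto
    define x where "x = (\<lambda>j. part (meets vs) (z j))"
    have "\<exists>q. part (\<lambda>m. \<not> meets vs m) (z j) = Var v * q" for j
      using z(2)[of _ j] by (intro divide_Var) (auto simp: supp_part meets_def)
    then obtain y where y: "\<And>j. part (\<lambda>m. \<not> meets vs m) (z j) = Var v * y j" by metis
    have zxy: "z = x + fva v y"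
      by (rule ext) (simp add: x_def fva_def y[symmetric] part_split[symmetric])
    have "x \<in> ?C a" using z(1)
      by (auto simp: x_def fcomp_iff homogeneous_def supp_part intro!: polys_part)
    then have "x \<in> irrelevant_part fva dg ?C vs a"
      unfolding IH by (auto simp: x_def supp_part)
    moreover have "y \<in> ?C (a - dg v)"
      unfolding fcomp_iff
    proof (intro conjI allI impI)
      fix j assume j: "j < r"
      have "Var v * y j \<in> polys V" "homogeneous dg (a - s j) (Var v * y j)"
        using z(1) j by (auto simp: y[symmetric] fcomp_iff homogeneous_def supp_part intro!: polys_part)
      then show "y j \<in> polys V" "homogeneous dg (a - dg v - s j) (y j)"
        using polys_Var_multD[of v "y j" V] homogeneous_Var_multD[of dg "a - s j" v "y j"]
        by (auto simp: diff_right_commute)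
    next
      fix j assume "r \<le> j"
      then have "Var v * y j = 0" using z(1) by (simp add: y[symmetric] fcomp_iff)
      then show "y j = 0" using supp_Var_mult[of v "y j"] by simp
    qed
    ultimately show "z \<in> irrelevant_part fva dg ?C (v # vs) a" using zxy by auto
  qed
qed

text \<open>The variables form a regular sequence on a free module: if every monomial of \<open>v * p\<close> involves one of
  the other variables \<open>vs\<close>, so does every monomial of \<open>p\<close>.\<close>

lemma exact_fcomp:
  assumes "distinct vs" "set vs \<subseteq> V" "q \<ge> 1"
  shows "kexact fva dg (fcomp V dg r s :: _ \<Rightarrow> (nat \<Rightarrow> 'k::field mpol) set) vs q a"
  using assms
proof (induction vs arbitrary: q a)
  case (Nil q a)
  let ?C = "fcomp V dg r s :: _ \<Rightarrow> (nat \<Rightarrow> 'k mpol) set"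
  interpret graded_action fva dg V ?C by (rule graded_action_fcomp)
  have "x = 0" if "x \<in> chain [] q a" for x
    using that Nil(3) kchainD(2)[OF that] by (auto simp: fun_eq_iff)
  moreover have "0 \<in> chain [] (q + 1) a" by (rule chain_0)
  ultimately show ?case unfolding kexact_def by (metis fva.kdiff_0)
next
  case (Cons v vs q a)
  let ?C = "fcomp V dg r s :: _ \<Rightarrow> (nat \<Rightarrow> 'k mpol) set"
  interpret graded_action fva dg V ?C by (rule graded_action_fcomp)
  have v: "v \<in> V" "set vs \<subseteq> V" "distinct vs" "v \<notin> set vs" using Cons.prems by auto
  show ?case
  proof (cases "q = 1")
    case False
    then show ?thesis using Cons v by (intro exact_Cons) auto
  next
    case q: True
    show ?thesis unfolding q
    proof (rule exact_ConsI[OF v(1,2)])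
      show "exact vs 1 a" using Cons.IH v by simp
      fix x y assume "x \<in> chain vs (1 - 1) (a - dg v)" and y: "y \<in> chain vs 1 a"
        and d: "diff vs y + (\<lambda>l. fva v (x l)) = 0"
      then obtain m where m: "m \<in> ?C (a - dg v)" and x: "x = emb vs m" by (auto simp: chain_0_iff)
      have "diff vs (- y) = emb vs (fva v m)"
        using d by (simp add: x va_emb fva.kdiff_uminus neg_eq_iff_add_eq_0)
      then have "fva v m \<in> irrelevant_part fva dg ?C vs a"
        using boundary_emb_iff[OF v(2)] chain_uminus[OF y] by blast
      then have "meets vs (monom v 1 + m')" if "m' \<in> supp (m j)" for j m'
        using that by (auto simp: irrelevant_part_fcomp[OF v(2)] fva_def supp_Var_mult)
      then have "meets vs m'" if "m' \<in> supp (m j)" for j m'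
        using that v(4) by (fastforce simp: meets_def supp_add_nat)
      then have "m \<in> irrelevant_part fva dg ?C vs (a - dg v)"
        using m by (auto simp: irrelevant_part_fcomp[OF v(2)])
      then show "\<exists>z\<in>chain vs 1 (a - dg v). diff vs z = x"
        unfolding x boundary_emb_iff[OF v(2)] .
    qed
  qed
qed

section \<open>Tor and Koszul homology\<close>

definition const :: "(nat \<Rightarrow> 'k::zero mpol) \<Rightarrow> nat \<Rightarrow> 'k" where
  "const x = (\<lambda>j. coeff (x j) 0)"

lemma const_diff: "const (x - y) = const x - const y" for x y :: "nat \<Rightarrow> 'k::field mpol"
  by (simp add: const_def fun_eq_iff lookup_minus)

lemma irrelevant_part_fcomp_const:
  assumes "set vs = V"
  shows "irrelevant_part fva dg (fcomp V dg r s) vs a = {x \<in> fcomp V dg r s a. const x = 0}"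
proof -
  have "(\<forall>m\<in>supp (x j). meets vs m) \<longleftrightarrow> coeff (x j) 0 = 0" if x: "x \<in> fcomp V dg r s a" for x :: "nat \<Rightarrow> 'k::field mpol" and j
  proof
    assume "\<forall>m\<in>supp (x j). meets vs m"
    moreover have "\<not> meets vs 0" by (simp add: meets_def)
    ultimately show "coeff (x j) 0 = 0" by (metis in_keys_iff)
  next
    assume 0: "coeff (x j) 0 = 0"
    have "x j \<in> polys V" using x by (cases "j < r") (auto simp: fcomp_iff)
    show "\<forall>m\<in>supp (x j). meets vs m"
    proof
      fix m assume m: "m \<in> supp (x j)"
      then have "m \<noteq> 0" using 0 by (auto simp: in_keys_iff)
      then have "supp m \<noteq> {}" by (auto simp: poly_mapping_eq_iff fun_eq_iff in_keys_iff)
      moreover have "supp m \<subseteq> V" using m \<open>x j \<in> polys V\<close> by (auto simp: polys_def)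
      ultimately show "meets vs m" unfolding meets_def assms by blast
    qed
  qed
  then show ?thesis using assms by (auto simp: irrelevant_part_fcomp const_def fun_eq_iff)
qed

lemma res_diff_add: "res_diff F k (x + y) = res_diff F k x + res_diff F k y"
  by (simp add: res_diff_def fun_eq_iff distrib_left sum.distrib)

lemma res_diff_diff: "res_diff F k (x - y) = res_diff F k x - res_diff F k y"
  by (simp add: res_diff_def fun_eq_iff right_diff_distrib sum_subtractf)

lemma res_diff_fva: "res_diff F k (fva v x) = fva v (res_diff F k x)"
  by (auto simp: res_diff_def fva_def fun_eq_iff sum_distrib_left mult_ac)

lemma const_res_diff: "const (res_diff F k x) = tensor_diff F k (const x)"
  by (simp add: const_def res_diff_def tensor_diff_def fun_eq_iff lookup_sum coeff_mult_0)

lemma res_mat_graded: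
  assumes "graded_free_resolution V dg M F" "i < res_rank F k" "j < res_rank F (Suc k)"
  shows "res_mat F k i j \<in> polys V"
    and "homogeneous dg (res_shift F (Suc k) j - res_shift F k i) (res_mat F k i j)"
  using assms unfolding graded_free_resolution_def by simp_all

text \<open>Surjectivity of the augmentation in each degree is an assumption of the locale because it is the only
  consequence of the direct sum decomposition of \<open>M\<close> that the arguments below use.\<close>

locale resolved_module =
  fixes V :: "var set" and dg :: "var \<Rightarrow> 'g::comm_ring_1"
    and M :: "('k::field mpol, 'g, 'm::ab_group_add) graded_module"
    and F :: "('k mpol, 'g, 'm) resolution"
    and vs :: "var list"
  assumes vs: "set vs = V" "distinct vs"
    and resolution: "graded_free_resolution V dg M F"
    and comp_action: "graded_action (\<lambda>v. mod_act M (Var v)) dg V (mod_comp M)"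
    and act_add: "mod_act M (p + q) x = mod_act M p x + mod_act M q x"
    and act_mult: "mod_act M (p * q) x = mod_act M p (mod_act M q x)"
    and aug_surj: "res_aug M F ` fcomp V dg (res_rank F 0) (res_shift F 0) a = mod_comp M a"
begin

sublocale M: graded_action "\<lambda>v. mod_act M (Var v)" dg V "mod_comp M"
  by (rule comp_action)

abbreviation fc :: "nat \<Rightarrow> 'g \<Rightarrow> (nat \<Rightarrow> 'k mpol) set" where
  "fc k \<equiv> fcomp V dg (res_rank F k) (res_shift F k)"

abbreviation cycles :: "nat \<Rightarrow> 'g \<Rightarrow> (nat \<Rightarrow> 'k mpol) set" where
  "cycles k \<equiv> \<lambda>a. {x \<in> fc k a. case k of 0 \<Rightarrow> res_aug M F x = 0 | Suc l \<Rightarrow> res_diff F l x = 0}"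

lemma res_aug_add: "res_aug M F (x + y) = res_aug M F x + res_aug M F y"
  by (simp add: res_aug_def act_add sum.distrib)

lemma res_aug_fva: "res_aug M F (fva v x) = mod_act M (Var v) (res_aug M F x)"
  by (simp add: res_aug_def fva_def act_mult M.va_sum)

sublocale A: graded_surjection fva "\<lambda>v. mod_act M (Var v)" dg V "fc 0" "mod_comp M" "res_aug M F"
  by (intro graded_surjection.intro graded_action_fcomp comp_action graded_surjection_axioms.intro)
    (simp_all add: res_aug_add res_aug_fva aug_surj)

lemma ker_aug: "A.ker = cycles 0"
  by (simp add: A.ker_def fun_eq_iff)

lemma res_diff_fc:
  assumes "x \<in> fc (Suc k) a"
  shows "res_diff F k x \<in> fc k a"
  unfolding fcomp_iff
proof (intro conjI allI impI)
  fix i assume i: "i < res_rank F k"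
  have mat: "res_mat F k i j \<in> polys V"
    "homogeneous dg (res_shift F (Suc k) j - res_shift F k i) (res_mat F k i j)"
    if "j < res_rank F (Suc k)" for j
    using res_mat_graded[OF resolution i that] by simp_all
  show "res_diff F k x i \<in> polys V"
    using i assms mat by (auto simp: res_diff_def fcomp_iff intro!: polys_sum polys_mult)
  show "homogeneous dg (a - res_shift F k i) (res_diff F k x i)"
  proof -
    have "homogeneous dg (a - res_shift F k i) (res_mat F k i j * x j)" if "j < res_rank F (Suc k)" for j
      using homogeneous_mult[OF mat(2)[OF that], of "a - res_shift F (Suc k) j" "x j"] assms that
      by (simp add: fcomp_iff)
    then show ?thesis using i by (auto simp: res_diff_def intro!: homogeneous_sum)
  qed
qed (simp add: res_diff_def)

lemma hpart_res_diff:
  assumes "i < res_rank F k"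
  shows "hpart dg (a - res_shift F k i) (res_diff F k x i) =
    res_diff F k (\<lambda>j. hpart dg (a - res_shift F (Suc k) j) (x j)) i"
proof -
  have "homogeneous dg (res_shift F (Suc k) j - res_shift F k i) (res_mat F k i j)"
    if "j < res_rank F (Suc k)" for j
    using res_mat_graded[OF resolution assms that] by simp
  then have "hpart dg (a - res_shift F k i) (x j * res_mat F k i j)
      = hpart dg (a - res_shift F (Suc k) j) (x j) * res_mat F k i j" if "j < res_rank F (Suc k)" for j
    using hpart_mult[of dg "res_shift F (Suc k) j - res_shift F k i" "res_mat F k i j" "a - res_shift F k i" "x j"] that
    by simp
  then show ?thesis using assms by (simp add: res_diff_def part_sum mult.commute)
qed

text \<open>Exactness is given without reference to degrees; the homogeneous part of a preimage makes it hold in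
  each degree.\<close>

lemma res_diff_surj: "res_diff F k ` fc (Suc k) a = cycles k a"
proof -
  have ker: "{x \<in> free_mod V (res_rank F k). case k of 0 \<Rightarrow> res_aug M F x = 0 | Suc l \<Rightarrow> res_diff F l x = 0}
     = res_diff F k ` free_mod V (res_rank F (Suc k))"
    using resolution by (cases k) (auto simp: graded_free_resolution_def zero_fun_def)
  show ?thesis
  proof (intro equalityI subsetI)
    fix y assume "y \<in> res_diff F k ` fc (Suc k) a"
    then obtain x where x: "x \<in> fc (Suc k) a" "y = res_diff F k x" by blast
    then have "y \<in> res_diff F k ` free_mod V (res_rank F (Suc k))" by (auto simp: fcomp_def)
    then show "y \<in> cycles k a" using res_diff_fc[OF x(1)] x(2) unfolding ker[symmetric] by simp
  next
    fix y assume y: "y \<in> cycles k a"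
    then have "y \<in> res_diff F k ` free_mod V (res_rank F (Suc k))"
      unfolding ker[symmetric] by (simp add: fcomp_def)
    then obtain x where x: "x \<in> free_mod V (res_rank F (Suc k))" "y = res_diff F k x" by blast
    define z where "z = (\<lambda>j. hpart dg (a - res_shift F (Suc k) j) (x j))"
    have "z \<in> fc (Suc k) a"
      using x(1) by (auto simp: z_def fcomp_iff free_mod_def intro!: polys_part homogeneous_hpart)
    moreover have "res_diff F k z = y"
    proof
      fix i
      show "res_diff F k z i = y i"
      proof (cases "i < res_rank F k")
        case True
        then have "homogeneous dg (a - res_shift F k i) (y i)" using y by (simp add: fcomp_iff)
        then show ?thesis using hpart_res_diff[OF True, of a x] x(2) by (simp add: z_def hpart_id)
      qed (simp add: x(2) res_diff_def)
    qed
    ultimately show "y \<in> res_diff F k ` fc (Suc k) a" by blast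
  qed
qed

lemma graded_action_cycles: "graded_action fva dg V (cycles k)"
proof (cases k)
  case 0
  then show ?thesis using A.N.graded_action_axioms by (simp add: ker_aug)
next
  case (Suc l)
  interpret graded_action fva dg V "fc k" by (rule graded_action_fcomp)
  have "res_diff F l 0 = 0" by (simp add: res_diff_def fun_eq_iff)
  then show ?thesis
    by unfold_locales (auto simp: Suc res_diff_diff res_diff_fva C_diff[unfolded Suc] C_va[unfolded Suc] C_0[unfolded Suc])
qed

lemma diff_surjection: "graded_surjection fva fva dg V (fc (Suc k)) (cycles k) (res_diff F k)"
  by (intro graded_surjection.intro graded_action_fcomp graded_action_cycles graded_surjection_axioms.intro)
    (simp_all only: res_diff_add res_diff_fva res_diff_surj)

lemma ker_diff: "graded_surjection.ker (fc (Suc k)) (res_diff F k) = cycles (Suc k)"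
  using graded_surjection.ker_def[OF diff_surjection[of k]] by (simp add: fun_eq_iff)

lemma exact_cycles_shift:
  assumes "q \<ge> 1"
  shows "kexact fva dg (cycles k) vs (q + 1) a \<longleftrightarrow> kexact fva dg (cycles (Suc k)) vs q a"
  using graded_surjection.exact_shift[OF diff_surjection[of k], of vs q a] assms vs
  by (simp only: ker_diff exact_fcomp subset_refl)

text \<open>Dimension shifting, iterated along the syzygies \<open>cycles k \<subseteq> F\<^sub>k\<close>.\<close>

lemma exact_cycles:
  "kexact fva dg (cycles k) vs (int l + 1) a \<longleftrightarrow> kexact fva dg (cycles (k + l)) vs 1 a"
proof (induction l arbitrary: k)
  case (Suc l)
  have "kexact fva dg (cycles k) vs (int (Suc l) + 1) a \<longleftrightarrow> kexact fva dg (cycles (Suc k)) vs (int l + 1) a"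
    using exact_cycles_shift[of "int l + 1" k a] by (simp add: add_ac)
  then show ?case using Suc[of "Suc k"] by simp
qed simp

text \<open>The syzygy \<open>cycles k\<close> is the kernel of \<open>F\<^sub>k \<rightarrow> F\<^bsub>k-1\<^esub>\<close> (of the augmentation for \<open>k = 0\<close>). After shifting
  down to homological degree \<open>1\<close>, vanishing means that a syzygy in \<open>\<mm> F\<^sub>k\<close> lies in \<open>\<mm>\<close> times the syzygies.\<close>

lemma exact_Suc_cycles:
  "M.exact vs (int (Suc k)) a \<longleftrightarrow>
     cycles k a \<inter> {x \<in> fc k a. const x = 0} \<subseteq> res_diff F k ` {x \<in> fc (Suc k) a. const x = 0}"
proof -
  have irr: "irrelevant_part fva dg (cycles k) vs a = res_diff F k ` {x \<in> fc (Suc k) a. const x = 0}" for k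
    using graded_surjection.irrelevant_part_map[OF diff_surjection[of k], of vs a] vs
    by (simp add: irrelevant_part_fcomp_const)
  show ?thesis
  proof (cases k)
    case 0
    have "M.exact vs 1 a \<longleftrightarrow> A.ker a \<inter> irrelevant_part fva dg (fc 0) vs a \<subseteq> irrelevant_part fva dg A.ker vs a"
      using vs by (intro A.exact_1_iff exact_fcomp) auto
    then show ?thesis using vs unfolding 0 ker_aug irr irrelevant_part_fcomp_const[OF vs(1)] by simp
  next
    case (Suc l)
    have "M.exact vs (int (Suc k)) a \<longleftrightarrow> kexact fva dg (cycles 0) vs (int k) a"
      using A.exact_shift[of vs "int k" a] vs Suc unfolding ker_aug by (simp add: exact_fcomp add_ac)
    also have "\<dots> \<longleftrightarrow> kexact fva dg (cycles l) vs 1 a"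
      using exact_cycles[of 0 l a] Suc by (simp add: add_ac)
    also have "\<dots> \<longleftrightarrow> cycles k a \<inter> irrelevant_part fva dg (fc k) vs a \<subseteq> irrelevant_part fva dg (cycles k) vs a"
      using graded_surjection.exact_1_iff[OF diff_surjection[of l], of vs a] vs
      unfolding ker_diff Suc by (simp add: exact_fcomp)
    finally show ?thesis unfolding irr irrelevant_part_fcomp_const[OF vs(1)] .
  qed
qed

lemma exact_0_const: "M.exact vs 0 a \<longleftrightarrow> res_aug M F ` fc 0 a \<subseteq> res_aug M F ` {x \<in> fc 0 a. const x = 0}"
  using A.irrelevant_part_map[of vs a] M.exact_0_iff[of vs a] vs
  by (simp add: irrelevant_part_fcomp_const aug_surj)

lemma const_fc: "const ` fc k a = tensor_comp F k a"
proof (intro equalityI subsetI)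
  fix y assume "y \<in> const ` fc k a"
  then obtain x where x: "x \<in> fc k a" "y = const x" by blast
  have "res_shift F k j = a" if "j < res_rank F k" "y j \<noteq> 0" for j
  proof -
    have "(0 :: var \<Rightarrow>\<^sub>0 nat) \<in> supp (x j)" using that x(2) by (simp add: const_def in_keys_iff)
    then have "mon_degree dg (0 :: var \<Rightarrow>\<^sub>0 nat) = a - res_shift F k j"
      using x(1) that unfolding fcomp_iff homogeneous_def by blast
    then show ?thesis by simp
  qed
  then show "y \<in> tensor_comp F k a"
    using x by (auto simp: tensor_comp_def tensor_space_def const_def fcomp_iff)
next
  fix y assume y: "y \<in> tensor_comp F k a"
  let ?x = "\<lambda>j. monom 0 (y j) :: 'k mpol"
  have "?x \<in> fc k a"
    using y by (auto simp: fcomp_iff tensor_comp_def tensor_space_def homogeneous_def intro!: polys_monom split: if_splits)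
  moreover have "const ?x = y" by (simp add: const_def)
  ultimately show "y \<in> const ` fc k a" by (metis imageI)
qed

text \<open>A nonzero constant entry of a matrix joins basis elements of equal degree, so any preimage of a
  homogeneous boundary can be replaced by its part of the same degree.\<close>

lemma boundary_comp:
  assumes "y \<in> tensor_comp F k a"
  shows "y \<in> tor_boundaries F k \<longleftrightarrow> y \<in> tensor_diff F k ` tensor_comp F (Suc k) a"
proof
  assume "y \<in> tor_boundaries F k"
  then obtain z where z: "z \<in> tensor_space F (Suc k)" "y = tensor_diff F k z" by (auto simp: tor_boundaries_def)
  let ?z = "\<lambda>j. if res_shift F (Suc k) j = a then z j else 0"
  have "?z \<in> tensor_comp F (Suc k) a" using z(1) by (auto simp: tensor_comp_def tensor_space_def)
  moreover have "tensor_diff F k ?z = y"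
  proof
    fix i
    show "tensor_diff F k ?z i = y i"
    proof (cases "i < res_rank F k")
      case i: True
      have shift: "res_shift F (Suc k) j = res_shift F k i"
        if "j < res_rank F (Suc k)" "coeff (res_mat F k i j) 0 \<noteq> 0" for j
      proof -
        have "homogeneous dg (res_shift F (Suc k) j - res_shift F k i) (res_mat F k i j)"
          using res_mat_graded[OF resolution i that(1)] by simp
        moreover have "0 \<in> supp (res_mat F k i j)" using that by (simp add: in_keys_iff)
        ultimately have "mon_degree dg 0 = res_shift F (Suc k) j - res_shift F k i"
          unfolding homogeneous_def by blast
        then show ?thesis by simp
      qed
      show ?thesis
      proof (cases "res_shift F k i = a")
        case True
        have "coeff (res_mat F k i j) 0 * ?z j = coeff (res_mat F k i j) 0 * z j" if "j < res_rank F (Suc k)" for j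
          using shift[OF that] True by (cases "coeff (res_mat F k i j) 0 = 0") auto
        then have "(\<Sum>j<res_rank F (Suc k). coeff (res_mat F k i j) 0 * ?z j)
            = (\<Sum>j<res_rank F (Suc k). coeff (res_mat F k i j) 0 * z j)"
          by (intro sum.cong) auto
        then show ?thesis using i unfolding z(2) tensor_diff_def by simp
      next
        case False
        then have "y i = 0" using assms i by (auto simp: tensor_comp_def)
        moreover have "coeff (res_mat F k i j) 0 * ?z j = 0" if "j < res_rank F (Suc k)" for j
          using shift[OF that] False by (cases "coeff (res_mat F k i j) 0 = 0") auto
        then have "(\<Sum>j<res_rank F (Suc k). coeff (res_mat F k i j) 0 * ?z j) = 0"
          by (intro sum.neutral) auto
        then have "tensor_diff F k ?z i = 0" by (simp add: tensor_diff_def)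
        ultimately show ?thesis by simp
      qed
    qed (simp add: z(2) tensor_diff_def)
  qed
  ultimately show "y \<in> tensor_diff F k ` tensor_comp F (Suc k) a" by blast
qed (auto simp: tor_boundaries_def tensor_comp_def)

text \<open>Elements of \<open>\<mm> F\<^sub>k\<close> are those without constant terms. Two elements of \<open>F\<^sub>k\<close> have the same image under
  the next map precisely when they differ by the image of an element of \<open>F\<^bsub>k+1\<^esub>\<close>, which turns the
  criterion for syzygies into one about constant terms only.\<close>

lemma exact_iff_lift:
  "M.exact vs (int k) a \<longleftrightarrow>
     (\<forall>x\<in>fc k a. const x \<in> tor_cycles F k \<longrightarrow> (\<exists>z\<in>fc (Suc k) a. const x = const (res_diff F k z)))"
proof -
  interpret C: graded_action fva dg V "fc l" for l by (rule graded_action_fcomp)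
  have diffs: "x - res_diff F k z \<in> fc k a" if "x \<in> fc k a" "z \<in> fc (Suc k) a" for k x z
    using that res_diff_fc by (intro C.C_diff) auto
  show ?thesis
  proof (cases "k = 0")
    case k: True
    have "(\<exists>p\<in>fc 0 a. const p = 0 \<and> res_aug M F x = res_aug M F p)
        \<longleftrightarrow> (\<exists>z\<in>fc 1 a. const x = const (res_diff F 0 z))" if x: "x \<in> fc 0 a" for x
    proof
      assume "\<exists>p\<in>fc 0 a. const p = 0 \<and> res_aug M F x = res_aug M F p"
      then obtain p where p: "p \<in> fc 0 a" "const p = 0" "res_aug M F x = res_aug M F p" by blast
      then have "x - p \<in> cycles 0 a" using x C.C_diff[of x 0 a p] by (simp add: A.map_diff)
      then obtain z where z: "z \<in> fc 1 a" "x - p = res_diff F 0 z"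
        using res_diff_surj[of 0 a] by auto
      then have "const x = const (res_diff F 0 z)" using p(2) by (simp add: const_diff flip: z(2))
      with z show "\<exists>z\<in>fc 1 a. const x = const (res_diff F 0 z)" by blast
    next
      assume "\<exists>z\<in>fc 1 a. const x = const (res_diff F 0 z)"
      then obtain z where z: "z \<in> fc 1 a" "const x = const (res_diff F 0 z)" by blast
      have "res_diff F 0 z \<in> cycles 0 a" using res_diff_surj[of 0 a] z by auto
      then have "res_aug M F x = res_aug M F (x - res_diff F 0 z)" by (simp add: A.map_diff)
      then show "\<exists>p\<in>fc 0 a. const p = 0 \<and> res_aug M F x = res_aug M F p"
        using diffs[OF x, of z] z by (intro bexI[of _ "x - res_diff F 0 z"]) (auto simp: const_diff)
    qed
    moreover have "const x \<in> tor_cycles F 0" if "x \<in> fc 0 a" for x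
      using that const_fc[of 0 a] by (auto simp: tor_cycles_def tensor_comp_def)
    moreover have "M.exact vs 0 a \<longleftrightarrow> (\<forall>x\<in>fc 0 a. \<exists>p\<in>fc 0 a. const p = 0 \<and> res_aug M F x = res_aug M F p)"
      unfolding exact_0_const by blast
    ultimately have "M.exact vs (int 0) a \<longleftrightarrow> (\<forall>x\<in>fc 0 a. const x \<in> tor_cycles F 0 \<longrightarrow> (\<exists>z\<in>fc (Suc 0) a. const x = const (res_diff F 0 z)))"
      by simp
    then show ?thesis unfolding k .
  next
    case False
    then obtain l where Suc: "k = Suc l" by (cases k) auto
    have cyc: "const x \<in> tor_cycles F k \<longleftrightarrow> const (res_diff F l x) = 0" if "x \<in> fc k a" for x
      using that const_fc[of k a]
      by (auto simp: tor_cycles_def tensor_comp_def Suc const_res_diff zero_fun_def)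
    have "M.exact vs (int k) a \<longleftrightarrow>
        (\<forall>x\<in>fc k a. const (res_diff F l x) = 0 \<longrightarrow> (\<exists>p\<in>fc k a. const p = 0 \<and> res_diff F l x = res_diff F l p))"
    proof -
      have "cycles l a \<inter> {x \<in> fc l a. const x = 0} = {u \<in> cycles l a. const u = 0}" by blast
      then have eq: "cycles l a \<inter> {x \<in> fc l a. const x = 0} = {u \<in> res_diff F l ` fc k a. const u = 0}"
        by (simp only: Suc res_diff_surj)
      have "{u \<in> f ` A. P u} \<subseteq> f ` {p \<in> A. Q p} \<longleftrightarrow> (\<forall>x\<in>A. P (f x) \<longrightarrow> (\<exists>p\<in>A. Q p \<and> f x = f p))"
        for f :: "(nat \<Rightarrow> 'k mpol) \<Rightarrow> nat \<Rightarrow> 'k mpol" and A P Q by (auto simp: subset_iff image_iff)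
      then show ?thesis unfolding Suc exact_Suc_cycles eq[unfolded Suc] .
    qed
    moreover have "(\<exists>p\<in>fc k a. const p = 0 \<and> res_diff F l x = res_diff F l p)
        \<longleftrightarrow> (\<exists>z\<in>fc (Suc k) a. const x = const (res_diff F k z))" if x: "x \<in> fc k a" for x
    proof
      assume "\<exists>p\<in>fc k a. const p = 0 \<and> res_diff F l x = res_diff F l p"
      then obtain p where p: "p \<in> fc k a" "const p = 0" "res_diff F l x = res_diff F l p" by blast
      then have "x - p \<in> cycles k a" using x C.C_diff[of x k a p] by (simp add: res_diff_diff Suc)
      then obtain z where z: "z \<in> fc (Suc k) a" "x - p = res_diff F k z"
        using res_diff_surj[of k a] by blast
      then have "const x = const (res_diff F k z)" using p(2) by (simp add: const_diff flip: z(2))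
      with z show "\<exists>z\<in>fc (Suc k) a. const x = const (res_diff F k z)" by blast
    next
      assume "\<exists>z\<in>fc (Suc k) a. const x = const (res_diff F k z)"
      then obtain z where z: "z \<in> fc (Suc k) a" "const x = const (res_diff F k z)" by blast
      have "res_diff F k z \<in> cycles k a" using res_diff_surj[of k a] z by blast
      then have "res_diff F l x = res_diff F l (x - res_diff F k z)" by (simp add: res_diff_diff Suc)
      then show "\<exists>p\<in>fc k a. const p = 0 \<and> res_diff F l x = res_diff F l p"
        using diffs[OF x z(1)] z by (intro bexI[of _ "x - res_diff F k z"]) (auto simp: const_diff)
    qed
    ultimately show ?thesis using cyc by auto
  qed
qed

text \<open>Balancedness of \<open>Tor\<close>, as far as vanishing is concerned. Taking constant terms maps \<open>F\<^sub>k\<close> onto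
  \<open>K \<otimes> F\<^sub>k\<close> degree by degree and commutes with the differentials. In particular the degrees of \<open>Tor\<close>
  do not depend on the resolution.\<close>

theorem tor_vanishes_iff_exact:
  "M.exact vs (int k) a \<longleftrightarrow> (\<forall>y\<in>tensor_comp F k a. y \<in> tor_cycles F k \<longrightarrow> y \<in> tor_boundaries F k)"
proof -
  have "(\<forall>y\<in>tensor_comp F k a. y \<in> tor_cycles F k \<longrightarrow> y \<in> tor_boundaries F k) \<longleftrightarrow>
    (\<forall>y\<in>tensor_comp F k a. y \<in> tor_cycles F k \<longrightarrow> (\<exists>z\<in>tensor_comp F (Suc k) a. y = tensor_diff F k z))"
    by (intro ball_cong refl) (simp add: boundary_comp image_iff)
  also have "\<dots> \<longleftrightarrow> M.exact vs (int k) a"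
    unfolding const_fc[symmetric] exact_iff_lift const_res_diff by (simp only: ball_simps bex_simps)
  finally show ?thesis by blast
qed

end

section \<open>Hilbert's basis theorem and minimal resolutions\<close>

subsection \<open>Monomials\<close>

instance var :: countable
  by countable_datatype

text \<open>Any linear order on the variables will do; it makes the monomials an ordered monoid under the
  lexicographic order.\<close>

instantiation var :: linorder
begin

definition less_eq_var :: "var \<Rightarrow> var \<Rightarrow> bool" where "(u :: var) \<le> v \<longleftrightarrow> to_nat u \<le> to_nat v"
definition less_var :: "var \<Rightarrow> var \<Rightarrow> bool" where "(u :: var) < v \<longleftrightarrow> to_nat u < to_nat v"

instance
  by intro_classes (auto simp: less_eq_var_def less_var_def)

end

lemma monomial_nonneg: "0 \<le> t" for t :: "var \<Rightarrow>\<^sub>0 nat"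
proof (rule ccontr)
  assume "\<not> 0 \<le> t"
  then have "less_fun (coeff t) (coeff 0)" by (simp add: not_le less_poly_mapping.rep_eq)
  then show False by (auto simp: less_fun_def)
qed

lemma monomial_le_add: "b \<le> b + t" for b t :: "var \<Rightarrow>\<^sub>0 nat"
  using add_left_mono[OF monomial_nonneg[of t], of b] by simp

lemma ascending_subsequence:
  fixes g :: "nat \<Rightarrow> nat"
  shows "\<exists>r :: nat \<Rightarrow> nat. strict_mono r \<and> (\<forall>i j. i \<le> j \<longrightarrow> g (r i) \<le> g (r j))"
proof -
  obtain r where r: "strict_mono r" "monoseq (\<lambda>n. g (r n))"
    using seq_monosub[of g] by blast
  show ?thesis
  proof (cases "\<forall>i j. i \<le> j \<longrightarrow> g (r i) \<le> g (r j)")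
    case False
    with r(2) have dec: "\<forall>i j. i \<le> j \<longrightarrow> g (r j) \<le> g (r i)" unfolding monoseq_def by blast
    define n where "n = (ARG_MIN (\<lambda>n. g (r n)) n. True)"
    have n: "g (r n) \<le> g (r k)" for k
      unfolding n_def by (rule arg_min_nat_le) simp
    have "g (r (n + i)) = g (r n)" for i
      using n[of "n + i"] dec le_add1[of n i] by (metis antisym)
    moreover have "strict_mono (\<lambda>i. r (n + i))"
      using r(1) by (auto simp: strict_mono_def)
    ultimately show ?thesis by (intro exI[of _ "\<lambda>i. r (n + i)"]) simp
  qed (use r in blast)
qed

lemma dickson_subsequence:
  fixes f :: "nat \<Rightarrow> var \<Rightarrow>\<^sub>0 nat"
  assumes "finite V"
  shows "\<exists>r :: nat \<Rightarrow> nat. strict_mono r \<and> (\<forall>v\<in>V. \<forall>i j. i \<le> j \<longrightarrow> coeff (f (r i)) v \<le> coeff (f (r j)) v)"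
  using assms
proof (induction V)
  case empty
  show ?case by (intro exI[of _ id]) (simp add: strict_mono_def)
next
  case (insert v V)
  then obtain r :: "nat \<Rightarrow> nat" where r: "strict_mono r" "\<forall>v\<in>V. \<forall>i j. i \<le> j \<longrightarrow> coeff (f (r i)) v \<le> coeff (f (r j)) v"
    by (elim exE conjE)
  obtain r' :: "nat \<Rightarrow> nat" where r': "strict_mono r'" "\<forall>i j. i \<le> j \<longrightarrow> coeff (f (r (r' i))) v \<le> coeff (f (r (r' j))) v"
    using ascending_subsequence[of "\<lambda>i. coeff (f (r i)) v"] by (elim exE conjE)
  have "strict_mono (\<lambda>i. r (r' i))" using r(1) r'(1) by (simp add: strict_mono_def)
  moreover have "r' i \<le> r' j" if "i \<le> j" for i j using r'(1) that by (simp add: strict_mono_less_eq)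
  ultimately show ?case using r(2) r'(2) by (intro exI[of _ "\<lambda>i. r (r' i)"] conjI) simp_all
qed

text \<open>Along a subsequence all exponents ascend.\<close>

lemma dickson:
  fixes f :: "nat \<Rightarrow> var \<Rightarrow>\<^sub>0 nat"
  assumes "finite V" "\<And>i. supp (f i) \<subseteq> V"
  shows "\<exists>i j t. i < j \<and> f j = f i + t"
proof -
  obtain r :: "nat \<Rightarrow> nat" where r: "strict_mono r" "\<forall>v\<in>V. \<forall>i j. i \<le> j \<longrightarrow> coeff (f (r i)) v \<le> coeff (f (r j)) v"
    using dickson_subsequence[OF assms(1), of f] by (elim exE conjE)
  have "coeff (f (r 0)) v \<le> coeff (f (r 1)) v" for v
  proof (cases "v \<in> V")
    case False
    then have "coeff (f (r 0)) v = 0" using assms(2)[of "r 0"] by (metis in_keys_iff subsetD)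
    then show ?thesis by simp
  qed (simp add: r(2))
  then have "f (r 1) = f (r 0) + (f (r 1) - f (r 0))"
    by (intro poly_mapping_eqI) (simp add: lookup_add lookup_minus)
  moreover have "r 0 < r 1" using r(1) by (simp add: strict_mono_def)
  ultimately show ?thesis by blast
qed

lemma std_mon_degree: "mon_degree (\<lambda>_. 1 :: int) m = (\<Sum>v\<in>supp m. int (coeff m v))"
  by (simp add: mon_degree_def)

lemma mon_degree_one_nonneg: "mon_degree (\<lambda>_. 1 :: int) m \<ge> 0"
  by (simp add: std_mon_degree sum_nonneg)

lemma mon_degree_one_eq_0: "mon_degree (\<lambda>_. 1 :: int) m = 0 \<Longrightarrow> m = 0"
  by (auto simp: std_mon_degree sum_nonneg_eq_0_iff in_keys_iff poly_mapping_eq_iff fun_eq_iff)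

text \<open>The elements of \<open>L\<close> that are minimal for divisibility suffice: an infinite set of them would contain
  two of which one divides the other.\<close>

lemma finite_monomial_basis:
  fixes L :: "(var \<Rightarrow>\<^sub>0 nat) set"
  assumes "finite V" "\<And>m. m \<in> L \<Longrightarrow> supp m \<subseteq> V"
  shows "\<exists>B\<subseteq>L. finite B \<and> (\<forall>m\<in>L. \<exists>b\<in>B. \<exists>t. m = b + t)"
proof -
  define B where "B = {b \<in> L. \<forall>c\<in>L. \<forall>t. b = c + t \<longrightarrow> c = b}"
  have "finite B"
  proof (rule ccontr)
    assume "infinite B"
    then obtain f :: "nat \<Rightarrow> _" where f: "inj f" "range f \<subseteq> B"
      using infinite_countable_subset by blast
    have fB: "f i \<in> B" for i using f(2) by blast
    then have "supp (f i) \<subseteq> V" for i using assms(2) by (auto simp: B_def)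
    then obtain i j t where ij: "i < j" "f j = f i + t" using dickson[OF assms(1), of f] by blast
    have "f i \<in> L" using fB[of i] by (simp add: B_def)
    then have "f i = f j" using fB[of j] ij(2) unfolding B_def by blast
    then show False using f(1) ij(1) by (auto dest: injD)
  qed
  moreover have "\<exists>b\<in>B. \<exists>t. m = b + t" if m: "m \<in> L" for m
  proof -
    let ?w = "\<lambda>c. nat (mon_degree (\<lambda>_. 1 :: int) c)"
    let ?D = "\<lambda>c. c \<in> L \<and> (\<exists>t. m = c + t)"
    have "?D m" using m by (auto intro!: exI[of _ 0])
    then obtain c where c: "?D c" "\<And>e. ?D e \<Longrightarrow> ?w c \<le> ?w e"
      using exists_least_lemma[of "\<lambda>n. \<exists>c. ?D c \<and> ?w c = n"] ex_has_least_nat[of ?D m ?w] by blast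
    have "c \<in> B" unfolding B_def
    proof (intro CollectI conjI ballI allI impI)
      show "c \<in> L" using c by blast
      fix e t assume e: "e \<in> L" "c = e + t"
      from c(1) obtain u where "m = c + u" by blast
      then have "m = e + (t + u)" using e(2) by (simp add: add.assoc)
      then have "?w c \<le> ?w e" using c(2) e(1) by blast
      then have "mon_degree (\<lambda>_. 1 :: int) t = 0"
        using mon_degree_one_nonneg[of t] mon_degree_one_nonneg[of e] by (simp add: e(2) mon_degree_add)
      then show "e = c" using e(2) mon_degree_one_eq_0 by simp
    qed
    then show ?thesis using c(1) by blast
  qed
  ultimately show ?thesis by (intro exI[of _ B]) (auto simp: B_def)
qed

text \<open>In an infinite descending chain some monomial would divide a later one, which is then not smaller.\<close>

lemma wf_monomials:
  assumes "finite V"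
  shows "wf {(m, m' :: var \<Rightarrow>\<^sub>0 nat). m < m' \<and> supp m \<subseteq> V \<and> supp m' \<subseteq> V}"
  unfolding wf_iff_no_infinite_down_chain
proof
  assume "\<exists>f. \<forall>i. (f (Suc i), f i) \<in> {(m, m' :: var \<Rightarrow>\<^sub>0 nat). m < m' \<and> supp m \<subseteq> V \<and> supp m' \<subseteq> V}"
  then obtain f :: "nat \<Rightarrow> var \<Rightarrow>\<^sub>0 nat" where f: "\<And>i. f (Suc i) < f i" "\<And>i. supp (f i) \<subseteq> V" by blast
  obtain i j t where ij: "i < j" "f j = f i + t" using dickson[OF assms f(2)] by blast
  have "f j < f i" using ij(1)
    by (induction j) (auto simp: less_Suc_eq intro: f(1) less_trans[OF f(1)])
  then show False using ij(2) monomial_le_add[of "f i" t] by simp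
qed

subsection \<open>Graded submodules of free modules\<close>

definition comb :: "nat \<Rightarrow> (nat \<Rightarrow> nat \<Rightarrow> 'k::field mpol) \<Rightarrow> (nat \<Rightarrow> 'k mpol) \<Rightarrow> nat \<Rightarrow> 'k mpol" where
  "comb R G c = (\<lambda>i. \<Sum>j<R. c j * G j i)"

lemma comb_add: "comb R G (c + c') = comb R G c + comb R G c'"
  by (simp add: comb_def fun_eq_iff distrib_right sum.distrib)

lemma comb_diff: "comb R G (c - c') = comb R G c - comb R G c'"
  by (simp add: comb_def fun_eq_iff left_diff_distrib sum_subtractf)

lemma comb_0 [simp]: "comb R G 0 = 0"
  by (simp add: comb_def fun_eq_iff)

lemma comb_mult: "comb R G (\<lambda>j. p * c j) = (\<lambda>i. p * comb R G c i)"
  by (simp add: comb_def sum_distrib_left mult.assoc)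

lemma comb_sum: "comb R G (\<Sum>a\<in>A. c a) = (\<Sum>a\<in>A. comb R G (c a))"
  by (induction A rule: infinite_finite_induct)
    (simp_all only: comb_add comb_0 sum.empty sum.insert sum.infinite simp_thms)

definition graded_submodule ::
  "var set \<Rightarrow> (var \<Rightarrow> 'g::comm_ring_1) \<Rightarrow> nat \<Rightarrow> (nat \<Rightarrow> 'g) \<Rightarrow> ('g \<Rightarrow> (nat \<Rightarrow> 'k::field mpol) set) \<Rightarrow> bool" where
  "graded_submodule V dg r s N \<longleftrightarrow>
     (\<forall>a. N a \<subseteq> fcomp V dg r s a) \<and>
     (\<forall>a. \<forall>x\<in>N a. \<forall>y\<in>N a. x - y \<in> N a) \<and>
     (\<forall>a t c. \<forall>x\<in>N a. supp t \<subseteq> V \<longrightarrow> (\<lambda>i. monom t c * x i) \<in> N (a + mon_degree dg t))"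

text \<open>Requiring nonzero generators ensures that their degrees lie in every group of degrees that contains
  those of the ambient free module and of the variables.\<close>

definition gens ::
  "var set \<Rightarrow> (var \<Rightarrow> 'g::comm_ring_1) \<Rightarrow> ('g \<Rightarrow> (nat \<Rightarrow> 'k::field mpol) set)
     \<Rightarrow> nat \<Rightarrow> (nat \<Rightarrow> 'g) \<Rightarrow> (nat \<Rightarrow> nat \<Rightarrow> 'k mpol) \<Rightarrow> bool" where
  "gens V dg N R t G \<longleftrightarrow>
     (\<forall>j<R. G j \<in> N (t j) \<and> G j \<noteq> 0) \<and> (\<forall>a. N a \<subseteq> comb R G ` fcomp V dg R t a)"

definition syz ::
  "var set \<Rightarrow> (var \<Rightarrow> 'g::comm_ring_1) \<Rightarrow> nat \<Rightarrow> (nat \<Rightarrow> 'g) \<Rightarrow> (nat \<Rightarrow> nat \<Rightarrow> 'k::field mpol)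
     \<Rightarrow> 'g \<Rightarrow> (nat \<Rightarrow> 'k mpol) set" where
  "syz V dg R t G a = {c \<in> fcomp V dg R t a. comb R G c = 0}"

lemma fcomp_monom_mult:
  assumes "x \<in> fcomp V dg r s a" "supp t \<subseteq> V"
  shows "(\<lambda>i. monom t c * x i) \<in> fcomp V dg r s (a + mon_degree dg t)"
  unfolding fcomp_iff
proof (intro conjI allI impI)
  fix j assume "j < r"
  then have x: "x j \<in> polys V" "homogeneous dg (a - s j) (x j)" using assms(1) by (auto simp: fcomp_iff)
  show "monom t c * x j \<in> polys V" using x assms(2) by (intro polys_mult polys_monom)
  have "mon_degree dg t + (a - s j) = a + mon_degree dg t - s j" by simp
  then show "homogeneous dg (a + mon_degree dg t - s j) (monom t c * x j)"
    using homogeneous_mult[OF homogeneous_monom[of dg t c] x(2)] by (simp only:)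
qed (use assms in \<open>simp add: fcomp_iff\<close>)

lemma fcomp_diff: "x \<in> fcomp V dg r s a \<Longrightarrow> y \<in> fcomp V dg r s a \<Longrightarrow> x - y \<in> fcomp V dg r s a"
  by (auto simp: fcomp_iff intro!: polys_diff homogeneous_diff)

lemma fcomp_add: "x \<in> fcomp V dg r s a \<Longrightarrow> y \<in> fcomp V dg r s a \<Longrightarrow> x + y \<in> fcomp V dg r s a"
  by (auto simp: fcomp_iff intro!: polys_add homogeneous_add)

lemma graded_submodule_syz: "graded_submodule V dg R t (syz V dg R t G)"
  by (auto simp: graded_submodule_def syz_def fcomp_diff comb_diff comb_mult fcomp_monom_mult fun_eq_iff)

text \<open>Leading terms: the last nonzero coordinate, then the largest monomial in it.\<close>

definition lead_pos :: "(nat \<Rightarrow> 'k::zero mpol) \<Rightarrow> nat" where "lead_pos x = Max {j. x j \<noteq> 0}"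
definition lead_mon :: "(nat \<Rightarrow> 'k::zero mpol) \<Rightarrow> var \<Rightarrow>\<^sub>0 nat" where "lead_mon x = Max (supp (x (lead_pos x)))"

lemma lead:
  fixes x :: "nat \<Rightarrow> 'k::field mpol"
  assumes "x \<in> fcomp V dg r s a" "x \<noteq> 0"
  shows "lead_pos x < r" "x (lead_pos x) \<noteq> 0" "\<And>j. lead_pos x < j \<Longrightarrow> x j = 0"
    "lead_mon x \<in> supp (x (lead_pos x))" "\<And>m. m \<in> supp (x (lead_pos x)) \<Longrightarrow> m \<le> lead_mon x"
    "supp (lead_mon x) \<subseteq> V"
proof -
  have sub: "{j. x j \<noteq> 0} \<subseteq> {..<r}" using assms(1) by (auto simp: fcomp_iff not_le[symmetric])
  then have fin: "finite {j. x j \<noteq> 0}" by (rule finite_subset) simp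
  have ne: "{j. x j \<noteq> 0} \<noteq> {}" using assms(2) by (auto simp: fun_eq_iff)
  have "lead_pos x \<in> {j. x j \<noteq> 0}" unfolding lead_pos_def by (rule Max_in[OF fin ne])
  then show 1: "x (lead_pos x) \<noteq> 0" and 2: "lead_pos x < r" using sub by auto
  show "x j = 0" if "lead_pos x < j" for j
  proof (rule ccontr)
    assume "x j \<noteq> 0"
    then have "j \<le> lead_pos x" unfolding lead_pos_def using fin by (intro Max_ge) auto
    then show False using that by simp
  qed
  have "supp (x (lead_pos x)) \<noteq> {}"
  proof
    assume "supp (x (lead_pos x)) = {}"
    then have "x (lead_pos x) = 0" using sum_monoms[of "x (lead_pos x)"] by simp
    then show False using 1 by simp
  qed
  then show 3: "lead_mon x \<in> supp (x (lead_pos x))" unfolding lead_mon_def by (intro Max_in) auto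
  show "m \<le> lead_mon x" if "m \<in> supp (x (lead_pos x))" for m
    unfolding lead_mon_def using that by (intro Max_ge) auto
  show "supp (lead_mon x) \<subseteq> V" using 3 2 assms(1) by (auto simp: fcomp_iff polys_def)
qed

text \<open>Elements of \<open>N\<close> whose leading terms divide all leading terms of \<open>N\<close> generate \<open>N\<close>, by division with
  remainder; finitely many suffice by Dickson's lemma. Homogeneity is preserved, because the cofactor of a
  division step is a single term whose degree is determined by the leading terms.\<close>

theorem graded_submodule_finitely_generated:
  fixes N :: "'g::comm_ring_1 \<Rightarrow> (nat \<Rightarrow> 'k::field mpol) set"
  assumes N: "graded_submodule V dg r s N" and V: "finite V"
  shows "\<exists>R t G. gens V dg N R t G"
proof -
  have Nf: "N a \<subseteq> fcomp V dg r s a" and Nd: "x \<in> N a \<Longrightarrow> y \<in> N a \<Longrightarrow> x - y \<in> N a"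
    and Nm: "x \<in> N a \<Longrightarrow> supp t \<subseteq> V \<Longrightarrow> (\<lambda>i. monom t c * x i) \<in> N (a + mon_degree dg t)" for a x y t c
    using N unfolding graded_submodule_def by blast+
  define L where "L p = {lead_mon x | x a. x \<in> N a \<and> x \<noteq> 0 \<and> lead_pos x = p}" for p
  have "\<exists>B\<subseteq>L p. finite B \<and> (\<forall>m\<in>L p. \<exists>b\<in>B. \<exists>t. m = b + t)" for p
    using lead(6)[of _ V dg r s] Nf by (intro finite_monomial_basis[OF V]) (unfold L_def, blast)
  then obtain B where B: "\<And>p. B p \<subseteq> L p" "\<And>p. finite (B p)" "\<And>p m. m \<in> L p \<Longrightarrow> \<exists>b\<in>B p. \<exists>t. m = b + t"
    by metis
  define S where "S = Sigma {..<r} B"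
  have "finite S" using B(2) by (auto simp: S_def)
  then obtain h where h: "bij_betw h {0..<card S} S" using ex_bij_betw_nat_finite by blast
  define R where "R = card S"
  have "\<exists>x a. x \<in> N a \<and> x \<noteq> 0 \<and> lead_pos x = fst q \<and> lead_mon x = snd q" if "q \<in> S" for q
    using that B(1) by (fastforce simp: S_def L_def)
  moreover have "h j \<in> S" if "j < R" for j
    using h that by (auto simp: bij_betw_def R_def)
  ultimately have "\<exists>x a. x \<in> N a \<and> x \<noteq> 0 \<and> lead_pos x = fst (h j) \<and> lead_mon x = snd (h j)" if "j < R" for j
    using that by blast
  then obtain G t where G: "\<And>j. j < R \<Longrightarrow> G j \<in> N (t j) \<and> G j \<noteq> 0 \<and> lead_pos (G j) = fst (h j) \<and> lead_mon (G j) = snd (h j)"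
    by metis
  let ?W = "less_than <*lex*> {(m, m' :: var \<Rightarrow>\<^sub>0 nat). m < m' \<and> supp m \<subseteq> V \<and> supp m' \<subseteq> V}"
  have wf: "wf ?W" by (intro wf_lex_prod wf_less_than wf_monomials V)
  have zero: "0 \<in> comb R G ` fcomp V dg R t a" for a
    by (rule image_eqI[of _ _ 0]) (auto simp: fcomp_iff)
  have main: "\<forall>x\<in>N a. x \<noteq> 0 \<longrightarrow> (lead_pos x, lead_mon x) = q \<longrightarrow> x \<in> comb R G ` fcomp V dg R t a" for q a
  proof (induction q rule: wf_induct_rule[OF wf])
    case (1 q)
    show ?case
    proof (intro ballI impI)
      fix x assume x: "x \<in> N a" "x \<noteq> 0" and q: "(lead_pos x, lead_mon x) = q"
      define p where "p = lead_pos x"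
      have xf: "x \<in> fcomp V dg r s a" using x Nf by blast
      note lx = lead[OF xf x(2), folded p_def]
      have "lead_mon x \<in> L p" using x by (auto simp: L_def p_def)
      then obtain b u where b: "b \<in> B p" "lead_mon x = b + u" using B(3) by blast
      then have "(p, b) \<in> h ` {0..<R}" using h lx(1) by (auto simp: S_def bij_betw_def R_def)
      then obtain j where j: "j < R" "h j = (p, b)" by auto
      have g: "G j \<in> N (t j)" "G j \<noteq> 0" "lead_pos (G j) = p" "lead_mon (G j) = b" using G[OF j(1)] j(2) by auto
      have gf: "G j \<in> fcomp V dg r s (t j)" using g(1) Nf by blast
      note lg = lead[OF gf g(2), unfolded g(3,4)]
      have a: "a = t j + mon_degree dg u"
      proof -
        have "mon_degree dg (lead_mon x) = a - s p" using xf lx(1,4) by (auto simp: fcomp_iff homogeneous_def)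
        moreover have "mon_degree dg b = t j - s p" using gf lg(1,4) by (auto simp: fcomp_iff homogeneous_def)
        ultimately show ?thesis by (simp add: b(2) mon_degree_add algebra_simps)
      qed
      have u: "supp u \<subseteq> V" using lx(6) b(2) by (simp add: supp_add_nat)
      \<comment> \<open>One division step: \<open>y\<close> is the multiple of a generator with the same leading term as \<open>x\<close>.\<close>
      define e where "e = coeff (x p) (lead_mon x) / coeff (G j p) b"
      define y where "y = (\<lambda>i. monom u e * G j i)"
      have yN: "y \<in> N a" unfolding y_def a by (rule Nm[OF g(1) u])
      define c where "c = (\<lambda>i. if i = j then monom u e else 0)"
      have cf: "c \<in> fcomp V dg R t a"
        using j(1) u by (auto simp: fcomp_iff c_def a polys_monom homogeneous_def)
      have cy: "comb R G c = y"
        using j(1) by (auto simp: comb_def c_def y_def fun_eq_iff if_distrib[of "\<lambda>z. z * _"] sum.delta cong: if_cong)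
      have z: "x - y \<in> N a" using x yN by (intro Nd)
      have "x - y \<in> comb R G ` fcomp V dg R t a"
      proof (cases "x - y = 0")
        case False
        have zf: "x - y \<in> fcomp V dg r s a" using z Nf by blast
        note lz = lead[OF zf False]
        have "(x - y) i = 0" if "p < i" for i
          using lx(3)[OF that] lg(3)[OF that] by (simp add: y_def)
        then have pos: "lead_pos (x - y) \<le> p" using lz(2) by (metis not_le)
        have "lead_mon (x - y) < lead_mon x" if eq: "lead_pos (x - y) = p"
        proof -
          have lm: "lead_mon (x - y) \<in> supp (x p - y p)" using lz(4) eq by simp
          have "m \<le> lead_mon x" if "m \<in> supp (y p)" for m
          proof -
            have "m \<in> (+) u ` supp (G j p)"
              using that supp_monom_mult[of u e "G j p"] unfolding y_def by (rule subsetD[rotated])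
            then obtain m' where "m' \<in> supp (G j p)" "m = u + m'" by (rule imageE)
            then show ?thesis using lg(5)[of m'] add_left_mono[of m' b u] by (simp add: b(2) add.commute)
          qed
          moreover have "supp (x p - y p) \<subseteq> supp (x p) \<union> supp (y p)"
            by (auto simp: in_keys_iff lookup_minus)
          ultimately have le: "lead_mon (x - y) \<le> lead_mon x" using lm lx(5) by blast
          have "coeff (G j p) b \<noteq> 0" using lg(4) by (simp add: in_keys_iff)
          then have "coeff (x p - y p) (lead_mon x) = 0"
            by (simp add: lookup_minus y_def b(2) add.commute[of b u] coeff_monom_mult e_def)
          then have "lead_mon (x - y) \<noteq> lead_mon x" using lm by (auto simp: in_keys_iff)
          with le show ?thesis by simp
        qed
        then have "((lead_pos (x - y), lead_mon (x - y)), q) \<in> ?W"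
          using pos lz(6) lx(6) by (auto simp: q[symmetric] p_def[symmetric])
        then show ?thesis using 1 z False by blast
      qed (simp add: zero)
      then obtain c' where "c' \<in> fcomp V dg R t a" "x - y = comb R G c'" by blast
      then have "c' + c \<in> fcomp V dg R t a" "x = comb R G (c' + c)"
        using cf cy by (auto simp: fcomp_add comb_add simp flip: diff_eq_eq)
      then show "x \<in> comb R G ` fcomp V dg R t a" by blast
    qed
  qed
  have "N a \<subseteq> comb R G ` fcomp V dg R t a" for a
    using main zero by (metis subsetI)
  then have "gens V dg N R t G" unfolding gens_def using G by blast
  then show ?thesis by blast
qed

subsection \<open>Minimal resolutions\<close>

text \<open>Minimality in the form in which a resolution needs it: the relations lie in \<open>\<mm>\<close> times the free module.\<close>

definition minimal_gens ::
  "var set \<Rightarrow> (var \<Rightarrow> 'g::comm_ring_1) \<Rightarrow> nat \<Rightarrow> (nat \<Rightarrow> 'g) \<Rightarrow> (nat \<Rightarrow> nat \<Rightarrow> 'k::field mpol) \<Rightarrow> bool" where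
  "minimal_gens V dg R t G \<longleftrightarrow> (\<forall>a. \<forall>c\<in>syz V dg R t G a. const c = 0)"

lemma sum_omit:
  fixes h :: "nat \<Rightarrow> 'a::comm_monoid_add"
  assumes "j0 < Suc R" "h j0 = 0"
  shows "(\<Sum>j<Suc R. h j) = (\<Sum>j<R. h (if j = j0 then R else j))"
proof (cases "j0 = R")
  case True
  then show ?thesis using assms(2) by (auto intro!: sum.cong)
next
  case False
  then have j0: "j0 \<in> {..<R}" using assms(1) by simp
  have "(\<Sum>j<R. h (if j = j0 then R else j)) = h R + (\<Sum>j\<in>{..<R} - {j0}. h (if j = j0 then R else j))"
    using sum.remove[OF _ j0, of "\<lambda>j. h (if j = j0 then R else j)"] by simp
  also have "(\<Sum>j\<in>{..<R} - {j0}. h (if j = j0 then R else j)) = (\<Sum>j\<in>{..<R} - {j0}. h j)"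
    by (rule sum.cong) auto
  also have "\<dots> = (\<Sum>j<R. h j)"
    using sum.remove[OF _ j0, of h] assms(2) by simp
  finally show ?thesis by (simp add: add.commute)
qed

text \<open>A homogeneous coefficient with a constant term has degree \<open>0\<close>, so it is a unit, and the relation
  expresses the generator at this place by the others. The last index takes the place of the omitted one.\<close>

lemma gens_omit:
  fixes G :: "nat \<Rightarrow> nat \<Rightarrow> 'k::field mpol"
  assumes pos: "\<And>m. supp m \<subseteq> V \<Longrightarrow> mon_degree dg m = 0 \<Longrightarrow> m = 0"
    and gens: "gens V dg N (Suc R) t G"
    and c: "c \<in> syz V dg (Suc R) t G a" "const c \<noteq> 0"
  shows "\<exists>t' G'. gens V dg N R t' G'"
proof -
  from c have cf: "c \<in> fcomp V dg (Suc R) t a" and c0: "comb (Suc R) G c = 0" by (auto simp: syz_def)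
  obtain j0 where j0: "coeff (c j0) 0 \<noteq> 0" using c(2) by (auto simp: const_def fun_eq_iff)
  then have j0R: "j0 < Suc R" using cf by (cases "j0 < Suc R") (auto simp: fcomp_iff)
  have cj0: "c j0 \<in> polys V" "homogeneous dg (a - t j0) (c j0)" using cf j0R by (auto simp: fcomp_iff)
  have "mon_degree dg (0 :: var \<Rightarrow>\<^sub>0 nat) = a - t j0"
    using bspec[OF cj0(2)[unfolded homogeneous_def], of 0] j0 by (simp add: in_keys_iff)
  then have a: "a = t j0" by simp
  define u where "u = coeff (c j0) 0"
  have c_const: "c j0 = monom 0 u"
  proof (rule poly_mapping_eqI)
    fix m
    show "coeff (c j0) m = coeff (monom 0 u) m"
    proof (cases "m = 0")
      case False
      have "m \<notin> supp (c j0)"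
      proof
        assume m: "m \<in> supp (c j0)"
        then have "supp m \<subseteq> V" "mon_degree dg m = 0" using cj0 a by (auto simp: polys_def homogeneous_def)
        then show False using pos False by blast
      qed
      then show ?thesis using False by (simp add: in_keys_iff lookup_single when_def)
    qed (simp add: u_def)
  qed
  let ?s = "\<lambda>j. if j = j0 then R else j"
  have s: "?s j < Suc R" "?s j \<noteq> j0" if "j < R" for j using that j0R by auto
  have "x \<in> comb R (\<lambda>j. G (?s j)) ` fcomp V dg R (\<lambda>j. t (?s j)) b" if x: "x \<in> N b" for x b
  proof -
    have "x \<in> comb (Suc R) G ` fcomp V dg (Suc R) t b" using gens x unfolding gens_def by blast
    then obtain e where e: "e \<in> fcomp V dg (Suc R) t b" "x = comb (Suc R) G e" by (elim imageE)
    \<comment> \<open>Subtract the multiple of the relation that cancels the coefficient at \<open>j0\<close>.\<close>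
    define k where "k = e j0 * monom 0 (1 / u)"
    define e' where "e' = e - (\<lambda>j. k * c j)"
    have k: "k \<in> polys V" "homogeneous dg (b - a) k"
    proof -
      have "e j0 \<in> polys V" "homogeneous dg (b - t j0) (e j0)" using e(1) j0R by (auto simp: fcomp_iff)
      then show "k \<in> polys V" "homogeneous dg (b - a) k"
        using homogeneous_mult[of dg "b - t j0" "e j0" 0 "monom 0 (1 / u)"]
        by (auto simp: k_def a homogeneous_def intro!: polys_mult polys_monom)
    qed
    have "(\<lambda>j. k * c j) \<in> fcomp V dg (Suc R) t b" unfolding fcomp_iff
    proof (intro conjI allI impI)
      fix j assume j: "j < Suc R"
      then have "c j \<in> polys V" "homogeneous dg (a - t j) (c j)" using cf by (auto simp: fcomp_iff)
      then show "k * c j \<in> polys V" "homogeneous dg (b - t j) (k * c j)"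
        using k homogeneous_mult[OF k(2), of "a - t j" "c j"] by (auto intro: polys_mult)
    qed (use cf in \<open>simp add: fcomp_iff\<close>)
    then have e'f: "e' \<in> fcomp V dg (Suc R) t b" unfolding e'_def by (rule fcomp_diff[OF e(1)])
    have xe': "x = comb (Suc R) G e'"
      unfolding e'_def comb_diff comb_mult by (simp add: c0 e(2) fun_eq_iff)
    have "u \<noteq> 0" using j0 by (simp add: u_def)
    then have "k * c j0 = e j0" by (simp add: k_def c_const mult.assoc mult_single)
    then have "e' j0 = 0" by (simp add: e'_def)
    then have om: "(\<Sum>j<Suc R. e' j * G j i) = (\<Sum>j<R. e' (?s j) * G (?s j) i)" for i
      by (intro sum_omit[OF j0R]) simp
    have "comb (Suc R) G e' = comb R (\<lambda>j. G (?s j)) (\<lambda>j. if j < R then e' (?s j) else 0)"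
      unfolding comb_def om by (intro ext sum.cong) simp_all
    moreover have "(\<lambda>j. if j < R then e' (?s j) else 0) \<in> fcomp V dg R (\<lambda>j. t (?s j)) b"
      using e'f s by (auto simp: fcomp_iff)
    ultimately show ?thesis using xe' by blast
  qed
  moreover have "G (?s j) \<in> N (t (?s j)) \<and> G (?s j) \<noteq> 0" if "j < R" for j
    using gens s[OF that] unfolding gens_def by blast
  ultimately have "gens V dg N R (\<lambda>j. t (?s j)) (\<lambda>j. G (?s j))"
    unfolding gens_def by blast
  then show ?thesis by blast
qed

text \<open>A generating family of smallest size is minimal.\<close>

lemma minimal_gens_exist:
  assumes "graded_submodule V dg r s N" "finite V"
    and pos: "\<And>m. supp m \<subseteq> V \<Longrightarrow> mon_degree dg m = 0 \<Longrightarrow> m = 0"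
  shows "\<exists>R t G. gens V dg N R t G \<and> minimal_gens V dg R t G"
proof -
  let ?P = "\<lambda>R. \<exists>t G. gens V dg N R t G"
  have ex: "\<exists>R. ?P R" using graded_submodule_finitely_generated[OF assms(1,2)] by blast
  define R where "R = (LEAST R. ?P R)"
  have "?P R" unfolding R_def by (rule LeastI_ex[OF ex])
  then obtain t G where G: "gens V dg N R t G" by blast
  have "minimal_gens V dg R t G"
  proof (rule ccontr)
    assume "\<not> minimal_gens V dg R t G"
    then obtain a c where c: "c \<in> syz V dg R t G a" "const c \<noteq> 0" by (auto simp: minimal_gens_def)
    have "R \<noteq> 0"
    proof
      assume "R = 0"
      then have "c = 0" using c(1) by (auto simp: syz_def fcomp_iff fun_eq_iff)
      then show False using c(2) by (simp add: const_def fun_eq_iff)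
    qed
    then obtain R' where R': "R = Suc R'" by (cases R) auto
    then have "?P R'" using gens_omit[OF pos G[unfolded R'] c(1)[unfolded R'] c(2)] by blast
    then have "R \<le> R'" unfolding R_def by (rule Least_le)
    then show False using R' by simp
  qed
  with G show ?thesis by blast
qed

lemma resolution_tower:
  fixes N :: "'g::comm_ring_1 \<Rightarrow> (nat \<Rightarrow> 'k::field mpol) set"
  assumes N: "graded_submodule V dg r s N" and V: "finite V"
    and pos: "\<And>m. supp m \<subseteq> V \<Longrightarrow> mon_degree dg m = 0 \<Longrightarrow> m = 0"
  obtains R :: "nat \<Rightarrow> nat" and t :: "nat \<Rightarrow> nat \<Rightarrow> 'g" and G :: "nat \<Rightarrow> nat \<Rightarrow> nat \<Rightarrow> 'k mpol"
  where "gens V dg N (R 0) (t 0) (G 0)"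
    and "\<And>k. gens V dg (syz V dg (R k) (t k) (G k)) (R (Suc k)) (t (Suc k)) (G (Suc k))"
    and "\<And>k. minimal_gens V dg (R k) (t k) (G k)"
proof -
  let ?P = "\<lambda>k :: nat. \<lambda>(R, t, G :: nat \<Rightarrow> nat \<Rightarrow> 'k mpol).
    minimal_gens V dg R t G \<and> (k = 0 \<longrightarrow> gens V dg N R t G)"
  let ?Q = "\<lambda>k :: nat. \<lambda>(R, t, G :: nat \<Rightarrow> nat \<Rightarrow> 'k mpol) (R', t', G'). gens V dg (syz V dg R t G) R' t' G'"
  have 0: "\<exists>x. ?P 0 x" using minimal_gens_exist[OF N V pos] by auto
  have step: "\<exists>y. ?P (Suc k) y \<and> ?Q k x y" for x k
  proof -
    obtain R t and G :: "nat \<Rightarrow> nat \<Rightarrow> 'k mpol" where x: "x = (R, t, G)" by (cases x)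
    show ?thesis using minimal_gens_exist[OF graded_submodule_syz[of V dg R t G] V pos] unfolding x by auto
  qed
  obtain f where f: "\<forall>k. ?P k (f k) \<and> ?Q k (f k) (f (Suc k))"
    using dependent_nat_choice[of ?P ?Q, OF 0 step] by (elim exE)
  define R where "R k = fst (f k)" for k
  define t where "t k = fst (snd (f k))" for k
  define G where "G k = snd (snd (f k))" for k
  have fk: "f k = (R k, t k, G k)" for k by (simp add: R_def t_def G_def)
  show thesis
    using f unfolding fk prod.case by (intro that[of R t G]) blast+
qed

subsection \<open>From graded to ungraded exactness\<close>

definition free_part ::
  "(var \<Rightarrow> 'g::comm_ring_1) \<Rightarrow> (nat \<Rightarrow> 'g) \<Rightarrow> 'g \<Rightarrow> (nat \<Rightarrow> 'k::field mpol) \<Rightarrow> nat \<Rightarrow> 'k mpol" where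
  "free_part dg s a x = (\<lambda>j. hpart dg (a - s j) (x j))"

lemma free_part_fcomp: "x \<in> free_mod V r \<Longrightarrow> free_part dg s a x \<in> fcomp V dg r s a"
  by (auto simp: free_part_def fcomp_iff free_mod_def intro!: polys_part homogeneous_hpart)

lemma sum_fun_apply: "(\<Sum>i\<in>A. g i) x = (\<Sum>i\<in>A. g i x)" for g :: "'a \<Rightarrow> 'b \<Rightarrow> 'c::comm_monoid_add"
  by (induction A rule: infinite_finite_induct) simp_all

lemma free_part_sum:
  fixes x :: "nat \<Rightarrow> 'k::field mpol"
  assumes "x \<in> free_mod V r"
  shows "\<exists>A. finite A \<and> x = (\<Sum>a\<in>A. free_part dg s a x)"
proof (intro exI conjI)
  let ?A = "\<Union>j<r. (\<lambda>m. s j + mon_degree dg m) ` supp (x j)"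
  show "finite ?A" by auto
  have "x j = (\<Sum>a\<in>?A. free_part dg s a x) j" for j
  proof (rule poly_mapping_eqI)
    fix m
    have "coeff ((\<Sum>a\<in>?A. free_part dg s a x) j) m = (\<Sum>a\<in>?A. coeff (free_part dg s a x j) m)"
      by (simp add: sum_fun_apply lookup_sum)
    also have "\<dots> = (\<Sum>a\<in>?A. if a = s j + mon_degree dg m then coeff (x j) m else 0)"
      by (intro sum.cong refl) (auto simp: free_part_def coeff_part algebra_simps)
    also have "\<dots> = (if s j + mon_degree dg m \<in> ?A then coeff (x j) m else 0)"
      by (simp add: sum.delta \<open>finite ?A\<close>)
    also have "\<dots> = coeff (x j) m"
    proof (cases "m \<in> supp (x j)")
      case True
      then have "j < r" using assms by (cases "j < r") (auto simp: free_mod_def)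
      then show ?thesis using True by auto
    qed (simp add: in_keys_iff)
    finally show "coeff (x j) m = coeff ((\<Sum>a\<in>?A. free_part dg s a x) j) m" by simp
  qed
  then show "x = (\<Sum>a\<in>?A. free_part dg s a x)" by (rule ext)
qed

lemma free_mod_add: "x \<in> free_mod V r \<Longrightarrow> y \<in> free_mod V r \<Longrightarrow> x + y \<in> free_mod V r"
  by (auto simp: free_mod_def intro: polys_add)

lemma free_mod_sum: "(\<And>i. i \<in> A \<Longrightarrow> g i \<in> free_mod V r) \<Longrightarrow> (\<Sum>i\<in>A. g i) \<in> free_mod V r"
proof (induction A rule: infinite_finite_induct)
  case (insert i A)
  then show ?case unfolding sum.insert[OF insert.hyps] by (intro free_mod_add) auto
qed (auto simp: free_mod_def)

text \<open>Every element is the finite sum of its homogeneous parts, so it is enough to generate these. In this way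
  exactness in each degree yields the exactness that the definition of a resolution asks for.\<close>

lemma graded_generation:
  assumes S: "S \<subseteq> free_mod V r" "\<And>x a. x \<in> S \<Longrightarrow> free_part dg s a x \<in> S"
    and gen: "\<And>a. S \<inter> fcomp V dg r s a \<subseteq> comb R G ` fcomp V dg R t a"
  shows "S \<subseteq> comb R G ` free_mod V R"
proof
  fix x assume x: "x \<in> S"
  obtain A where A: "finite A" "x = (\<Sum>a\<in>A. free_part dg s a x)"
    using free_part_sum[of x V r] S(1) x by blast
  have "free_part dg s a x \<in> comb R G ` fcomp V dg R t a" for a
    using gen[of a] S(2)[OF x] free_part_fcomp[of x V r] S(1) x by blast
  then have "\<forall>a. \<exists>c. c \<in> fcomp V dg R t a \<and> free_part dg s a x = comb R G c" by (simp add: image_iff Bex_def)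
  from choice[OF this] obtain c
    where c: "\<And>a. c a \<in> fcomp V dg R t a" "\<And>a. free_part dg s a x = comb R G (c a)" by auto
  have "(\<Sum>a\<in>A. c a) \<in> free_mod V R" using c(1) by (intro free_mod_sum) (simp add: fcomp_def)
  moreover have "x = comb R G (\<Sum>a\<in>A. c a)" using A(2) c(2) by (simp add: comb_sum)
  ultimately show "x \<in> comb R G ` free_mod V R" by blast
qed

lemma hpart_comb:
  assumes "\<And>j. j < R \<Longrightarrow> homogeneous dg (t j - b) (G j i)"
  shows "hpart dg (a - b) (comb R G c i) = comb R G (free_part dg t a c) i"
proof -
  have "hpart dg (a - b) (c j * G j i) = hpart dg (a - t j) (c j) * G j i" if "j < R" for j
    using hpart_mult[OF assms[OF that], of "a - b" "c j"] by simp
  then show ?thesis by (simp add: comb_def part_sum free_part_def)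
qed

lemma syz_generation:
  assumes G: "\<And>j. j < R \<Longrightarrow> G j \<in> fcomp V dg r s (t j)"
    and gens: "gens V dg (syz V dg R t G) R' t' G'"
  shows "{c \<in> free_mod V R. comb R G c = 0} = comb R' G' ` free_mod V R'"
proof (intro equalityI)
  show "{c \<in> free_mod V R. comb R G c = 0} \<subseteq> comb R' G' ` free_mod V R'"
  proof (rule graded_generation[where s = t and dg = dg and t = t'])
    fix c a assume "c \<in> {c \<in> free_mod V R. comb R G c = 0}"
    then have c: "c \<in> free_mod V R" "comb R G c = 0" by auto
    have "comb R G (free_part dg t a c) i = 0" for i
    proof (cases "i < r")
      case True
      then have "comb R G (free_part dg t a c) i = hpart dg (a - s i) (comb R G c i)"
        using G by (intro hpart_comb[symmetric]) (auto simp: fcomp_iff)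
      then show ?thesis by (simp add: c(2))
    next
      case False
      then show ?thesis using G by (auto simp: comb_def fcomp_iff intro!: sum.neutral)
    qed
    then show "free_part dg t a c \<in> {c \<in> free_mod V R. comb R G c = 0}"
      using free_part_fcomp[OF c(1), of dg t a] by (auto simp: fcomp_def fun_eq_iff)
  next
    fix a
    show "{c \<in> free_mod V R. comb R G c = 0} \<inter> fcomp V dg R t a \<subseteq> comb R' G' ` fcomp V dg R' t' a"
      using gens unfolding gens_def syz_def by blast
  qed blast
next
  have G': "G' j \<in> fcomp V dg R t (t' j)" "comb R G (G' j) = 0" if "j < R'" for j
    using gens that by (auto simp: gens_def syz_def)
  show "comb R' G' ` free_mod V R' \<subseteq> {c \<in> free_mod V R. comb R G c = 0}"
  proof (intro subsetI, elim imageE)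
    fix y c assume y: "y = comb R' G' c" and c: "c \<in> free_mod V R'"
    have 1: "comb R' G' c \<in> free_mod V R" unfolding free_mod_def
    proof (intro CollectI conjI allI impI)
      fix i assume "i < R"
      then show "comb R' G' c i \<in> polys V"
        using c G'(1) by (auto simp: comb_def free_mod_def fcomp_iff intro!: polys_sum polys_mult)
    next
      fix i assume "R \<le> i"
      then show "comb R' G' c i = 0" using G'(1) by (auto simp: comb_def fcomp_iff intro!: sum.neutral)
    qed
    have "comb R' G' c = (\<Sum>j<R'. (\<lambda>i. c j * G' j i))" by (simp add: comb_def fun_eq_iff sum_fun_apply)
    then have "comb R G (comb R' G' c) = (\<Sum>j<R'. comb R G (\<lambda>i. c j * G' j i))" by (simp add: comb_sum)
    also have "\<dots> = 0" using G'(2) by (intro sum.neutral) (simp add: comb_mult fun_eq_iff)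
    finally show "y \<in> {c \<in> free_mod V R. comb R G c = 0}" using 1 y by simp
  qed
qed

lemma deg_of_fcomp:
  assumes "x \<in> fcomp V dg r s a" "x \<noteq> 0"
    and Deg: "\<And>j. j < r \<Longrightarrow> s j \<in> Deg" "\<And>m. supp m \<subseteq> V \<Longrightarrow> mon_degree dg m \<in> Deg"
      "\<And>a b. a \<in> Deg \<Longrightarrow> b \<in> Deg \<Longrightarrow> a + b \<in> Deg"
  shows "a \<in> Deg"
proof -
  from assms(2) obtain j where j: "x j \<noteq> 0" by (auto simp: fun_eq_iff)
  with assms(1) have jr: "j < r" by (cases "j < r") (auto simp: fcomp_iff)
  have "supp (x j) \<noteq> {}" using j sum_monoms[of "x j"] by auto
  then obtain m where m: "m \<in> supp (x j)" by blast
  then have "mon_degree dg m = a - s j" "supp m \<subseteq> V" using assms(1) jr by (auto simp: fcomp_iff homogeneous_def polys_def)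
  then show ?thesis using Deg(3)[OF Deg(1)[OF jr] Deg(2)[of m]] by simp
qed

section \<open>The presentation of the multi-Rees algebra\<close>

subsection \<open>The substitution homomorphism\<close>

definition subst_mon :: "(nat \<Rightarrow> nat \<Rightarrow> 'k::field mpol) \<Rightarrow> (var \<Rightarrow>\<^sub>0 nat) \<Rightarrow> 'k mpol" where
  "subst_mon f m = (\<Prod>v\<in>supp m. \<Phi>_var f v ^ coeff m v)"

lemma subst_mon_superset:
  assumes "finite A" "supp m \<subseteq> A"
  shows "subst_mon f m = (\<Prod>v\<in>A. \<Phi>_var f v ^ coeff m v)"
  unfolding subst_mon_def using assms by (intro prod.mono_neutral_left) (auto simp: in_keys_iff)

lemma subst_mon_add: "subst_mon f (m + m') = subst_mon f m * subst_mon f m'"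
proof -
  let ?A = "supp m \<union> supp m'"
  have "subst_mon f (m + m') = (\<Prod>v\<in>?A. \<Phi>_var f v ^ coeff (m + m') v)"
    by (rule subst_mon_superset) (auto simp: supp_add_nat)
  also have "\<dots> = (\<Prod>v\<in>?A. \<Phi>_var f v ^ coeff m v) * (\<Prod>v\<in>?A. \<Phi>_var f v ^ coeff m' v)"
    by (simp add: lookup_add power_add prod.distrib)
  also have "\<dots> = subst_mon f m * subst_mon f m'"
    by (simp add: subst_mon_superset[of ?A])
  finally show ?thesis .
qed

lemma subst_mon_0 [simp]: "subst_mon f 0 = 1"
  by (simp add: subst_mon_def)

lemma subst_mon_single: "subst_mon f (monom v 1) = \<Phi>_var f v"
  by (simp add: subst_mon_def)

lemma Phi_superset:
  assumes "finite A" "supp p \<subseteq> A"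
  shows "\<Phi> f p = (\<Sum>m\<in>A. monom 0 (coeff p m) * subst_mon f m)"
  unfolding \<Phi>_def subst_mon_def[symmetric] using assms
  by (intro sum.mono_neutral_left) (auto simp: in_keys_iff)

lemma Phi_add: "\<Phi> f (p + q) = \<Phi> f p + \<Phi> f q"
proof -
  let ?A = "supp p \<union> supp q"
  have "\<Phi> f (p + q) = (\<Sum>m\<in>?A. monom 0 (coeff (p + q) m) * subst_mon f m)"
    using keys_add[of p q] by (intro Phi_superset) auto
  also have "\<dots> = (\<Sum>m\<in>?A. monom 0 (coeff p m) * subst_mon f m) + (\<Sum>m\<in>?A. monom 0 (coeff q m) * subst_mon f m)"
    by (simp add: lookup_add single_add distrib_right sum.distrib)
  also have "\<dots> = \<Phi> f p + \<Phi> f q"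
    by (simp add: Phi_superset[of ?A])
  finally show ?thesis .
qed

lemma Phi_0 [simp]: "\<Phi> f 0 = 0"
  by (simp add: \<Phi>_def)

lemma Phi_monom: "\<Phi> f (monom m c) = monom 0 c * subst_mon f m"
  using Phi_superset[of "{m}" "monom m c" f] by simp

lemma Phi_sum: "\<Phi> f (\<Sum>i\<in>A. g i) = (\<Sum>i\<in>A. \<Phi> f (g i))"
  by (induction A rule: infinite_finite_induct) (simp_all add: Phi_add)

lemma Phi_mult: "\<Phi> (f :: _ \<Rightarrow> _ \<Rightarrow> 'a::field mpol) (p * q) = \<Phi> f p * \<Phi> f q"
proof -
  have mono: "\<Phi> f (monom m c * monom m' c') = \<Phi> f (monom m c) * \<Phi> f (monom m' c')" for m m' c c'
  proof -
    have s: "monom 0 (c * c') = monom 0 c * (monom 0 c' :: 'a mpol)" by (simp add: mult_single)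
    show ?thesis unfolding mult_single[of m c] Phi_monom subst_mon_add s by (simp only: mult_ac)
  qed
  have "p * q = (\<Sum>m\<in>supp p. \<Sum>m'\<in>supp q. monom m (coeff p m) * monom m' (coeff q m'))"
    by (subst (1) sum_monoms[of p, symmetric], subst (1) sum_monoms[of q, symmetric]) (simp add: sum_product)
  then have "\<Phi> f (p * q) = (\<Sum>m\<in>supp p. \<Sum>m'\<in>supp q. \<Phi> f (monom m (coeff p m)) * \<Phi> f (monom m' (coeff q m')))"
    by (simp add: Phi_sum mono)
  also have "\<dots> = \<Phi> f (\<Sum>m\<in>supp p. monom m (coeff p m)) * \<Phi> f (\<Sum>m'\<in>supp q. monom m' (coeff q m'))"
    by (simp add: Phi_sum sum_product)
  finally show ?thesis by (simp add: sum_monoms)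
qed

lemma Phi_Var: "\<Phi> f (Var v) = \<Phi>_var f v"
  unfolding Var_def Phi_monom subst_mon_single by simp

lemma monomial_induct [consumes 1, case_names zero step]:
  assumes "supp m \<subseteq> V" "P 0"
    and "\<And>v m. v \<in> V \<Longrightarrow> supp m \<subseteq> V \<Longrightarrow> P m \<Longrightarrow> P (monom v 1 + m)"
  shows "P (m :: var \<Rightarrow>\<^sub>0 nat)"
  using assms(1)
proof (induction "nat (mon_degree (\<lambda>_. 1 :: int) m)" arbitrary: m rule: less_induct)
  case less
  show ?case
  proof (cases "m = 0")
    case False
    then obtain v where v: "v \<in> supp m" by (auto simp: poly_mapping_eq_iff fun_eq_iff in_keys_iff)
    define m' where "m' = m - monom v 1"
    have m: "m = monom v 1 + m'"
      unfolding m'_def using v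
      by (intro poly_mapping_eqI) (auto simp: lookup_add lookup_minus lookup_single when_def in_keys_iff)
    have "supp m' \<subseteq> V" using less.prems by (simp add: m supp_add_nat)
    moreover have "nat (mon_degree (\<lambda>_. 1 :: int) m') < nat (mon_degree (\<lambda>_. 1 :: int) m)"
      using mon_degree_one_nonneg[of m'] by (simp add: m mon_degree_add mon_degree_single)
    ultimately have "P m'" using less.hyps by blast
    then show ?thesis unfolding m using assms(3) v less.prems \<open>supp m' \<subseteq> V\<close> by blast
  qed (simp add: assms(2))
qed

lemma subst_mon_X:
  assumes "supp m \<subseteq> X_vars n"
  shows "subst_mon f m = monom m 1"
  using assms
proof (induction m rule: monomial_induct)
  case (step v m)
  then have "subst_mon f (monom v 1 + m) = Var v * monom m 1"
    unfolding subst_mon_add subst_mon_single by (auto simp: X_vars_def supp_add_nat)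
  then show ?case by (simp add: Var_def mult_single)
qed simp

lemma Phi_X: 
  assumes "p \<in> polys (X_vars n)"
  shows "\<Phi> f p = p"
proof -
  have "\<Phi> f p = (\<Sum>m\<in>supp p. \<Phi> f (monom m (coeff p m)))"
    by (subst sum_monoms[of p, symmetric]) (simp only: Phi_sum)
  also have "\<dots> = (\<Sum>m\<in>supp p. monom m (coeff p m))"
    using assms by (intro sum.cong) (auto simp: Phi_monom subst_mon_X polys_def mult_single)
  finally show ?thesis by (simp add: sum_monoms)
qed

lemma homogeneous_X_multi:
  assumes "p \<in> polys (X_vars n)" "homogeneous std_degree e p"
  shows "homogeneous (multi_degree d) (\<lambda>l. e * unit_deg 0 l) p"
  unfolding homogeneous_def
proof
  fix m assume m: "m \<in> supp p"
  have "mon_degree (multi_degree d) m = (\<lambda>l. mon_degree std_degree m * unit_deg 0 l)"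
  proof -
    have "supp m \<subseteq> X_vars n" using m assms(1) by (auto simp: polys_def)
    then have "multi_degree d v = unit_deg 0" if "v \<in> supp m" for v using that by (auto simp: X_vars_def)
    then show ?thesis
      by (simp add: mon_degree_def std_degree_def fun_eq_iff sum_fun_apply sum_distrib_right)
  qed
  then show "mon_degree (multi_degree d) m = (\<lambda>l. e * unit_deg 0 l)"
    using m assms(2) by (simp add: homogeneous_def)
qed

subsection \<open>Ideals and their products\<close>

lemma poly_ring_simps [simp]:
  "carrier (poly_ring V) = polys V" "x \<otimes>\<^bsub>poly_ring V\<^esub> y = x * y" "x \<oplus>\<^bsub>poly_ring V\<^esub> y = x + y"
  "\<one>\<^bsub>poly_ring V\<^esub> = 1" "\<zero>\<^bsub>poly_ring V\<^esub> = 0"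
  by (simp_all add: poly_ring_def)

lemma cring_poly_ring: "cring (poly_ring V)"
proof (rule cringI)
  show "abelian_group (poly_ring V)"
    by (rule abelian_groupI) (auto simp: polys_add add_ac intro: bexI[of _ "- _"] polys_uminus)
  show "comm_monoid (poly_ring V)"
    by (rule comm_monoidI) (auto simp: polys_mult mult_ac)
qed (simp add: distrib_right)

lemma idealD:
  assumes "ideal J (poly_ring V)"
  shows "J \<subseteq> polys V" "0 \<in> J" "x \<in> J \<Longrightarrow> y \<in> J \<Longrightarrow> x + y \<in> J" "x \<in> J \<Longrightarrow> p \<in> polys V \<Longrightarrow> p * x \<in> J"
proof -
  interpret ideal J "poly_ring V" by (rule assms)
  show "J \<subseteq> polys V" using a_subset by simp
  show "0 \<in> J" using additive_subgroup.zero_closed[OF ideal.axioms(1)[OF assms]] by simp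
  show "x + y \<in> J" if "x \<in> J" "y \<in> J" using additive_subgroup.a_closed[OF ideal.axioms(1)[OF assms] that] by simp
  show "p * x \<in> J" if "x \<in> J" "p \<in> polys V" using I_l_closed[of x p] that by simp
qed

lemma ideal_diff:
  assumes "ideal J (poly_ring V)" "x \<in> J" "y \<in> J"
  shows "x - y \<in> J"
proof -
  have "- 1 * y \<in> J" by (rule idealD(4)[OF assms(1,3)]) (intro polys_uminus polys_1)
  then show ?thesis using idealD(3)[OF assms(1,2), of "- y"] by simp
qed

lemma ideal_sum: "ideal J (poly_ring V) \<Longrightarrow> (\<And>i. i \<in> A \<Longrightarrow> g i \<in> J) \<Longrightarrow> (\<Sum>i\<in>A. g i) \<in> J"
  by (induction A rule: infinite_finite_induct) (auto simp: idealD)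

lemma poly_ring_idealI:
  assumes "J \<subseteq> polys V" "0 \<in> J" "\<And>x y. x \<in> J \<Longrightarrow> y \<in> J \<Longrightarrow> x + y \<in> J"
    "\<And>x p. x \<in> J \<Longrightarrow> p \<in> polys V \<Longrightarrow> p * x \<in> J"
  shows "ideal J (poly_ring V)"
proof (rule idealI)
  interpret cring "poly_ring V" by (rule cring_poly_ring)
  show "ring (poly_ring V)" by (rule ring_axioms)
  have um: "- x \<in> J" if "x \<in> J" for x
    using assms(4)[OF that, of "- 1"] by (simp add: polys_uminus)
  show "subgroup J (add_monoid (poly_ring V))"
  proof (rule add.subgroupI)
    show "J \<subseteq> carrier (poly_ring V)" using assms(1) by simp
    show "J \<noteq> {}" using assms(2) by blast
    show "\<ominus>\<^bsub>poly_ring V\<^esub> x \<in> J" if "x \<in> J" for x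
    proof -
      have x: "x \<in> polys V" using that assms(1) by blast
      then have "\<ominus>\<^bsub>poly_ring V\<^esub> x = - x"
        using minus_equality[of "- x" x] by (simp add: polys_uminus)
      then show ?thesis using um[OF that] by simp
    qed
    show "x \<oplus>\<^bsub>poly_ring V\<^esub> y \<in> J" if "x \<in> J" "y \<in> J" for x y using assms(3) that by simp
  qed
  show "x \<otimes>\<^bsub>poly_ring V\<^esub> a \<in> J" "a \<otimes>\<^bsub>poly_ring V\<^esub> x \<in> J" if "a \<in> J" "x \<in> carrier (poly_ring V)" for a x
    using assms(4)[OF that(1), of x] that(2) by (simp_all add: mult.commute)
qed

lemma Idl_poly_ring:
  assumes "S \<subseteq> polys V"
  shows "ideal (Idl\<^bsub>poly_ring V\<^esub> S) (poly_ring V)" "S \<subseteq> Idl\<^bsub>poly_ring V\<^esub> S"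
    "\<And>J. ideal J (poly_ring V) \<Longrightarrow> S \<subseteq> J \<Longrightarrow> Idl\<^bsub>poly_ring V\<^esub> S \<subseteq> J"
proof -
  interpret cring "poly_ring V" by (rule cring_poly_ring)
  show "ideal (Idl\<^bsub>poly_ring V\<^esub> S) (poly_ring V)" using assms by (intro genideal_ideal) simp
  show "S \<subseteq> Idl\<^bsub>poly_ring V\<^esub> S" using assms by (intro genideal_self) simp
  show "Idl\<^bsub>poly_ring V\<^esub> S \<subseteq> J" if "ideal J (poly_ring V)" "S \<subseteq> J" for J
    by (rule genideal_minimal[OF that])
qed

definition Tm :: "nat \<Rightarrow> (nat \<Rightarrow> nat) \<Rightarrow> 'k::field mpol" where
  "Tm w a = (\<Prod>i=1..w. Var (T i) ^ a i)"

lemma Tm_cong: "(\<And>i. i \<in> {1..w} \<Longrightarrow> a i = b i) \<Longrightarrow> Tm w a = Tm w b"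
  unfolding Tm_def by (rule prod.cong) auto

lemma Tm_Suc:
  assumes "i \<in> {1..w}"
  shows "Tm w (a(i := Suc (a i))) = Var (T i) * Tm w a"
proof -
  have "Tm w (a(i := Suc (a i))) = Var (T i) ^ Suc (a i) * (\<Prod>l\<in>{1..w} - {i}. Var (T l) ^ a l)"
    unfolding Tm_def by (subst prod.remove[OF _ assms]) (auto intro!: prod.cong)
  also have "\<dots> = Var (T i) * Tm w a"
    unfolding Tm_def by (subst prod.remove[OF _ assms]) (simp_all add: mult.assoc)
  finally show ?thesis .
qed

lemma Tm_monom: "\<exists>t. Tm w a = (monom t 1 :: 'k::field mpol) \<and> supp t \<subseteq> T ` {1..w} \<and>
    mon_degree (multi_degree d) t = (\<Sum>i=1..w. of_nat (a i) * multi_degree d (T i))"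
proof (intro exI conjI)
  let ?t = "\<Sum>i=1..w. monom (T i) (a i)"
  have pw: "Var v ^ k = monom (monom v k) (1 :: 'k)" for v k
    by (induction k) (simp_all add: Var_def mult_single flip: single_add)
  have "(\<Prod>i\<in>A. Var (T i) ^ a i) = monom (\<Sum>i\<in>A. monom (T i) (a i)) (1 :: 'k)" if "finite A" for A
    using that by (induction A) (simp_all add: pw mult_single)
  then show "Tm w a = monom ?t (1 :: 'k)" by (simp add: Tm_def)
  have "supp (\<Sum>i\<in>A. monom (T i) (a i)) \<subseteq> T ` A \<and>
      mon_degree (multi_degree d) (\<Sum>i\<in>A. monom (T i) (a i)) = (\<Sum>i\<in>A. of_nat (a i) * multi_degree d (T i))"
    if "finite A" for A
    using that by (induction A) (auto simp: mon_degree_add mon_degree_single supp_add_nat split: if_splits)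
  from this[of "{1..w}"] show "supp ?t \<subseteq> T ` {1..w}"
    "mon_degree (multi_degree d) ?t = (\<Sum>i=1..w. of_nat (a i) * multi_degree d (T i))" by simp_all
qed

locale rees_setting =
  fixes n w :: nat
    and I :: "nat \<Rightarrow> 'k::field mpol set"
    and d m :: "nat \<Rightarrow> nat"
    and f :: "nat \<Rightarrow> nat \<Rightarrow> 'k mpol"
  assumes f: "\<And>i j. i \<in> {1..w} \<Longrightarrow> j \<in> {1..m i} \<Longrightarrow>
             f i j \<in> polys (X_vars n) \<and> homogeneous std_degree (int (d i)) (f i j)"
    and I: "\<And>i. i \<in> {1..w} \<Longrightarrow> I i = Idl\<^bsub>poly_ring (X_vars n)\<^esub> (f i ` {1..m i})"
begin

abbreviation "R \<equiv> poly_ring (X_vars n) :: 'k mpol ring"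
abbreviation "XP \<equiv> polys (X_vars n) :: 'k mpol set"
abbreviation "SP \<equiv> polys (S_vars n w m) :: 'k mpol set"
abbreviation "J \<equiv> prod_ideal n w I"

lemma f_polys: "i \<in> {1..w} \<Longrightarrow> f i ` {1..m i} \<subseteq> XP"
  using f by auto

lemma ideal_I: "i \<in> {1..w} \<Longrightarrow> ideal (I i) R"
  using Idl_poly_ring(1)[OF f_polys] I by simp

lemma comm_monoid_ideals: "comm_monoid (ideals_set R)"
  by (rule cring.ideals_set_is_comm_monoid[OF cring_poly_ring])

lemma ideals_carrier: "x \<in> carrier (ideals_set R) \<longleftrightarrow> ideal x R"
  by (simp add: ideals_set_def)

lemma pow_closed: "i \<in> {1..w} \<Longrightarrow> I i [^]\<^bsub>ideals_set R\<^esub> (k :: nat) \<in> carrier (ideals_set R)"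
proof -
  interpret comm_monoid "ideals_set R" by (rule comm_monoid_ideals)
  show "i \<in> {1..w} \<Longrightarrow> ?thesis" by (intro nat_pow_closed) (simp add: ideals_carrier ideal_I)
qed

lemma ideal_J: "ideal (J a) R"
proof -
  interpret comm_monoid "ideals_set R" by (rule comm_monoid_ideals)
  have "J a \<in> carrier (ideals_set R)"
    unfolding prod_ideal_def Let_def using pow_closed by (intro finprod_closed) auto
  then show ?thesis by (simp add: ideals_carrier)
qed

lemma J_cong: 
  assumes "\<And>i. i \<in> {1..w} \<Longrightarrow> a i = b i"
  shows "J a = J b"
proof -
  interpret comm_monoid "ideals_set R" by (rule comm_monoid_ideals)
  show ?thesis unfolding prod_ideal_def Let_def
    using pow_closed assms by (intro finprod_cong') auto
qed

lemma J_0: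
  assumes "\<And>i. i \<in> {1..w} \<Longrightarrow> a i = 0"
  shows "J a = XP"
proof -
  interpret comm_monoid "ideals_set R" by (rule comm_monoid_ideals)
  have "J a = \<one>\<^bsub>ideals_set R\<^esub>" unfolding prod_ideal_def Let_def
    using assms by (intro finprod_one_eqI) auto
  then show ?thesis by (simp add: ideals_set_def)
qed

lemma J_Suc:
  assumes i: "i \<in> {1..w}"
  shows "J (a(i := Suc (a i))) = ideal_prod R (I i) (J a)"
proof -
  interpret comm_monoid "ideals_set R" by (rule comm_monoid_ideals)
  let ?P = "\<lambda>a. finprod (ideals_set R) (\<lambda>l. I l [^]\<^bsub>ideals_set R\<^esub> a l) ({1..w} - {i})"
  have split: "J a = I i [^]\<^bsub>ideals_set R\<^esub> a i \<otimes>\<^bsub>ideals_set R\<^esub> ?P a" for a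
  proof -
    have "J a = finprod (ideals_set R) (\<lambda>l. I l [^]\<^bsub>ideals_set R\<^esub> a l) (insert i ({1..w} - {i}))"
      unfolding prod_ideal_def Let_def using i by (simp add: insert_absorb)
    also have "\<dots> = I i [^]\<^bsub>ideals_set R\<^esub> a i \<otimes>\<^bsub>ideals_set R\<^esub> ?P a"
      using pow_closed i by (intro finprod_insert) auto
    finally show ?thesis .
  qed
  have P: "?P (a(i := Suc (a i))) = ?P a"
    using pow_closed by (intro finprod_cong') auto
  have cl: "I i \<in> carrier (ideals_set R)" "I i [^]\<^bsub>ideals_set R\<^esub> a i \<in> carrier (ideals_set R)"
    using pow_closed i by (auto simp: ideals_carrier ideal_I)
  have "?P a \<in> carrier (ideals_set R)" using pow_closed by (intro finprod_closed) auto
  note cl = cl this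
  have "J (a(i := Suc (a i))) = (I i [^]\<^bsub>ideals_set R\<^esub> a i \<otimes>\<^bsub>ideals_set R\<^esub> I i) \<otimes>\<^bsub>ideals_set R\<^esub> ?P a"
    unfolding split[of "a(i := Suc (a i))"] P by simp
  also have "\<dots> = I i \<otimes>\<^bsub>ideals_set R\<^esub> J a"
    unfolding split[of a] using cl by (simp add: m_comm m_assoc)
  finally show ?thesis by (simp add: ideals_set_def)
qed

text \<open>Exponents are functions on all of \<open>nat\<close>, of which only the values on \<open>{1..w}\<close> count; hence the base
  case covers every function that vanishes there.\<close>

lemma exponent_induct:
  assumes "\<And>a. (\<And>i. i \<in> {1..w} \<Longrightarrow> a i = 0) \<Longrightarrow> P a"
    and "\<And>a i. i \<in> {1..w} \<Longrightarrow> P a \<Longrightarrow> P (a(i := Suc (a i)))"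
  shows "P (a :: nat \<Rightarrow> nat)"
proof (induction "\<Sum>i=1..w. a i" arbitrary: a)
  case 0
  then show ?case by (intro assms(1)) auto
next
  case (Suc k)
  then obtain i where i: "i \<in> {1..w}" "a i \<noteq> 0" by (metis sum.neutral nat.distinct(1))
  let ?b = "a(i := a i - 1)"
  have "(\<Sum>i=1..w. a i) = a i + (\<Sum>l\<in>{1..w} - {i}. a l)" using i by (simp add: sum.remove)
  moreover have "(\<Sum>i=1..w. ?b i) = (a i - 1) + (\<Sum>l\<in>{1..w} - {i}. a l)"
    using i by (simp add: sum.remove[of _ i] cong: sum.cong_simp)
  ultimately have "P ?b" using Suc i by (intro Suc(1)) auto
  then have "P (?b(i := Suc (?b i)))" by (rule assms(2)[OF i(1)])
  moreover have "?b(i := Suc (?b i)) = a" using i by auto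
  ultimately show ?case by simp
qed

end

subsection \<open>The multi-Rees algebra as an image\<close>

context rees_setting
begin

lemma f_in_I: "i \<in> {1..w} \<Longrightarrow> j \<in> {1..m i} \<Longrightarrow> f i j \<in> I i"
  using Idl_poly_ring(2)[OF f_polys, of i] I[of i] by blast

definition Z_exponent :: "(var \<Rightarrow>\<^sub>0 nat) \<Rightarrow> nat \<Rightarrow> nat" where
  "Z_exponent mm i = (\<Sum>j=1..m i. coeff mm (Z i j))"

lemma Z_exponent_X: "Z_exponent (monom (X k) 1 + mm) = Z_exponent mm"
  by (simp add: Z_exponent_def fun_eq_iff lookup_add lookup_single when_def)

lemma Z_exponent_Z:
  assumes "j \<in> {1..m i}"
  shows "Z_exponent (monom (Z i j) 1 + mm) = (Z_exponent mm)(i := Suc (Z_exponent mm i))"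
proof
  fix l
  have "(\<Sum>j'=1..m l. coeff (monom (Z i j) (1 :: nat)) (Z l j')) = (\<Sum>j'=1..m l. if j' = j then (if l = i then 1 else 0) else 0)"
    by (rule sum.cong) (auto simp: lookup_single when_def)
  also have "\<dots> = (if l = i then 1 else 0)"
    using assms by (auto simp: sum.delta)
  finally show "Z_exponent (monom (Z i j) 1 + mm) l = ((Z_exponent mm)(i := Suc (Z_exponent mm i))) l"
    by (simp add: Z_exponent_def lookup_add sum.distrib)
qed

lemma S_vars_cases:
  assumes "v \<in> S_vars n w m"
  obtains k where "v = X k" "k \<in> {1..n}" | i j where "v = Z i j" "i \<in> {1..w}" "j \<in> {1..m i}"
  using assms by (auto simp: S_vars_def X_vars_def)

lemma XP_SP: "XP \<subseteq> SP"
  by (auto simp: polys_def S_vars_def)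

text \<open>Each factor \<open>Z i j\<close> contributes an element \<open>f i j\<close> of \<open>I i\<close> and a factor \<open>T i\<close>.\<close>

lemma subst_mon_in_product:
  assumes "supp mm \<subseteq> S_vars n w m"
  shows "\<exists>x\<in>J (Z_exponent mm). subst_mon f mm = x * Tm w (Z_exponent mm)"
  using assms
proof (induction mm rule: monomial_induct)
  case zero
  have "J (Z_exponent 0) = XP" by (rule J_0) (simp add: Z_exponent_def)
  moreover have "Tm w (Z_exponent 0) = (1 :: 'k mpol)" by (simp add: Tm_def Z_exponent_def)
  ultimately show ?case by auto
next
  case (step v mm)
  then obtain x where x: "x \<in> J (Z_exponent mm)" "subst_mon f mm = x * Tm w (Z_exponent mm)"
    by (auto simp: supp_add_nat)
  from step(1) show ?case
  proof (cases rule: S_vars_cases)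
    case (1 k)
    then have "Var (X k) * x \<in> J (Z_exponent mm)"
      using x(1) idealD(4)[OF ideal_J] by (auto simp: polys_Var X_vars_def)
    then show ?thesis using x(2)
      unfolding 1 Z_exponent_X subst_mon_add subst_mon_single by (auto simp: mult.assoc intro!: bexI)
  next
    case (2 i j)
    have "f i j \<in> I i" using 2 by (intro f_in_I)
    then have "f i j \<otimes>\<^bsub>R\<^esub> x \<in> ideal_prod R (I i) (J (Z_exponent mm))" using x(1) by (rule ideal_prod.prod)
    then have "f i j * x \<in> J ((Z_exponent mm)(i := Suc (Z_exponent mm i)))" by (simp only: J_Suc[OF 2(2)] poly_ring_simps)
    moreover have "f i j * Var (T i) * (x * Tm w (Z_exponent mm)) = (f i j * x) * (Var (T i) * Tm w (Z_exponent mm))"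
      by (simp only: mult_ac)
    ultimately show ?thesis using x(2) 2
      unfolding 2(1) Z_exponent_Z[OF 2(3)] subst_mon_add subst_mon_single Tm_Suc[OF 2(2)] \<Phi>_var.simps by metis
  qed
qed

abbreviation "ImP \<equiv> \<Phi> f ` SP"

lemma Im_add: "x \<in> ImP \<Longrightarrow> y \<in> ImP \<Longrightarrow> x + y \<in> ImP"
  by (auto simp: Phi_add[symmetric] intro!: imageI polys_add)

lemma Im_mult: "x \<in> ImP \<Longrightarrow> y \<in> ImP \<Longrightarrow> x * y \<in> ImP"
  by (auto simp: Phi_mult[symmetric] intro!: imageI polys_mult)

lemma Im_0: "0 \<in> ImP"
  by (rule image_eqI[of _ _ 0]) auto

lemma XP_Im: "x \<in> XP \<Longrightarrow> x \<in> ImP"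
  using Phi_X[of x n f] XP_SP by (intro image_eqI[of _ _ x]) auto

lemma colon_ideal:
  assumes K: "ideal K R" and g: "g \<in> XP"
  shows "ideal {y \<in> XP. y * g \<in> K} R"
  using idealD[OF K] by (intro poly_ring_idealI) (auto simp: polys_add polys_mult distrib_right mult.assoc)

lemma I_T_in_image:
  assumes i: "i \<in> {1..w}" and "y \<in> I i"
  shows "y * Var (T i) \<in> ImP"
proof -
  have "ideal {y \<in> XP. y * Var (T i) \<in> ImP} R"
    using Im_0 Im_add Im_mult XP_Im
    by (intro poly_ring_idealI) (auto simp: polys_add polys_mult distrib_right mult.assoc simp del: imageI image_iff)
  moreover have "f i j * Var (T i) \<in> ImP" if "j \<in> {1..m i}" for j
    using Phi_Var[of f "Z i j"] that i by (intro image_eqI[of _ _ "Var (Z i j)"]) (auto simp: S_vars_def intro!: polys_Var)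
  ultimately have "I i \<subseteq> {y \<in> XP. y * Var (T i) \<in> ImP}"
    unfolding I[OF i] using f_polys[OF i] by (intro Idl_poly_ring(3)) auto
  then show ?thesis using assms(2) by blast
qed

text \<open>The ideal \<open>I i\<close> is generated by the \<open>f i j\<close>, and \<open>f i j * T i\<close> is the image of \<open>Z i j\<close>; products are
  handled one factor at a time.\<close>

lemma J_Tm_in_image: "\<forall>x\<in>J a. x * Tm w a \<in> ImP"
proof (induction a rule: exponent_induct)
  case (1 a)
  then have "Tm w a = (1 :: 'k mpol)" by (simp add: Tm_def)
  then show ?case using J_0[OF 1] XP_Im by simp
next
  case (2 a i)
  show ?case unfolding J_Suc[OF 2(1)] Tm_Suc[OF 2(1)]
  proof
    fix x assume "x \<in> ideal_prod R (I i) (J a)"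
    then show "x * (Var (T i) * Tm w a) \<in> ImP"
    proof induction
      case (prod y z)
      have "(y * Var (T i)) * (z * Tm w a) \<in> ImP"
        by (rule Im_mult[OF I_T_in_image[OF 2(1) prod(1)] bspec[OF 2(2) prod(2)]])
      moreover have "(y * Var (T i)) * (z * Tm w a) = y \<otimes>\<^bsub>R\<^esub> z * (Var (T i) * Tm w a)"
        by (simp add: mult_ac)
      ultimately show ?case by simp
    next
      case (sum s1 s2)
      then show ?case using Im_add by (simp add: distrib_right)
    qed
  qed
qed

definition gen_degree :: "(nat \<Rightarrow> nat) \<Rightarrow> nat" where
  "gen_degree a = (\<Sum>i=1..w. d i * a i)"

lemma gen_degree_Suc:
  assumes "i \<in> {1..w}"
  shows "gen_degree (a(i := Suc (a i))) = d i + gen_degree a"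
  unfolding gen_degree_def using assms by (simp add: sum.remove[of _ i] algebra_simps)

text \<open>Products of generators of degrees \<open>d i\<close> generate the product ideal, and they all have the same degree.
  Testing generation on one factor at a time uses that \<open>{y. y * g \<in> K}\<close> is an ideal.\<close>

lemma J_generated:
  "J a = Idl\<^bsub>R\<^esub> {g \<in> J a. homogeneous std_degree (int (gen_degree a)) g}"
proof (induction a rule: exponent_induct)
  case (1 a)
  let ?G = "{g \<in> J a. homogeneous std_degree (int (gen_degree a)) g}"
  have G: "?G \<subseteq> XP" using idealD(1)[OF ideal_J] by blast
  have "gen_degree a = 0" using 1 by (simp add: gen_degree_def)
  then have "1 \<in> ?G" using J_0[OF 1] by (simp add: homogeneous_def)
  then have one: "1 \<in> Idl\<^bsub>R\<^esub> ?G" using Idl_poly_ring(2)[OF G] by blast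
  have "J a \<subseteq> Idl\<^bsub>R\<^esub> ?G"
    using idealD(4)[OF Idl_poly_ring(1)[OF G] one] idealD(1)[OF ideal_J] by fastforce
  moreover have "Idl\<^bsub>R\<^esub> ?G \<subseteq> J a" by (rule Idl_poly_ring(3)[OF G ideal_J]) blast
  ultimately show ?case by blast
next
  case (2 a i)
  let ?b = "a(i := Suc (a i))"
  let ?G = "{g \<in> J ?b. homogeneous std_degree (int (gen_degree ?b)) g}"
  let ?H = "{g \<in> J a. homogeneous std_degree (int (gen_degree a)) g}"
  have G: "?G \<subseteq> XP" and H: "?H \<subseteq> XP" using idealD(1)[OF ideal_J] by blast+
  note K = Idl_poly_ring(1)[OF G] and IH = 2(2)
  have IXP: "I i \<subseteq> XP" using idealD(1)[OF ideal_I[OF 2(1)]] .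
  have 1: "f i j * g \<in> Idl\<^bsub>R\<^esub> ?G" if j: "j \<in> {1..m i}" and g: "g \<in> ?H" for j g
  proof -
    have "f i j \<in> I i" using 2(1) j by (rule f_in_I)
    then have "f i j \<otimes>\<^bsub>R\<^esub> g \<in> ideal_prod R (I i) (J a)" using g by (intro ideal_prod.prod) auto
    then have "f i j * g \<in> J ?b" by (simp only: J_Suc[OF 2(1)] poly_ring_simps)
    moreover have "homogeneous std_degree (int (gen_degree ?b)) (f i j * g)"
      using homogeneous_mult[of std_degree "int (d i)" "f i j" "int (gen_degree a)" g] f[OF 2(1) j] g
      by (simp add: gen_degree_Suc[OF 2(1)])
    ultimately show ?thesis using Idl_poly_ring(2)[OF G] by blast
  qed
  have 2: "y * g \<in> Idl\<^bsub>R\<^esub> ?G" if y: "y \<in> I i" and g: "g \<in> ?H" for y g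
  proof -
    have "I i \<subseteq> {y \<in> XP. y * g \<in> Idl\<^bsub>R\<^esub> ?G}"
      unfolding I[OF 2(1)] using 1[OF _ g] f_polys[OF 2(1)] g H
      by (intro Idl_poly_ring(3) colon_ideal[OF K]) auto
    then show ?thesis using y by blast
  qed
  have 3: "y * z \<in> Idl\<^bsub>R\<^esub> ?G" if y: "y \<in> I i" and z: "z \<in> J a" for y z
  proof -
    have "Idl\<^bsub>R\<^esub> ?H \<subseteq> {z \<in> XP. z * y \<in> Idl\<^bsub>R\<^esub> ?G}"
      using 2[OF y] y IXP H
      by (intro Idl_poly_ring(3) colon_ideal[OF K]) (auto simp: mult.commute)
    then have "z * y \<in> Idl\<^bsub>R\<^esub> ?G" using z IH by blast
    then show ?thesis by (simp only: mult.commute)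
  qed
  have "J ?b \<subseteq> Idl\<^bsub>R\<^esub> ?G"
  proof
    fix x assume "x \<in> J ?b"
    then have "x \<in> ideal_prod R (I i) (J a)" using J_Suc[OF \<open>i \<in> {1..w}\<close>, of a] by simp
    then show "x \<in> Idl\<^bsub>R\<^esub> ?G"
    proof induction
      case (prod y z)
      then show ?case unfolding poly_ring_simps by (rule 3)
    next
      case (sum s1 s2)
      show ?case unfolding poly_ring_simps by (rule idealD(3)[OF K sum.IH])
    qed
  qed
  moreover have "Idl\<^bsub>R\<^esub> ?G \<subseteq> J ?b" by (rule Idl_poly_ring(3)[OF G ideal_J]) blast
  ultimately show ?case by blast
qed

lemma multi_rees_add:
  assumes "p \<in> multi_rees n w I" "q \<in> multi_rees n w I"
  shows "p + q \<in> multi_rees n w I"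
proof -
  from assms obtain A x B y where p: "p = (\<Sum>a\<in>A. x a * Tm w a)" "finite A" "\<forall>a\<in>A. x a \<in> J a"
    and q: "q = (\<Sum>a\<in>B. y a * Tm w a)" "finite B" "\<forall>a\<in>B. y a \<in> J a"
    unfolding multi_rees_def Tm_def by blast
  let ?x = "\<lambda>a. if a \<in> A then x a else 0" and ?y = "\<lambda>a. if a \<in> B then y a else 0"
  have "p = (\<Sum>a\<in>A \<union> B. ?x a * Tm w a)" "q = (\<Sum>a\<in>A \<union> B. ?y a * Tm w a)"
    unfolding p(1) q(1) using p(2) q(2) by (auto intro!: sum.mono_neutral_cong_left)
  then have "p + q = (\<Sum>a\<in>A \<union> B. (?x a + ?y a) * Tm w a)" by (simp add: distrib_right sum.distrib)
  moreover have "\<forall>a\<in>A \<union> B. ?x a + ?y a \<in> J a"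
    using p(3) q(3) idealD(2,3)[OF ideal_J] by auto
  ultimately show ?thesis unfolding multi_rees_def Tm_def[symmetric] using p(2) q(2)
    by (intro CollectI exI[of _ "A \<union> B"] exI[of _ "\<lambda>a. ?x a + ?y a"]) auto
qed

lemma J_Tm_in_multi_rees: "x \<in> J a \<Longrightarrow> x * Tm w a \<in> multi_rees n w I"
  unfolding multi_rees_def Tm_def[symmetric]
  by (intro CollectI exI[of _ "{a}"] exI[of _ "\<lambda>_. x"]) auto

lemma monom_0_times_J: "x \<in> J a \<Longrightarrow> monom 0 c * x \<in> J a"
  by (intro idealD(4)[OF ideal_J] polys_monom) simp_all

lemma multi_rees_eq_image: "multi_rees n w I = ImP"
proof (intro equalityI subsetI)
  fix p assume "p \<in> multi_rees n w I"
  then obtain A x where p: "p = (\<Sum>a\<in>A. x a * Tm w a)" "finite A" "\<forall>a\<in>A. x a \<in> J a"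
    unfolding multi_rees_def Tm_def by blast
  have "(\<Sum>a\<in>A. x a * Tm w a) \<in> ImP" if "finite A" "\<forall>a\<in>A. x a \<in> J a" for A
    using that
  proof (induction A)
    case (insert a A)
    then show ?case using Im_add[OF J_Tm_in_image[rule_format]] by simp
  qed (simp add: Im_0[simplified])
  then show "p \<in> ImP" using p by blast
next
  fix p assume "p \<in> ImP"
  then obtain s where s: "s \<in> SP" "p = \<Phi> f s" by blast
  have 0: "0 \<in> multi_rees n w I" using J_Tm_in_multi_rees[of 0 "\<lambda>_. 0"] idealD(2)[OF ideal_J] by simp
  have "monom 0 c * subst_mon f mm \<in> multi_rees n w I" if "mm \<in> supp s" for mm c
  proof -
    have "supp mm \<subseteq> S_vars n w m" using s(1) that by (auto simp: polys_def)
    then obtain x where "x \<in> J (Z_exponent mm)" "subst_mon f mm = x * Tm w (Z_exponent mm)"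
      using subst_mon_in_product by blast
    then show ?thesis using J_Tm_in_multi_rees[OF monom_0_times_J, of x _ c] by (simp add: mult.assoc)
  qed
  then have "(\<Sum>mm\<in>A. monom 0 (coeff s mm) * subst_mon f mm) \<in> multi_rees n w I" if "A \<subseteq> supp s" for A
    using that by (induction A rule: infinite_finite_induct) (auto simp: 0 multi_rees_add)
  from this[of "supp s"] show "p \<in> multi_rees n w I"
    unfolding s(2) using Phi_superset[of "supp s" s f] by simp
qed

abbreviation "md \<equiv> multi_degree d"

lemma homogeneous_Phi_var:
  assumes "v \<in> S_vars n w m"
  shows "homogeneous md (md v) (\<Phi>_var f v)"
  using assms
proof (cases rule: S_vars_cases)
  case (1 k)
  then show ?thesis using homogeneous_Var[of md "X k"] by simp
next
  case (2 i j)
  have "homogeneous md ((\<lambda>l. int (d i) * unit_deg 0 l) + md (T i)) (f i j * Var (T i))"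
    using f[OF 2(2,3)] by (intro homogeneous_mult homogeneous_X_multi[where n = n] homogeneous_Var) auto
  moreover have "(\<lambda>l. int (d i) * unit_deg 0 l) + md (T i) = md (Z i j)" by (simp add: fun_eq_iff)
  ultimately show ?thesis unfolding 2(1) by simp
qed

lemma homogeneous_subst_mon:
  assumes "supp mm \<subseteq> S_vars n w m"
  shows "homogeneous md (mon_degree md mm) (subst_mon f mm)"
  using assms
proof (induction mm rule: monomial_induct)
  case zero
  show ?case using homogeneous_monom[of md 0 "1 :: 'k"] by (simp only: single_one subst_mon_0)
next
  case (step v mm)
  have "mon_degree md (monom v 1) = md v" by (simp add: mon_degree_single)
  then show ?case unfolding mon_degree_add subst_mon_add subst_mon_single
    using step homogeneous_Phi_var by (intro homogeneous_mult) (auto simp: supp_add_nat)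
qed

text \<open>The grading of the presenting ring is chosen such that \<open>\<Phi>\<close> preserves degrees.\<close>

lemma hpart_Phi:
  assumes "s \<in> SP"
  shows "hpart md b (\<Phi> f s) = \<Phi> f (hpart md b s)"
proof -
  have "hpart md b (monom 0 c * subst_mon f mm) = (if mon_degree md mm = b then monom 0 c * subst_mon f mm else 0)"
    if "mm \<in> supp s" for mm c
  proof -
    have "homogeneous md (mon_degree md mm) (subst_mon f mm)"
      using assms that by (intro homogeneous_subst_mon) (auto simp: polys_def)
    from homogeneous_mult[OF homogeneous_monom[of md 0 c] this]
    have h: "homogeneous md (mon_degree md mm) (monom 0 c * subst_mon f mm)" by simp
    show ?thesis
    proof (cases "mon_degree md mm = b")
      case True
      then show ?thesis using h hpart_id by auto
    next
      case False
      then show ?thesis using h by (auto simp: homogeneous_def intro!: part_eq_0)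
    qed
  qed
  then have "hpart md b (\<Phi> f s) = (\<Sum>mm\<in>supp s. if mon_degree md mm = b then monom 0 (coeff s mm) * subst_mon f mm else 0)"
    using Phi_superset[of "supp s" s f] by (simp add: part_sum)
  also have "\<dots> = (\<Sum>mm\<in>supp s. monom 0 (coeff (hpart md b s) mm) * subst_mon f mm)"
    by (intro sum.cong) (auto simp: coeff_part)
  also have "\<dots> = \<Phi> f (hpart md b s)"
    by (rule Phi_superset[symmetric]) (auto simp: supp_part)
  finally show ?thesis .
qed

lemma mon_degree_S:
  assumes "supp mm \<subseteq> S_vars n w m"
  shows "(\<forall>l. mon_degree md mm l \<ge> 0 \<and> (l > w \<longrightarrow> mon_degree md mm l = 0) \<and>
        (l \<in> {1..w} \<longrightarrow> mon_degree md mm l = int (Z_exponent mm l)))"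
  using assms
proof (induction mm rule: monomial_induct)
  case zero
  show ?case by (simp add: Z_exponent_def)
next
  case (step v mm)
  then have IH: "\<forall>l. mon_degree md mm l \<ge> 0 \<and> (l > w \<longrightarrow> mon_degree md mm l = 0) \<and>
        (l \<in> {1..w} \<longrightarrow> mon_degree md mm l = int (Z_exponent mm l))" by (auto simp: supp_add_nat)
  have e: "mon_degree md (monom v 1 + mm) = md v + mon_degree md mm"
    by (simp add: mon_degree_add mon_degree_single)
  from step(1) show ?case
  proof (cases rule: S_vars_cases)
    case (1 k)
    show ?thesis using IH unfolding e unfolding 1 Z_exponent_X by (auto simp: unit_deg_def)
  next
    case (2 i j)
    show ?thesis using IH 2(2) unfolding e unfolding 2(1) Z_exponent_Z[OF 2(3)] by (auto simp: unit_deg_def)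
  qed
qed

definition rees_degree :: "(nat \<Rightarrow> nat) \<Rightarrow> int \<Rightarrow> nat \<Rightarrow> int" where
  "rees_degree a e = (\<lambda>l. if l = 0 then e - int (gen_degree a) else if l \<le> w then int (a l) else 0)"

lemma Tm_degree:
  "(\<lambda>l. e * unit_deg 0 l) + (\<Sum>i=1..w. of_nat (a i) * md (T i)) = rees_degree a e"
proof
  fix l
  have "(\<Sum>i=1..w. int (a i) * (unit_deg i l - int (d i) * unit_deg 0 l)) =
      (\<Sum>i=1..w. (if i = l then int (a i) else 0) - int (d i * a i) * unit_deg 0 l)"
    by (intro sum.cong refl) (simp add: unit_deg_def right_diff_distrib)
  also have "\<dots> = (\<Sum>i=1..w. if i = l then int (a i) else 0) - (\<Sum>i=1..w. int (d i * a i)) * unit_deg 0 l"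
    by (simp only: sum_subtractf sum_distrib_right)
  also have "\<dots> = rees_degree a e l - e * unit_deg 0 l"
    by (auto simp: rees_degree_def gen_degree_def unit_deg_def sum.delta')
  finally show "((\<lambda>l. e * unit_deg 0 l) + (\<Sum>i=1..w. of_nat (a i) * md (T i))) l = rees_degree a e l"
    by (simp add: sum_fun_apply)
qed

abbreviation "rees_comp b \<equiv> {p \<in> multi_rees n w I. homogeneous md b p}"

lemma rees_comp_Phi: "rees_comp b = \<Phi> f ` {s \<in> SP. homogeneous md b s}"
proof (intro equalityI subsetI)
  fix p assume "p \<in> rees_comp b"
  then obtain s where s: "s \<in> SP" "p = \<Phi> f s" "homogeneous md b p" by (auto simp: multi_rees_eq_image)
  then have "p = \<Phi> f (hpart md b s)" using hpart_Phi[OF s(1), of b] hpart_id[of md b p] by simp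
  then show "p \<in> \<Phi> f ` {s \<in> SP. homogeneous md b s}"
    using s(1) polys_part homogeneous_hpart by blast
next
  fix p assume "p \<in> \<Phi> f ` {s \<in> SP. homogeneous md b s}"
  then obtain s where s: "s \<in> SP" "p = \<Phi> f s" "homogeneous md b s" by blast
  then have "p = hpart md b p" using hpart_Phi[OF s(1), of b] hpart_id[of md b s] by simp
  then have "homogeneous md b p" using homogeneous_hpart[of md b p] by simp
  then show "p \<in> rees_comp b" using s by (auto simp: multi_rees_eq_image)
qed

text \<open>The presenting ring has no monomial of such a degree.\<close>

lemma rees_comp_eq_0:
  assumes "b l < 0 \<or> l > w \<and> b l \<noteq> 0"
  shows "rees_comp b = {0}"
proof -
  have "s = 0" if s: "s \<in> SP" "homogeneous md b s" for s
  proof (rule ccontr)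
    assume "s \<noteq> 0"
    then have "supp s \<noteq> {}" using sum_monoms[of s] by auto
    then obtain mm where "mm \<in> supp s" by blast
    then have S: "supp mm \<subseteq> S_vars n w m" and b: "mon_degree md mm = b"
      using s by (auto simp: polys_def homogeneous_def)
    from mon_degree_S[OF S] have "b l \<ge> 0" "l > w \<longrightarrow> b l = 0" unfolding b by blast+
    then show False using assms by linarith
  qed
  moreover have "0 \<in> {s \<in> SP. homogeneous md b s}" by simp
  ultimately have "{s \<in> SP. homogeneous md b s} = {0}" by blast
  then show ?thesis unfolding rees_comp_Phi by simp
qed

text \<open>A monomial of the presenting ring determines the exponent of \<open>T\<close> by its degree, so a component of
  nonnegative degree is concentrated in a single power \<open>T\<^sup>a\<close>. The twist by \<open>gen_degree a\<close> in
  \<open>rees_degree\<close> comes from the degrees of the \<open>T i\<close>.\<close>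

lemma rees_comp_eq_J:
  "rees_comp (rees_degree a e) = (\<lambda>x. x * Tm w a) ` {x \<in> J a. homogeneous std_degree e x}"
proof (intro equalityI subsetI)
  obtain t where t: "Tm w a = (monom t 1 :: 'k mpol)"
    and td: "mon_degree md t = (\<Sum>i=1..w. of_nat (a i) * md (T i))"
    using Tm_monom[of w a d] by blast
  {
    fix p assume pr: "p \<in> rees_comp (rees_degree a e)"
    then have p: "homogeneous md (rees_degree a e) p" by simp
    from pr obtain s where s: "s \<in> SP" "homogeneous md (rees_degree a e) s" "p = \<Phi> f s"
      unfolding rees_comp_Phi by (auto elim!: imageE)
    have "\<exists>x\<in>J a. monom 0 (coeff s mm) * subst_mon f mm = x * Tm w a" if mm: "mm \<in> supp s" for mm
    proof -
      have S: "supp mm \<subseteq> S_vars n w m" and deg: "mon_degree md mm = rees_degree a e"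
        using s mm by (auto simp: polys_def homogeneous_def)
      have za: "Z_exponent mm i = a i" if "i \<in> {1..w}" for i
        using mon_degree_S[OF S] that unfolding deg by (force simp: rees_degree_def)
      obtain x where x: "x \<in> J (Z_exponent mm)" "subst_mon f mm = x * Tm w (Z_exponent mm)"
        using subst_mon_in_product[OF S] by blast
      have "J (Z_exponent mm) = J a" "Tm w (Z_exponent mm) = (Tm w a :: 'k mpol)"
        using za J_cong Tm_cong by blast+
      then show ?thesis using x monom_0_times_J[of x a "coeff s mm"]
        by (auto simp: mult.assoc intro!: bexI[of _ "monom 0 (coeff s mm) * x"])
    qed
    then obtain x where x: "\<And>mm. mm \<in> supp s \<Longrightarrow> x mm \<in> J a"
      "\<And>mm. mm \<in> supp s \<Longrightarrow> monom 0 (coeff s mm) * subst_mon f mm = x mm * Tm w a" by metis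
    define y where "y = (\<Sum>mm\<in>supp s. x mm)"
    have yJ: "y \<in> J a" unfolding y_def using x(1) by (intro ideal_sum[OF ideal_J])
    have py: "p = y * Tm w a"
      unfolding s(3) y_def using x(2) Phi_superset[of "supp s" s f] by (simp add: sum_distrib_right)
    have "homogeneous std_degree e y" unfolding homogeneous_def
    proof
      fix mm assume mm: "mm \<in> supp y"
      have yX: "y \<in> XP" using yJ idealD(1)[OF ideal_J] by blast
      have mX: "monom mm (1 :: 'k) \<in> XP" using mm yX by (auto simp: polys_def)
      have "homogeneous md (\<lambda>l. mon_degree std_degree mm * unit_deg 0 l) (monom mm (1 :: 'k))"
        by (rule homogeneous_X_multi[OF mX homogeneous_monom])
      then have mmd: "mon_degree md mm = (\<lambda>l. mon_degree std_degree mm * unit_deg 0 l)"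
        by (simp add: homogeneous_def)
      have "coeff p (t + mm) = coeff y mm" unfolding py t mult.commute[of y] by (simp add: coeff_monom_mult)
      then have "t + mm \<in> supp p" using mm by (simp add: in_keys_iff)
      then have "mon_degree md (t + mm) = rees_degree a e"
        using p unfolding homogeneous_def by blast
      then have "mon_degree md t + mon_degree md mm = rees_degree a e"
        by (simp only: mon_degree_add)
      then have "rees_degree a (mon_degree std_degree mm) = rees_degree a e"
        unfolding Tm_degree[symmetric] mmd td by (simp add: add.commute)
      then have "rees_degree a (mon_degree std_degree mm) 0 = rees_degree a e 0" by simp
      then show "mon_degree std_degree mm = e" by (simp add: rees_degree_def)
    qed
    then show "p \<in> (\<lambda>x. x * Tm w a) ` {x \<in> J a. homogeneous std_degree e x}" using yJ py by blast
  next
    fix p assume "p \<in> (\<lambda>x. x * Tm w a) ` {x \<in> J a. homogeneous std_degree e x}"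
    then obtain x where x: "x \<in> J a" "homogeneous std_degree e x" "p = x * Tm w a" by blast
    have "homogeneous md (\<lambda>l. e * unit_deg 0 l) x"
      using x(1,2) idealD(1)[OF ideal_J] by (intro homogeneous_X_multi[where n = n]) auto
    from homogeneous_mult[OF this homogeneous_monom[of md t 1]]
    have "homogeneous md (rees_degree a e) p"
      unfolding x(3) t td Tm_degree[symmetric] .
    then show "p \<in> rees_comp (rees_degree a e)" using J_Tm_in_multi_rees[OF x(1)] x(3) by simp
  }
qed

end

section \<open>Existence of resolutions\<close>

lemma comb_free_mod:
  assumes G: "\<And>j. j < R \<Longrightarrow> G j \<in> fcomp V dg r s (t j)" and c: "c \<in> free_mod V R"
  shows "comb R G c \<in> free_mod V r"
  unfolding free_mod_def
proof (intro CollectI conjI allI impI)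
  fix i assume "i < r"
  then show "comb R G c i \<in> polys V"
    using c G by (auto simp: comb_def free_mod_def fcomp_iff intro!: polys_sum polys_mult)
next
  fix i assume "r \<le> i"
  then show "comb R G c i = 0" using G by (auto simp: comb_def fcomp_iff intro!: sum.neutral)
qed

lemma res_diff_eq_comb:
  assumes "\<And>j. j < R \<Longrightarrow> G j \<in> fcomp V dg r s (t j)"
    and "res_rank F k = r" "res_rank F (Suc k) = R" "\<And>i j. res_mat F k i j = G j i"
  shows "res_diff F k x = comb R G x"
proof
  fix i
  show "res_diff F k x i = comb R G x i"
  proof (cases "i < r")
    case True
    then show ?thesis using assms by (simp add: res_diff_def comb_def mult.commute)
  next
    case False
    then show ?thesis using assms by (auto simp: res_diff_def comb_def fcomp_iff intro!: sum.neutral)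
  qed
qed

lemma std_degree_eq: "std_degree = (\<lambda>_. 1)"
  by (simp add: std_degree_def fun_eq_iff)

lemma single_fcomp:
  "(\<lambda>i. if i = 0 then p else 0) \<in> free_mod V (Suc 0) \<longleftrightarrow> p \<in> polys V"
  by (auto simp: free_mod_def)

text \<open>An ideal is a submodule of the free module of rank one, so its generators can be chosen by the same
  construction as those of the syzygies.\<close>

theorem graded_ideal_minimal_resolution:
  fixes J :: "'k::field mpol set"
  assumes J: "ideal J (poly_ring V)" and V: "finite V"
    and hom: "\<And>x e. x \<in> J \<Longrightarrow> hpart std_degree e x \<in> J"
  shows "\<exists>F. graded_free_resolution V std_degree (ideal_module J) F \<and> minimal_resolution F"
proof -
  let ?fc = "fcomp V std_degree 1 (\<lambda>_. 0) :: int \<Rightarrow> (nat \<Rightarrow> 'k mpol) set"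
  define N where "N a = {x \<in> ?fc a. x 0 \<in> J}" for a
  have N: "graded_submodule V std_degree 1 (\<lambda>_. 0) N"
    unfolding graded_submodule_def N_def
    by (auto simp: fcomp_diff ideal_diff[OF J] fcomp_monom_mult intro!: idealD(4)[OF J] polys_monom)
  have pos: "m = 0" if "mon_degree std_degree m = 0" for m
    using that mon_degree_one_eq_0 by (simp add: std_degree_eq)
  obtain R t G where g0: "gens V std_degree N (R 0) (t 0) (G 0)"
    and gS: "\<And>k. gens V std_degree (syz V std_degree (R k) (t k) (G k)) (R (Suc k)) (t (Suc k)) (G (Suc k))"
    and mg: "\<And>k. minimal_gens V std_degree (R k) (t k) (G k)"
    using resolution_tower[OF N V pos] by blast
  have G0: "G 0 j \<in> ?fc (t 0 j)" "G 0 j 0 \<in> J" if "j < R 0" for j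
    using g0 that by (auto simp: gens_def N_def)
  have GS: "G (Suc k) j \<in> fcomp V std_degree (R k) (t k) (t (Suc k) j)"
    "G (Suc k) j \<in> syz V std_degree (R k) (t k) (G k) (t (Suc k) j)" if "j < R (Suc k)" for k j
    using gS[of k] that by (auto simp: gens_def syz_def)
  define F :: "('k mpol, int, 'k mpol) resolution" where
    "F = \<lparr>res_rank = R, res_shift = t, res_mat = (\<lambda>k i j. G (Suc k) j i), res_gen = (\<lambda>j. G 0 j 0)\<rparr>"
  have F [simp]: "res_rank F = R" "res_shift F = t" "res_mat F k i j = G (Suc k) j i" "res_gen F j = G 0 j 0" for k i j
    by (simp_all add: F_def)
  have diff: "res_diff F k x = comb (R (Suc k)) (G (Suc k)) x" for k x
    by (rule res_diff_eq_comb[where V = V and dg = std_degree and r = "R k" and s = "t k" and t = "t (Suc k)"])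
      (simp_all add: GS)
  have aug: "res_aug (ideal_module J) F x = comb (R 0) (G 0) x 0" for x
    by (simp add: res_aug_def ideal_module_def comb_def)
  have comb0: "comb (R 0) (G 0) x i = 0" if "i \<ge> 1" for x i
    using G0(1) that by (auto simp: comb_def fcomp_iff intro!: sum.neutral)
  let ?S = "{x \<in> free_mod V 1. x 0 \<in> J}"
  have gen: "?S \<subseteq> comb (R 0) (G 0) ` free_mod V (R 0)"
  proof (rule graded_generation[where s = "\<lambda>_. 0" and dg = std_degree and t = "t 0"])
    fix x a assume x: "x \<in> ?S"
    then show "free_part std_degree (\<lambda>_. 0) a x \<in> ?S"
      using hom free_part_fcomp[of x V 1 std_degree "\<lambda>_. 0" a] by (auto simp: fcomp_def free_part_def)
  next
    fix a
    show "?S \<inter> ?fc a \<subseteq> comb (R 0) (G 0) ` fcomp V std_degree (R 0) (t 0) a"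
      using g0 unfolding gens_def N_def by blast
  qed blast
  have "graded_free_resolution V std_degree (ideal_module J) F"
    unfolding graded_free_resolution_def
  proof (intro conjI allI impI)
    show "res_shift F k j \<in> mod_degrees (ideal_module J)" for k j by (simp add: ideal_module_def)
    show "res_gen F j \<in> mod_comp (ideal_module J) (res_shift F 0 j)" if "j < res_rank F 0" for j
      using G0[of j] that by (auto simp: ideal_module_def fcomp_iff)
    show "res_mat F k i j \<in> polys V" "homogeneous std_degree (res_shift F (Suc k) j - res_shift F k i) (res_mat F k i j)"
      if "i < res_rank F k" "j < res_rank F (Suc k)" for k i j
      using GS(1)[of j k] that by (auto simp: fcomp_iff)
    show "res_aug (ideal_module J) F ` free_mod V (res_rank F 0) = mod_carrier (ideal_module J)"
    proof (intro equalityI subsetI)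
      fix y assume "y \<in> res_aug (ideal_module J) F ` free_mod V (res_rank F 0)"
      then obtain x where x: "x \<in> free_mod V (R 0)" "y = comb (R 0) (G 0) x 0" by (auto simp: aug)
      have "y \<in> J" unfolding x(2) comb_def
        using G0(2) x(1) by (intro ideal_sum[OF J] idealD(4)[OF J]) (auto simp: free_mod_def)
      then show "y \<in> mod_carrier (ideal_module J)" by (simp add: ideal_module_def)
    next
      fix y assume "y \<in> mod_carrier (ideal_module J)"
      then have y: "y \<in> J" "y \<in> polys V" using idealD(1)[OF J] by (auto simp: ideal_module_def)
      let ?x = "\<lambda>i. if i = 0 then y else (0 :: 'k mpol)"
      have "?x \<in> ?S" using y by (simp add: single_fcomp)
      then obtain c where "c \<in> free_mod V (R 0)" "?x = comb (R 0) (G 0) c" using gen by blast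
      then show "y \<in> res_aug (ideal_module J) F ` free_mod V (res_rank F 0)"
        using fun_cong[of ?x "comb (R 0) (G 0) c" 0] by (auto simp: aug)
    qed
    have "res_aug (ideal_module J) F x = 0 \<longleftrightarrow> comb (R 0) (G 0) x = 0" for x
      unfolding aug fun_eq_iff[of "comb (R 0) (G 0) x"] using comb0[of _ x]
      by (metis One_nat_def Suc_leI neq0_conv zero_fun_apply)
    then show "{x \<in> free_mod V (res_rank F 0). res_aug (ideal_module J) F x = 0} = res_diff F 0 ` free_mod V (res_rank F 1)"
      unfolding diff using syz_generation[OF G0(1) gS[of 0]] by simp
    show "{x \<in> free_mod V (res_rank F (Suc k)). res_diff F k x = (\<lambda>_. 0)} = res_diff F (Suc k) ` free_mod V (res_rank F (Suc (Suc k)))" for k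
      unfolding diff using syz_generation[OF GS(1) gS[of "Suc k"]] by (simp add: zero_fun_def)
  qed
  moreover have "minimal_resolution F"
    unfolding minimal_resolution_def
  proof (intro allI impI)
    fix k i j assume "i < res_rank F k" "j < res_rank F (Suc k)"
    then have "const (G (Suc k) j) = 0" using mg[of k] GS(2)[of j k] unfolding minimal_gens_def by simp
    then show "coeff (res_mat F k i j) 0 = 0" by (simp add: const_def fun_eq_iff)
  qed
  ultimately show ?thesis by blast
qed

text \<open>For a module of polynomials whose components are given by homogeneity, the homogeneous part of the
  image of \<open>x\<close> is the image of the homogeneous part of \<open>x\<close>. The map \<open>\<phi>\<close> covers the action of \<open>R\<close> on its
  ideals and the action through \<open>\<Phi>\<close>.\<close>

lemma aug_surj_of_resolution:
  fixes M :: "('k::field mpol, 'g::comm_ring_1, 'k mpol) graded_module"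
  assumes res: "graded_free_resolution V dg M F"
    and act: "mod_act M = (\<lambda>s x. \<phi> s * x)"
    and comp: "mod_comp M = (\<lambda>a. {p \<in> mod_carrier M. homogeneous dg' a p})"
    and \<phi>: "\<And>s b. s \<in> polys V \<Longrightarrow> hpart dg' b (\<phi> s) = \<phi> (hpart dg b s)"
  shows "res_aug M F ` fcomp V dg (res_rank F 0) (res_shift F 0) a = mod_comp M a"
proof -
  have aug: "res_aug M F ` free_mod V (res_rank F 0) = mod_carrier M"
    and gen: "\<And>j. j < res_rank F 0 \<Longrightarrow> homogeneous dg' (res_shift F 0 j) (res_gen F j)"
    using res by (auto simp: graded_free_resolution_def comp)
  have hp: "hpart dg' a (res_aug M F x) = res_aug M F (free_part dg (res_shift F 0) a x)"
    if x: "x \<in> free_mod V (res_rank F 0)" for x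
  proof -
    have "hpart dg' a (\<phi> (x j) * res_gen F j) = \<phi> (hpart dg (a - res_shift F 0 j) (x j)) * res_gen F j"
      if "j < res_rank F 0" for j
      using hpart_mult[OF gen[OF that]] \<phi> x that by (simp add: free_mod_def)
    then show ?thesis by (simp add: res_aug_def act part_sum free_part_def)
  qed
  show ?thesis
  proof (intro equalityI subsetI)
    fix y assume "y \<in> res_aug M F ` fcomp V dg (res_rank F 0) (res_shift F 0) a"
    then obtain x where x: "x \<in> fcomp V dg (res_rank F 0) (res_shift F 0) a" "y = res_aug M F x" by blast
    then have xf: "x \<in> free_mod V (res_rank F 0)" by (simp add: fcomp_def)
    have "free_part dg (res_shift F 0) a x = x"
    proof
      fix j show "free_part dg (res_shift F 0) a x j = x j"
        using x(1) by (cases "j < res_rank F 0") (auto simp: free_part_def fcomp_iff hpart_id)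
    qed
    then have "y = hpart dg' a y" using hp[OF xf] x(2) by simp
    then have "homogeneous dg' a y" using homogeneous_hpart[of dg' a y] by simp
    moreover have "y \<in> mod_carrier M" using aug xf x(2) by blast
    ultimately show "y \<in> mod_comp M a" by (simp add: comp)
  next
    fix y assume "y \<in> mod_comp M a"
    then have y: "y \<in> mod_carrier M" "homogeneous dg' a y" by (auto simp: comp)
    then obtain x where x: "x \<in> free_mod V (res_rank F 0)" "y = res_aug M F x" using aug by blast
    then have "y = res_aug M F (free_part dg (res_shift F 0) a x)" using hp[OF x(1)] hpart_id[OF y(2)] by simp
    then show "y \<in> res_aug M F ` fcomp V dg (res_rank F 0) (res_shift F 0) a"
      using free_part_fcomp[OF x(1)] by blast
  qed
qed

context resolved_module
begin

text \<open>All differentials of \<open>K \<otimes> F\<close> vanish, so that \<open>Tor\<^sub>k\<close> is \<open>K \<otimes> F\<^sub>k\<close> itself.\<close>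

lemma minimal_exact_iff:
  assumes min: "minimal_resolution F"
  shows "M.exact vs (int k) a \<longleftrightarrow> (\<forall>j<res_rank F k. res_shift F k j \<noteq> a)"
proof -
  have diff0: "tensor_diff F k y = (\<lambda>_. 0)" for k y
    using min by (auto simp: tensor_diff_def minimal_resolution_def fun_eq_iff)
  have cyc: "y \<in> tor_cycles F k" if "y \<in> tensor_comp F k a" for y
    using that by (auto simp: tor_cycles_def tensor_comp_def diff0 split: nat.split)
  have bd: "y \<in> tor_boundaries F k \<longleftrightarrow> y = (\<lambda>_. 0)" for y
    unfolding tor_boundaries_def diff0 by (auto simp: tensor_space_def)
  have "M.exact vs (int k) a \<longleftrightarrow> (\<forall>y\<in>tensor_comp F k a. y = (\<lambda>_. 0))"
    unfolding tor_vanishes_iff_exact bd using cyc by blast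
  also have "\<dots> \<longleftrightarrow> (\<forall>j<res_rank F k. res_shift F k j \<noteq> a)"
  proof
    assume *: "\<forall>y\<in>tensor_comp F k a. y = (\<lambda>_. 0)"
    show "\<forall>j<res_rank F k. res_shift F k j \<noteq> a"
    proof (intro allI impI notI)
      fix j assume j: "j < res_rank F k" "res_shift F k j = a"
      then have "(\<lambda>i. if i = j then 1 else 0) \<in> tensor_comp F k a"
        by (auto simp: tensor_comp_def tensor_space_def)
      then have "(\<lambda>i. if i = j then 1 else (0 :: 'k)) = (\<lambda>_. 0)" using * by blast
      from fun_cong[OF this, of j] show False by simp
    qed
  next
    assume "\<forall>j<res_rank F k. res_shift F k j \<noteq> a"
    then show "\<forall>y\<in>tensor_comp F k a. y = (\<lambda>_. 0)"
      by (auto simp: tensor_comp_def tensor_space_def fun_eq_iff) (metis not_le)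
  qed
  finally show ?thesis .
qed

text \<open>Otherwise a basis element would be a cycle, hence a boundary, although boundaries have no constant
  terms.\<close>

lemma minimal_column_nonzero:
  assumes min: "minimal_resolution F" and j: "j < res_rank F (Suc k)"
  shows "\<exists>i<res_rank F k. res_mat F k i j \<noteq> 0"
proof (rule ccontr)
  assume no: "\<not> ?thesis"
  let ?x = "\<lambda>i. if i = j then 1 else (0 :: 'k mpol)"
  have "?x \<in> free_mod V (res_rank F (Suc k))" using j by (auto simp: free_mod_def)
  moreover have "res_diff F k ?x = (\<lambda>_. 0)"
  proof
    fix i
    show "res_diff F k ?x i = 0"
    proof (cases "i < res_rank F k")
      case True
      have "(\<Sum>l<res_rank F (Suc k). res_mat F k i l * ?x l) = 0"
        using no True by (intro sum.neutral) auto
      then show ?thesis by (simp add: res_diff_def)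
    qed (simp add: res_diff_def)
  qed
  ultimately have "?x \<in> {x \<in> free_mod V (res_rank F (Suc k)). res_diff F k x = (\<lambda>_. 0)}" by blast
  also have "\<dots> = res_diff F (Suc k) ` free_mod V (res_rank F (Suc (Suc k)))"
    using resolution unfolding graded_free_resolution_def by blast
  finally obtain z where "?x = res_diff F (Suc k) z" by blast
  then have "const ?x = tensor_diff F (Suc k) (const z)" by (simp add: const_res_diff)
  then have "const ?x j = tensor_diff F (Suc k) (const z) j" by simp
  moreover have "tensor_diff F (Suc k) y j = 0" for y
    using min j by (auto simp: tensor_diff_def minimal_resolution_def)
  ultimately show False by (simp add: const_def)
qed

end

section \<open>Linear products and partial regularity\<close>

lemma slot_Cons_cases:
  assumes "slot dg (v # vs) q a l = Some b"
  obtains l' where "slot dg vs (q - 1) (a - dg v) l' = Some b" | l' where "slot dg vs q a l' = Some b"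
  using assms by (auto split: list.splits if_splits)

lemma slot_mono:
  fixes dg :: "var \<Rightarrow> nat \<Rightarrow> int"
  assumes "slot dg vs q a l = Some b" "\<And>v. v \<in> set vs \<Longrightarrow> dg v i \<ge> 0"
  shows "b i \<le> a i"
  using assms
proof (induction vs arbitrary: q a l)
  case (Cons v vs)
  have nn: "dg v i \<ge> 0" "\<And>u. u \<in> set vs \<Longrightarrow> dg u i \<ge> 0" using Cons.prems(2) by auto
  from Cons.prems(1) show ?case
  proof (cases rule: slot_Cons_cases)
    case (1 l')
    from Cons.IH[OF 1 nn(2)] nn(1) show ?thesis by simp
  next
    case (2 l')
    from Cons.IH[OF 2 nn(2)] show ?thesis .
  qed
qed (simp split: if_splits)

lemma slot_const:
  fixes dg :: "var \<Rightarrow> nat \<Rightarrow> int"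
  assumes "slot dg vs q a l = Some b" "\<And>v. v \<in> set vs \<Longrightarrow> dg v i = 0"
  shows "b i = a i"
  using assms
proof (induction vs arbitrary: q a l)
  case (Cons v vs)
  have nn: "dg v i = 0" "\<And>u. u \<in> set vs \<Longrightarrow> dg u i = 0" using Cons.prems(2) by auto
  from Cons.prems(1) show ?case
  proof (cases rule: slot_Cons_cases)
    case (1 l')
    from Cons.IH[OF 1 nn(2)] nn(1) show ?thesis by simp
  next
    case (2 l')
    from Cons.IH[OF 2 nn(2)] show ?thesis .
  qed
qed (simp split: if_splits)

lemma slot_std: "slot std_degree vs q a l = Some b \<Longrightarrow> b = a - q"
proof (induction vs arbitrary: q a l)
  case (Cons v vs)
  from Cons.prems show ?case
  proof (cases rule: slot_Cons_cases)
    case (1 l')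
    from Cons.IH[OF 1] show ?thesis by (simp add: std_degree_def)
  next
    case (2 l')
    from Cons.IH[OF 2] show ?thesis .
  qed
qed (simp split: if_splits)

lemma kexact_trivial:
  assumes "\<And>l b. slot dg vs q a l = Some b \<Longrightarrow> C b \<subseteq> {0}" "\<And>b. 0 \<in> C b" "var_action va"
  shows "kexact va dg C vs q a"
  unfolding kexact_def
proof (intro ballI impI)
  fix x assume x: "x \<in> kchain dg C vs q a"
  have "x l = 0" for l
    using kchainD[OF x, of l] assms(1)[of l] by (cases "slot dg vs q a l") auto
  then have "x = 0" by (simp add: fun_eq_iff)
  moreover have "0 \<in> kchain dg C vs (q + 1) a"
    using assms(2) by (auto intro: kchainI)
  ultimately show "\<exists>y\<in>kchain dg C vs (q + 1) a. kdiff va vs y = x"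
    using var_action.kdiff_0[OF assms(3)] by blast
qed

lemma finite_X_vars: "finite (X_vars n)"
  by (simp add: X_vars_def)

lemma finite_S_vars: "finite (S_vars n w m)"
proof -
  have "{Z i j | i j. i \<in> {1..w} \<and> j \<in> {1..m i}} = (\<Union>i\<in>{1..w}. Z i ` {1..m i})" by auto
  then show ?thesis by (simp add: S_vars_def finite_X_vars)
qed

context rees_setting
begin

subsection \<open>The graded modules\<close>

abbreviation "rees \<equiv> rees_module n w I d f"
abbreviation "vaJ \<equiv> \<lambda>v x. Var v * x :: 'k mpol"
abbreviation "vaM \<equiv> \<lambda>v x. \<Phi> f (Var v) * x :: 'k mpol"
abbreviation "J_comp a \<equiv> \<lambda>e. {x \<in> J a. homogeneous std_degree e x}"

lemma vaJ_action: "graded_action vaJ std_degree (X_vars n) (J_comp a)"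
proof
  fix v x e y
  show "Var v * (x + y) = Var v * x + Var v * (y :: 'k mpol)" by (simp add: distrib_left)
  show "Var u * (Var v * x) = Var v * (Var u * (x :: 'k mpol))" for u by (simp only: mult_ac)
  show "0 \<in> J_comp a e" using idealD(2)[OF ideal_J] by simp
  show "x - y \<in> J_comp a e" if "x \<in> J_comp a e" "y \<in> J_comp a e"
    using that by (auto intro: ideal_diff[OF ideal_J] homogeneous_diff)
  show "Var v * x \<in> J_comp a (e + std_degree v)" if "v \<in> X_vars n" "x \<in> J_comp a e"
    using that homogeneous_Var_mult[of std_degree "e + std_degree v" v x]
    by (auto intro!: idealD(4)[OF ideal_J] polys_Var)
qed

lemma ImP_diff: "x \<in> ImP \<Longrightarrow> y \<in> ImP \<Longrightarrow> x - y \<in> ImP"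
proof -
  assume x: "x \<in> ImP" and y: "y \<in> ImP"
  have "- 1 * y \<in> ImP" using XP_Im[of "- 1"] by (intro Im_mult y) (simp add: polys_uminus)
  then show ?thesis using Im_add[OF x, of "- y"] by simp
qed

lemma vaM_action: "graded_action vaM md (S_vars n w m) rees_comp"
proof
  fix v x y and b :: "nat \<Rightarrow> int"
  show "\<Phi> f (Var v) * (x + y) = \<Phi> f (Var v) * x + \<Phi> f (Var v) * y" by (simp add: distrib_left)
  show "\<Phi> f (Var u) * (\<Phi> f (Var v) * x) = \<Phi> f (Var v) * (\<Phi> f (Var u) * x)" for u by (simp only: mult_ac)
  show "0 \<in> rees_comp b" using Im_0 by (simp add: multi_rees_eq_image)
  show "x - y \<in> rees_comp b" if "x \<in> rees_comp b" "y \<in> rees_comp b"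
    using that ImP_diff by (simp add: multi_rees_eq_image homogeneous_diff)
  show "\<Phi> f (Var v) * x \<in> rees_comp (b + md v)" if v: "v \<in> S_vars n w m" and x: "x \<in> rees_comp b"
  proof -
    have "\<Phi> f (Var v) \<in> ImP" using v by (intro imageI polys_Var)
    moreover have "homogeneous md (b + md v) (\<Phi> f (Var v) * x)"
      using homogeneous_mult[OF homogeneous_Phi_var[OF v], of b x] x by (simp add: Phi_Var add.commute)
    ultimately show ?thesis using x Im_mult by (simp add: multi_rees_eq_image)
  qed
qed

sublocale RM: graded_action vaM md "S_vars n w m" rees_comp
  by (rule vaM_action)

lemma ideal_module_simps:
  "mod_act (ideal_module K) = (*)" "mod_carrier (ideal_module K) = K"
  "mod_comp (ideal_module K) = (\<lambda>e. {x \<in> K. homogeneous std_degree e x})"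
  by (simp_all add: ideal_module_def)

lemma rees_simps:
  "mod_act rees = (\<lambda>s x. \<Phi> f s * x)" "mod_carrier rees = multi_rees n w I"
  "mod_comp rees = rees_comp"
  by (simp_all add: rees_module_def)

lemma resolved_ideal:
  assumes "graded_free_resolution (X_vars n) std_degree (ideal_module (J a)) F"
    and "set xs = X_vars n" "distinct xs"
  shows "resolved_module (X_vars n) std_degree (ideal_module (J a)) F xs"
proof (rule resolved_module.intro)
  show "res_aug (ideal_module (J a)) F ` fcomp (X_vars n) std_degree (res_rank F 0) (res_shift F 0) e
      = mod_comp (ideal_module (J a)) e" for e
    by (rule aug_surj_of_resolution[OF assms(1), where \<phi> = "\<lambda>s. s" and dg' = std_degree])
      (simp_all add: ideal_module_simps)
  show "graded_action (\<lambda>v. mod_act (ideal_module (J a)) (Var v)) std_degree (X_vars n) (mod_comp (ideal_module (J a)))"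
    using vaJ_action[of a] by (simp add: ideal_module_simps)
qed (use assms in \<open>simp_all add: ideal_module_simps distrib_right mult.assoc\<close>)

lemma resolved_rees:
  assumes "graded_free_resolution (S_vars n w m) md rees F"
    and "set vs = S_vars n w m" "distinct vs"
  shows "resolved_module (S_vars n w m) md rees F vs"
proof (rule resolved_module.intro)
  show "res_aug rees F ` fcomp (S_vars n w m) md (res_rank F 0) (res_shift F 0) b = mod_comp rees b" for b
    by (rule aug_surj_of_resolution[OF assms(1), where \<phi> = "\<Phi> f" and dg' = md])
      (simp_all add: rees_simps hpart_Phi)
  show "graded_action (\<lambda>v. mod_act rees (Var v)) md (S_vars n w m) (mod_comp rees)"
    using vaM_action by (simp add: rees_simps)
qed (use assms in \<open>simp_all add: rees_simps Phi_add Phi_mult distrib_right mult.assoc\<close>)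

text \<open>Since \<open>\<Phi>\<close> preserves degrees, homogeneous parts of elements of the algebra stay in it; then \<open>T\<^sup>a\<close> is
  cancelled.\<close>

lemma J_hpart:
  assumes x: "x \<in> J a"
  shows "hpart std_degree e x \<in> J a"
proof -
  obtain t where t: "Tm w a = (monom t 1 :: 'k mpol)"
    and td: "mon_degree md t = (\<Sum>i=1..w. of_nat (a i) * md (T i))"
    using Tm_monom[of w a d] by blast
  have xX: "x \<in> XP" using x idealD(1)[OF ideal_J] by blast
  obtain s where s: "s \<in> SP" "x * Tm w a = \<Phi> f s" using J_Tm_in_image x by blast
  let ?b = "rees_degree a e"
  have "hpart md ?b (x * Tm w a) \<in> rees_comp ?b"
    unfolding s(2) hpart_Phi[OF s(1)] rees_comp_Phi using s(1) polys_part homogeneous_hpart by blast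
  moreover have "hpart md ?b (x * Tm w a) = hpart std_degree e x * Tm w a"
  proof -
    have "hpart md (?b - mon_degree md t) x = hpart std_degree e x"
    proof (rule poly_mapping_eqI)
      fix mm
      show "coeff (hpart md (?b - mon_degree md t) x) mm = coeff (hpart std_degree e x) mm"
      proof (cases "mm \<in> supp x")
        case True
        then have "monom mm (1 :: 'k) \<in> XP" using xX by (auto simp: polys_def)
        from homogeneous_X_multi[OF this homogeneous_monom, of d]
        have "mon_degree md mm = (\<lambda>l. mon_degree std_degree mm * unit_deg 0 l)"
          by (simp add: homogeneous_def)
        moreover have "?b - mon_degree md t = (\<lambda>l. e * unit_deg 0 l)"
          unfolding Tm_degree[where e = e and a = a, symmetric] td by simp
        moreover have "(\<lambda>l. mon_degree std_degree mm * unit_deg 0 l) = (\<lambda>l. e * unit_deg 0 l) \<longleftrightarrow> mon_degree std_degree mm = e"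
          by (auto simp: fun_eq_iff unit_deg_def)
        ultimately show ?thesis by (simp add: coeff_part)
      qed (simp add: coeff_part in_keys_iff)
    qed
    then show ?thesis unfolding t using hpart_mult[OF homogeneous_monom[of md t "1 :: 'k"], of ?b x] by simp
  qed
  ultimately obtain y where "y \<in> J a" "hpart std_degree e x * Tm w a = y * Tm w a"
    unfolding rees_comp_eq_J by auto
  then show ?thesis unfolding t using monom_mult_cancel[of t "hpart std_degree e x" y] by (simp add: mult.commute)
qed

text \<open>The coordinates of the degree of a monomial add up to its total degree.\<close>

lemma positive_S:
  assumes "supp mm \<subseteq> S_vars n w m" "mon_degree md mm = 0"
  shows "mm = 0"
proof -
  have "(\<Sum>l\<le>w. mon_degree md mm l) = mon_degree (\<lambda>_. 1 :: int) mm"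
    using assms(1)
  proof (induction mm rule: monomial_induct)
    case zero
    show ?case by simp
  next
    case (step v mm)
    have "(\<Sum>l\<le>w. md v l) = 1"
      using step(1) by (cases rule: S_vars_cases) (auto simp: unit_deg_def sum.delta)
    then have "(\<Sum>l\<le>w. mon_degree md (monom v 1 + mm) l) = 1 + (\<Sum>l\<le>w. mon_degree md mm l)"
      by (simp add: mon_degree_add mon_degree_single sum.distrib)
    moreover have "mon_degree (\<lambda>_. 1 :: int) (monom v 1 + mm) = 1 + mon_degree (\<lambda>_. 1) mm"
      by (simp add: mon_degree_add mon_degree_single)
    ultimately show ?case using step by (simp add: supp_add_nat)
  qed
  then show ?thesis using assms(2) mon_degree_one_eq_0 by simp
qed

text \<open>Over the presenting ring the algebra is generated by \<open>1\<close>, so its resolution starts with a free module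
  of rank one and continues with the kernel of \<open>\<Phi>\<close>.\<close>

theorem rees_resolution_exists:
  "\<exists>F. graded_free_resolution (S_vars n w m) md rees F \<and> res_rank F 0 = 1 \<and> res_shift F 0 0 = 0"
proof -
  let ?V = "S_vars n w m"
  let ?fc = "fcomp ?V md 1 (\<lambda>_. 0) :: _ \<Rightarrow> (nat \<Rightarrow> 'k mpol) set"
  let ?Deg = "{b :: nat \<Rightarrow> int. \<forall>l>w. b l = 0}"
  define N where "N b = {x \<in> ?fc b. \<Phi> f (x 0) = 0}" for b
  have Phi_diff: "\<Phi> f (x - y) = \<Phi> f x - \<Phi> f y" for x y
    using Phi_add[of f "x - y" y] by simp
  have N: "graded_submodule ?V md 1 (\<lambda>_. 0) N"
    unfolding graded_submodule_def N_def
    by (auto simp: fcomp_diff fcomp_monom_mult Phi_mult Phi_diff)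
  obtain R t G where g0: "gens ?V md N (R 0) (t 0) (G 0)"
    and gS: "\<And>k. gens ?V md (syz ?V md (R k) (t k) (G k)) (R (Suc k)) (t (Suc k)) (G (Suc k))"
    and "\<And>k. minimal_gens ?V md (R k) (t k) (G k)"
    by (rule resolution_tower[OF N finite_S_vars positive_S], assumption+, rule that)
  have G0: "G 0 j \<in> ?fc (t 0 j)" "\<Phi> f (G 0 j 0) = 0" "G 0 j \<noteq> 0" if "j < R 0" for j
    using g0 that by (auto simp: gens_def N_def)
  have GS: "G (Suc k) j \<in> fcomp ?V md (R k) (t k) (t (Suc k) j)" "G (Suc k) j \<noteq> 0" if "j < R (Suc k)" for k j
    using gS[of k] that by (auto simp: gens_def syz_def)
  have Deg: "mon_degree md mm \<in> ?Deg" if "supp mm \<subseteq> ?V" for mm using mon_degree_S[OF that] by blast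
  have tDeg: "\<forall>j<R k. t k j \<in> ?Deg" for k
  proof (induction k)
    case 0
    show ?case
    proof (intro allI impI)
      fix j assume j: "j < R 0"
      show "t 0 j \<in> ?Deg"
        by (rule deg_of_fcomp[OF G0(1)[OF j] G0(3)[OF j]]) (simp, erule Deg, simp)
    qed
  next
    case (Suc k)
    show ?case
    proof (intro allI impI)
      fix j assume j: "j < R (Suc k)"
      show "t (Suc k) j \<in> ?Deg"
        by (rule deg_of_fcomp[OF GS(1)[OF j] GS(2)[OF j]]) (rule Suc[rule_format], assumption, erule Deg, simp)
    qed
  qed
  define F :: "('k mpol, nat \<Rightarrow> int, 'k mpol) resolution" where
    "F = \<lparr>res_rank = case_nat 1 R, res_shift = case_nat (\<lambda>_. 0) t,
          res_mat = (\<lambda>k i j. G k j i), res_gen = (\<lambda>j. 1)\<rparr>"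
  have F [simp]: "res_rank F 0 = 1" "res_rank F (Suc k) = R k" "res_shift F 0 = (\<lambda>_. 0)" "res_shift F (Suc k) = t k"
    "res_mat F k i j = G k j i" "res_gen F j = 1" for k i j
    by (simp_all add: F_def)
  have Gk: "G k j \<in> fcomp ?V md (res_rank F k) (res_shift F k) (t k j)" if "j < R k" for k j
    using that G0(1) GS(1) by (cases k) auto
  have diff: "res_diff F k x = comb (R k) (G k) x" for k x
    by (rule res_diff_eq_comb[where V = ?V and dg = md and r = "res_rank F k" and s = "res_shift F k" and t = "t k"])
      (simp_all add: Gk)
  have aug: "res_aug rees F x = \<Phi> f (x 0)" for x
    by (simp add: res_aug_def rees_simps)
  have "graded_free_resolution ?V md rees F"
    unfolding graded_free_resolution_def
  proof (intro conjI allI impI)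
    show "res_shift F k j \<in> mod_degrees rees" if "j < res_rank F k" for k j
      using tDeg that by (cases k) (auto simp: rees_module_def)
    have "homogeneous md 0 (1 :: 'k mpol)" by (simp add: homogeneous_def)
    moreover have "1 \<in> ImP" by (rule XP_Im) simp
    ultimately show "res_gen F j \<in> mod_comp rees (res_shift F 0 j)" for j
      by (simp add: rees_simps multi_rees_eq_image zero_fun_def)
    show "res_mat F k i j \<in> polys ?V" "homogeneous md (res_shift F (Suc k) j - res_shift F k i) (res_mat F k i j)"
      if "i < res_rank F k" "j < res_rank F (Suc k)" for k i j
      using Gk[of j k] that by (auto simp: fcomp_iff)
    show "res_aug rees F ` free_mod ?V (res_rank F 0) = mod_carrier rees"
    proof (intro equalityI subsetI)
      fix y assume "y \<in> res_aug rees F ` free_mod ?V (res_rank F 0)"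
      then show "y \<in> mod_carrier rees" by (auto simp: aug rees_simps multi_rees_eq_image free_mod_def)
    next
      fix y assume "y \<in> mod_carrier rees"
      then obtain s where "s \<in> SP" "y = \<Phi> f s" by (auto simp: rees_simps multi_rees_eq_image)
      then show "y \<in> res_aug rees F ` free_mod ?V (res_rank F 0)"
        using single_fcomp[of s ?V] by (intro image_eqI[of _ _ "\<lambda>i. if i = 0 then s else 0"]) (auto simp: aug)
    qed
    let ?S = "{x \<in> free_mod ?V 1. \<Phi> f (x 0) = 0}"
    have "?S = comb (R 0) (G 0) ` free_mod ?V (R 0)"
    proof (intro equalityI)
      show "?S \<subseteq> comb (R 0) (G 0) ` free_mod ?V (R 0)"
      proof (rule graded_generation[where s = "\<lambda>_. 0" and dg = md and t = "t 0"])
        fix x b assume x: "x \<in> ?S"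
        then have "x 0 \<in> SP" by (simp add: free_mod_def)
        then have "\<Phi> f (hpart md b (x 0)) = 0" using hpart_Phi[of "x 0" b] x by simp
        then show "free_part md (\<lambda>_. 0) b x \<in> ?S"
          using x free_part_fcomp[of x ?V 1 md "\<lambda>_. 0" b] by (auto simp: fcomp_def free_part_def)
      next
        fix b
        show "?S \<inter> ?fc b \<subseteq> comb (R 0) (G 0) ` fcomp ?V md (R 0) (t 0) b"
          using g0 unfolding gens_def N_def by blast
      qed blast
      show "comb (R 0) (G 0) ` free_mod ?V (R 0) \<subseteq> ?S"
      proof (intro subsetI, elim imageE)
        fix y c assume y: "y = comb (R 0) (G 0) c" and c: "c \<in> free_mod ?V (R 0)"
        have "y \<in> free_mod ?V 1" unfolding y by (rule comb_free_mod[OF G0(1) c])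
        moreover have "\<Phi> f (y 0) = 0"
          unfolding y comb_def Phi_sum Phi_mult using G0(2) by (intro sum.neutral) simp
        ultimately show "y \<in> ?S" by blast
      qed
    qed
    then show "{x \<in> free_mod ?V (res_rank F 0). res_aug rees F x = 0} = res_diff F 0 ` free_mod ?V (res_rank F 1)"
      unfolding diff aug by simp
    show "{x \<in> free_mod ?V (res_rank F (Suc k)). res_diff F k x = (\<lambda>_. 0)} = res_diff F (Suc k) ` free_mod ?V (res_rank F (Suc (Suc k)))" for k
      unfolding diff using syz_generation[OF Gk[of _ k] gS[of k]] by (simp add: zero_fun_def)
  qed
  then show ?thesis by (intro exI[of _ F]) simp
qed

subsection \<open>Koszul homology of the multi-Rees algebra\<close>

lemma exact_J_iff:
  assumes "set xs \<subseteq> X_vars n"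
  shows "kexact vaJ std_degree (J_comp a) xs q e \<longleftrightarrow> RM.exact xs q (rees_degree a e)"
proof (rule kexact_iso[where \<psi> = "\<lambda>x. x * Tm w a"])
  obtain t where t: "Tm w a = (monom t 1 :: 'k mpol)" using Tm_monom by blast
  show "x = 0" if "x * Tm w a = 0" for x :: "'k mpol"
    using that monom_mult_cancel[of t x 0] by (simp add: t mult.commute)
  show "(\<lambda>x. x * Tm w a) ` J_comp a e = rees_comp (rees_degree a e)" for e
    by (rule rees_comp_eq_J[symmetric])
  fix v assume "v \<in> set xs"
  then obtain k where v: "v = X k" using assms by (auto simp: X_vars_def)
  show "rees_degree a (e - std_degree v) = rees_degree a e - md v" for e
    by (simp add: v rees_degree_def std_degree_def unit_deg_def fun_eq_iff)
  show "Var v * x * Tm w a = \<Phi> f (Var v) * (x * Tm w a)" for x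
    by (simp add: v Phi_Var mult.assoc)
qed (simp add: distrib_right)

lemma md_nonneg: "v \<in> S_vars n w m \<Longrightarrow> md v i \<ge> 0"
  and md_beyond: "v \<in> S_vars n w m \<Longrightarrow> i > w \<Longrightarrow> md v i = 0"
  by (auto elim!: S_vars_cases simp: unit_deg_def)

text \<open>The degrees of the variables have no negative coordinates, so the coefficients of such a chain also lie
  in components that vanish.\<close>

lemma exact_outside:
  assumes "set vs \<subseteq> S_vars n w m" "b l < 0 \<or> l > w \<and> b l \<noteq> 0"
  shows "RM.exact vs q b"
proof (rule kexact_trivial)
  fix k b' assume s: "slot md vs q b k = Some b'"
  have "b' l < 0 \<or> l > w \<and> b' l \<noteq> 0"
  proof (cases "b l < 0")
    case True
    have "b' l \<le> b l" using assms(1) md_nonneg by (intro slot_mono[OF s]) auto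
    then show ?thesis using True by simp
  next
    case False
    then have l: "l > w" "b l \<noteq> 0" using assms(2) by auto
    have "b' l = b l" using assms(1) md_beyond l(1) by (intro slot_const[OF s]) auto
    then show ?thesis using l by simp
  qed
  then show "rees_comp b' \<subseteq> {0}" using rees_comp_eq_0 by blast
qed (rule RM.C_0, rule RM.var_action_axioms)

text \<open>Passing to the cone over \<open>Z i j\<close> involves the homology at \<open>(q, b)\<close> and at \<open>(q - 1, b - e\<^sub>i)\<close>, and
  \<open>b - e\<^sub>i\<close> has the same \<open>0\<close>-th coordinate as \<open>b\<close>.\<close>

lemma exact_add_Z:
  assumes "set zs \<subseteq> S_vars n w m - X_vars n" "set xs \<subseteq> S_vars n w m"
    and "\<And>q b. b 0 > q \<Longrightarrow> RM.exact xs q b"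
  shows "b 0 > q \<Longrightarrow> RM.exact (zs @ xs) q b"
  using assms(1)
proof (induction zs arbitrary: q b)
  case Nil
  then show ?case using assms(3) by simp
next
  case (Cons z zs)
  then have z: "z \<in> S_vars n w m" "z \<notin> X_vars n" "set zs \<subseteq> S_vars n w m - X_vars n" by auto
  then have "md z 0 = 0" by (auto elim!: S_vars_cases simp: unit_deg_def X_vars_def)
  then have 1: "RM.exact (zs @ xs) (q - 1) (b - md z)" using Cons z by (intro Cons.IH) auto
  have 2: "RM.exact (zs @ xs) q b" using Cons z by (intro Cons.IH) auto
  have "set (zs @ xs) \<subseteq> S_vars n w m" using z(3) assms(2) by auto
  from RM.exact_Cons[OF z(1) this 2 1] show ?case by simp
qed

text \<open>Multiplication by \<open>Z i j\<close> is surjective on the homology in the degrees concerned, and below \<open>0\<close> in the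
  \<open>i\<close>-th coordinate there is none.\<close>

lemma exact_remove_Z:
  assumes "set zs \<subseteq> S_vars n w m - X_vars n" "set xs \<subseteq> S_vars n w m"
    and "\<And>b. b 0 > q \<Longrightarrow> RM.exact (zs @ xs) q b"
  shows "b 0 > q \<Longrightarrow> RM.exact xs q b"
  using assms(1,3)
proof (induction zs arbitrary: b)
  case (Cons z zs)
  then have z: "z \<in> S_vars n w m" "z \<notin> X_vars n" "set zs \<subseteq> S_vars n w m - X_vars n" by auto
  then obtain i j where ij: "z = Z i j" "i \<in> {1..w}"
    by (auto elim!: S_vars_cases simp: X_vars_def)
  have vs: "set (zs @ xs) \<subseteq> S_vars n w m" using z(3) assms(2) by auto
  have step: "c 0 > q \<Longrightarrow> c i < int k \<Longrightarrow> RM.exact (zs @ xs) q c" for k c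
  proof (induction k arbitrary: c)
    case 0
    then show ?case by (intro exact_outside[OF vs, of c i]) simp
  next
    case (Suc k)
    have 1: "RM.exact (zs @ xs) q (c - md z)"
      using Suc.prems ij by (intro Suc.IH) (auto simp: unit_deg_def)
    have 2: "RM.exact (z # (zs @ xs)) q c" using Cons.prems(3)[of c] Suc.prems by simp
    show ?case by (rule RM.exact_ConsD_step[OF z(1) vs 2 1])
  qed
  have "RM.exact (zs @ xs) q c" if "c 0 > q" for c
  proof -
    have "c i < int (nat (c i) + 1)" by simp
    then show ?thesis by (rule step[where c = c, OF that])
  qed
  then show ?case by (rule Cons.IH[of b, OF Cons.prems(1) z(3)])
qed simp

end

subsection \<open>Both conditions in terms of Koszul homology\<close>

context rees_setting
begin

lemma J_comp_below:
  assumes "e < int (gen_degree a)"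
  shows "J_comp a e \<subseteq> {0}"
proof
  fix x assume x: "x \<in> J_comp a e"
  obtain t where t: "Tm w a = (monom t 1 :: 'k mpol)" using Tm_monom by blast
  have "rees_degree a e 0 < 0" using assms by (simp add: rees_degree_def)
  then have "rees_comp (rees_degree a e) = {0}" by (intro rees_comp_eq_0[of _ 0]) simp
  then have "x * Tm w a = 0" using x unfolding rees_comp_eq_J by blast
  then show "x \<in> {0}" using monom_mult_cancel[of t x 0] by (simp add: t mult.commute)
qed

text \<open>A coefficient of a chain of degree \<open>e\<close> has degree \<open>e - q\<close>, and the ideal is zero below its generating
  degree.\<close>

lemma exact_J_below:
  assumes "e < int (gen_degree a) + q"
  shows "kexact vaJ std_degree (J_comp a) xs q e"
proof (rule kexact_trivial)
  fix l b assume "slot std_degree xs q e l = Some b"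
  then have "b = e - q" by (rule slot_std)
  then show "J_comp a b \<subseteq> {0}" using assms by (intro J_comp_below) simp
next
  show "0 \<in> J_comp a b" for b using idealD(2)[OF ideal_J] by simp
  show "var_action vaJ" by (rule graded_action.axioms(1)[OF vaJ_action])
qed

text \<open>The algebra is generated by \<open>1\<close> as a module over the presenting ring.\<close>

lemma exact_degree_0:
  assumes "set vs = S_vars n w m" "distinct vs" "b \<noteq> 0"
  shows "RM.exact vs 0 b"
proof -
  obtain F where F: "graded_free_resolution (S_vars n w m) md rees F" "res_rank F 0 = 1" "res_shift F 0 0 = 0"
    using rees_resolution_exists by blast
  interpret F: resolved_module "S_vars n w m" md rees F vs
    by (rule resolved_rees[OF F(1) assms(1,2)])
  have "y \<in> tor_boundaries F 0" if "y \<in> tensor_comp F 0 b" for y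
  proof -
    have "y = (\<lambda>_. 0)" using that F(2,3) assms(3) by (auto simp: tensor_comp_def tensor_space_def fun_eq_iff) (metis One_nat_def Suc_leI neq0_conv)
    moreover have "tensor_diff F 0 (\<lambda>_. 0) = (\<lambda>_. 0)" by (simp add: tensor_diff_def fun_eq_iff)
    ultimately show ?thesis unfolding tor_boundaries_def
      by (intro image_eqI[of _ _ "\<lambda>_. 0"]) (simp_all add: tensor_space_def)
  qed
  then have "F.M.exact vs (int 0) b" unfolding F.tor_vanishes_iff_exact by blast
  then show ?thesis by (simp add: rees_simps)
qed

text \<open>No nonzero element of degree \<open>0\<close> is a combination of multiples of variables, but \<open>1\<close> has this degree.
  This is what keeps the regularity from being negative.\<close>

lemma not_exact_degree_0:
  assumes "set vs \<subseteq> S_vars n w m"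
  shows "\<not> RM.exact vs 0 0"
proof -
  have "irrelevant_part vaM md rees_comp vs 0 = {0}" using assms
  proof (induction vs)
    case (Cons v vs)
    then have v: "v \<in> S_vars n w m" by simp
    then have "\<exists>l. md v l > 0" by (elim S_vars_cases) (auto simp: unit_deg_def intro: exI)
    then obtain l where l: "md v l > 0" by blast
    then have 1: "rees_comp (0 - md v) = {0}" by (intro rees_comp_eq_0[of _ l]) simp
    have 2: "irrelevant_part vaM md rees_comp vs 0 = {0}" by (rule Cons.IH) (use Cons.prems in simp)
    show ?case unfolding irrelevant_part.simps 1 2 by simp
  qed simp
  moreover have "1 \<in> rees_comp 0"
    using XP_Im[of 1] by (simp add: multi_rees_eq_image homogeneous_def)
  ultimately show ?thesis unfolding RM.exact_0_iff[OF assms] by auto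
qed

text \<open>With all variables of the presenting ring this is the condition \<open>reg\<^sub>0 \<le> 0\<close>; with the variables of \<open>R\<close>
  alone it is linearity of all product ideals.\<close>

definition Koszul_linear :: "var list \<Rightarrow> bool" where
  "Koszul_linear vs \<longleftrightarrow> (\<forall>q b. q < b 0 \<longrightarrow> RM.exact vs q b)"

text \<open>In a linear minimal resolution every basis element of \<open>F\<^bsub>k+1\<^esub>\<close> has a nonzero entry in its column, so its
  degree exceeds that of some basis element of \<open>F\<^sub>k\<close> by exactly \<open>1\<close>. At the start, the assumption on
  homological degree \<open>0\<close> bounds the degrees of the generators.\<close>

lemma linear_resolution_imp_exact:
  assumes lin: "linear_resolution n (J a)" and xs: "set xs = X_vars n" "distinct xs"
    and gen: "\<And>e. e > int (gen_degree a) \<Longrightarrow> kexact vaJ std_degree (J_comp a) xs 0 e"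
    and e: "e > int (gen_degree a) + int k"
  shows "kexact vaJ std_degree (J_comp a) xs (int k) e"
proof -
  obtain F where F: "graded_free_resolution (X_vars n) std_degree (ideal_module (J a)) F" "minimal_resolution F"
    and linF: "\<And>k i j. i < res_rank F k \<Longrightarrow> j < res_rank F (Suc k) \<Longrightarrow> homogeneous std_degree 1 (res_mat F k i j)"
    using lin unfolding linear_resolution_def by blast
  interpret F: resolved_module "X_vars n" std_degree "ideal_module (J a)" F xs
    by (rule resolved_ideal[OF F(1) xs])
  have ex: "kexact vaJ std_degree (J_comp a) xs (int k) e \<longleftrightarrow> (\<forall>j<res_rank F k. res_shift F k j \<noteq> e)" for k e
    using F.minimal_exact_iff[OF F(2), of k e] by (simp add: ideal_module_simps)
  have shift: "\<forall>j<res_rank F k. res_shift F k j \<le> int (gen_degree a) + int k" for k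
  proof (induction k)
    case 0
    show ?case
    proof (intro allI impI)
      fix j assume j: "j < res_rank F 0"
      then have "\<not> kexact vaJ std_degree (J_comp a) xs 0 (res_shift F 0 j)"
        using ex[of 0 "res_shift F 0 j", unfolded of_nat_0] by blast
      then show "res_shift F 0 j \<le> int (gen_degree a) + int 0"
        using gen[of "res_shift F 0 j"] by linarith
    qed
  next
    case (Suc k)
    show ?case
    proof (intro allI impI)
      fix j assume j: "j < res_rank F (Suc k)"
      obtain i where i: "i < res_rank F k" "res_mat F k i j \<noteq> 0"
        using F.minimal_column_nonzero[OF F(2) j] by blast
      then have "supp (res_mat F k i j) \<noteq> {}" using sum_monoms[of "res_mat F k i j"] by auto
      then obtain mm where mm: "mm \<in> supp (res_mat F k i j)" by blast
      have "mon_degree std_degree mm = 1" using linF[OF i(1) j] mm by (auto simp: homogeneous_def)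
      moreover have "mon_degree std_degree mm = res_shift F (Suc k) j - res_shift F k i"
        using res_mat_graded(2)[OF F(1) i(1) j] mm by (auto simp: homogeneous_def)
      moreover have "res_shift F k i \<le> int (gen_degree a) + int k" using Suc i(1) by blast
      ultimately show "res_shift F (Suc k) j \<le> int (gen_degree a) + int (Suc k)" by simp
    qed
  qed
  show ?thesis unfolding ex using shift[of k] e by fastforce
qed

text \<open>The degrees of the basis elements of \<open>F\<^sub>k\<close> in a minimal resolution are those with nonvanishing homology.
  The assumption excludes degrees that are too large; the others are excluded because the ideal starts in
  its generating degree.\<close>

lemma exact_imp_linear_resolution:
  assumes xs: "set xs = X_vars n" "distinct xs"
    and ex: "\<And>k e. e > int (gen_degree a) + int k \<Longrightarrow> kexact vaJ std_degree (J_comp a) xs (int k) e"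
  shows "linear_resolution n (J a)"
proof -
  obtain F where F: "graded_free_resolution (X_vars n) std_degree (ideal_module (J a)) F" "minimal_resolution F"
    using graded_ideal_minimal_resolution[OF ideal_J finite_X_vars J_hpart] by blast
  interpret F: resolved_module "X_vars n" std_degree "ideal_module (J a)" F xs
    by (rule resolved_ideal[OF F(1) xs])
  have ex': "kexact vaJ std_degree (J_comp a) xs (int k) e \<longleftrightarrow> (\<forall>j<res_rank F k. res_shift F k j \<noteq> e)" for k e
    using F.minimal_exact_iff[OF F(2), of k e] by (simp add: ideal_module_simps)
  have shift: "res_shift F k j = int (gen_degree a) + int k" if j: "j < res_rank F k" for k j
  proof (rule ccontr)
    assume "res_shift F k j \<noteq> int (gen_degree a) + int k"
    then have "kexact vaJ std_degree (J_comp a) xs (int k) (res_shift F k j)"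
      using ex[of k "res_shift F k j"] exact_J_below[of "res_shift F k j" a "int k" xs] by linarith
    then show False using ex' j by blast
  qed
  have "homogeneous std_degree 1 (res_mat F k i j)" if "i < res_rank F k" "j < res_rank F (Suc k)" for k i j
    using res_mat_graded(2)[OF F(1) that] shift[OF that(1)] shift[OF that(2)] by simp
  moreover have "{g \<in> J a. homogeneous std_degree (int (gen_degree a)) g} \<subseteq> XP"
    using idealD(1)[OF ideal_J] by blast
  ultimately show ?thesis unfolding linear_resolution_def
    using J_generated[of a] F
    by (intro conjI exI[of _ "gen_degree a"] exI[of _ "{g \<in> J a. homogeneous std_degree (int (gen_degree a)) g}"]
        exI[of _ F]) blast+
qed

lemma ex_var_lists:
  obtains xs zs where "set xs = X_vars n" "distinct xs" "set (zs @ xs) = S_vars n w m" "distinct (zs @ xs)"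
    "set zs \<subseteq> S_vars n w m - X_vars n" "set xs \<subseteq> S_vars n w m"
proof -
  obtain xs where xs: "set xs = X_vars n" "distinct xs"
    using finite_distinct_list[OF finite_X_vars] by blast
  obtain zs where zs: "set zs = S_vars n w m - X_vars n" "distinct zs"
    using finite_distinct_list[of "S_vars n w m - X_vars n"] finite_S_vars by blast
  have "X_vars n \<subseteq> S_vars n w m" by (simp add: S_vars_def)
  then show thesis using xs zs by (intro that[of xs zs]) auto
qed

lemma Koszul_linear_lists:
  assumes "set zs \<subseteq> S_vars n w m - X_vars n" "set xs \<subseteq> S_vars n w m"
  shows "Koszul_linear (zs @ xs) \<longleftrightarrow> Koszul_linear xs"
  unfolding Koszul_linear_def
  using exact_add_Z[OF assms] exact_remove_Z[OF assms] by blast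

text \<open>Strand by strand, the homology of the algebra over the variables of \<open>R\<close> is that of the product ideals. The
  \<open>zs\<close> enter only to see that each product ideal is generated in its expected degree, which is inherited
  from the generator \<open>1\<close> of the algebra.\<close>

lemma linear_products_iff_Koszul:
  assumes xs: "set xs = X_vars n" "distinct xs" and zs: "set zs \<subseteq> S_vars n w m - X_vars n"
    and vs: "set (zs @ xs) = S_vars n w m" "distinct (zs @ xs)"
  shows "linear_products n w I \<longleftrightarrow> Koszul_linear xs"
proof
  assume lin: "linear_products n w I"
  have xsS: "set xs \<subseteq> S_vars n w m" using vs by auto
  have gen: "RM.exact xs 0 b" if "b 0 > 0" for b
  proof (rule exact_remove_Z[where zs = zs and xs = xs and q = 0 and b = b, OF zs xsS _ that])
    fix c :: "nat \<Rightarrow> int" assume "0 < c 0"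
    then have "c \<noteq> 0" by auto
    then show "RM.exact (zs @ xs) 0 c" by (rule exact_degree_0[OF vs])
  qed
  show "Koszul_linear xs" unfolding Koszul_linear_def
  proof (intro allI impI)
    fix q :: int and b :: "nat \<Rightarrow> int" assume q: "q < b 0"
    show "RM.exact xs q b"
    proof (cases "q < 0 \<or> (\<exists>l. b l < 0 \<or> l > w \<and> b l \<noteq> 0)")
      case True
      then show ?thesis using RM.exact_neg exact_outside[OF xsS] by blast
    next
      case False
      \<comment> \<open>All coordinates of \<open>b\<close> beyond the \<open>0\<close>-th are now natural numbers: they are the exponent \<open>a\<close>.\<close>
      define a where "a = (\<lambda>i. nat (b i))"
      define e where "e = b 0 + int (gen_degree a)"
      have b: "b = rees_degree a e"
        using False by (auto simp: fun_eq_iff rees_degree_def e_def a_def not_less)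
      have "kexact vaJ std_degree (J_comp a) xs (int (nat q)) e"
      proof (rule linear_resolution_imp_exact[OF _ xs])
        show "linear_resolution n (J a)" using lin by (simp add: linear_products_def)
        show "kexact vaJ std_degree (J_comp a) xs 0 e" if "e > int (gen_degree a)" for e
          unfolding exact_J_iff[OF equalityD1[OF xs(1)]]
          using that by (intro gen) (simp add: rees_degree_def)
        show "e > int (gen_degree a) + int (nat q)" using q False by (simp add: e_def)
      qed
      then show ?thesis unfolding b using False xs(1) exact_J_iff[of xs a q e] by simp
    qed
  qed
next
  assume K: "Koszul_linear xs"
  show "linear_products n w I" unfolding linear_products_def
  proof
    fix a
    show "linear_resolution n (J a)"
    proof (rule exact_imp_linear_resolution[OF xs])
      fix k e assume "e > int (gen_degree a) + int k"
      then have "RM.exact xs (int k) (rees_degree a e)"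
        using K unfolding Koszul_linear_def by (simp add: rees_degree_def)
      then show "kexact vaJ std_degree (J_comp a) xs (int k) e" using xs(1) exact_J_iff[of xs a "int k" e] by simp
    qed
  qed
qed

lemma tor_degrees_eq:
  assumes "set vs = S_vars n w m" "distinct vs"
  shows "tor_degrees (S_vars n w m) md rees k = {b. \<not> RM.exact vs (int k) b}"
proof -
  define F where "F = chosen_resolution (S_vars n w m) md rees"
  have F: "graded_free_resolution (S_vars n w m) md rees F"
    unfolding F_def chosen_resolution_def using rees_resolution_exists by (metis (no_types, lifting) someI)
  interpret F: resolved_module "S_vars n w m" md rees F vs
    by (rule resolved_rees[OF F assms])
  have "RM.exact vs (int k) b \<longleftrightarrow> (\<forall>y\<in>tensor_comp F k b. y \<in> tor_cycles F k \<longrightarrow> y \<in> tor_boundaries F k)" for b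
    using F.tor_vanishes_iff_exact[of k b] by (simp add: rees_simps)
  then show ?thesis unfolding tor_degrees_def Let_def F_def[symmetric] by blast
qed

lemma reg0_eq_0_iff_Koszul:
  assumes vs: "set vs = S_vars n w m" "distinct vs"
  shows "reg0 (S_vars n w m) md rees = 0 \<longleftrightarrow> Koszul_linear vs"
proof -
  let ?V = "S_vars n w m"
  note td = tor_degrees_eq[OF vs]
  have nonneg: "0 \<le> reg0 ?V md rees"
  proof -
    have "0 \<in> tor_degrees ?V md rees 0"
      unfolding td using not_exact_degree_0[of vs] vs(1) by simp
    then have "ereal (of_int ((0 :: nat \<Rightarrow> int) 0)) \<le> t0 ?V md rees 0"
      unfolding t0_def by (rule SUP_upper)
    then have "0 \<le> t0 ?V md rees 0 - ereal (of_nat 0)" by (simp add: zero_ereal_def[symmetric])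
    also have "\<dots> \<le> reg0 ?V md rees" unfolding reg0_def by (rule SUP_upper) simp
    finally show ?thesis .
  qed
  have minus_le: "x - ereal r \<le> 0 \<longleftrightarrow> x \<le> ereal r" for x r
    by (cases x) auto
  have "reg0 ?V md rees = 0 \<longleftrightarrow> reg0 ?V md rees \<le> 0" using nonneg by (auto intro: antisym)
  also have "\<dots> \<longleftrightarrow> (\<forall>k. t0 ?V md rees k \<le> ereal (of_nat k))"
    unfolding reg0_def SUP_le_iff minus_le by simp
  also have "\<dots> \<longleftrightarrow> (\<forall>k b. int k < b 0 \<longrightarrow> RM.exact vs (int k) b)"
  proof -
    have "t0 ?V md rees k \<le> ereal (of_nat k) \<longleftrightarrow> (\<forall>b. int k < b 0 \<longrightarrow> RM.exact vs (int k) b)" for k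
    proof -
      have "real_of_int z \<le> real k \<longleftrightarrow> z \<le> int k" for z by linarith
      then show ?thesis unfolding t0_def SUP_le_iff td by (auto simp: not_less[symmetric])
    qed
    then show ?thesis by blast
  qed
  also have "\<dots> \<longleftrightarrow> Koszul_linear vs" unfolding Koszul_linear_def
  proof (intro iffI allI impI)
    fix q :: int and b :: "nat \<Rightarrow> int"
    assume *: "\<forall>k b. int k < b 0 \<longrightarrow> RM.exact vs (int k) b" and q: "q < b 0"
    show "RM.exact vs q b"
    proof (cases "q < 0")
      case True
      then show ?thesis by (rule RM.exact_neg)
    next
      case False
      then show ?thesis using *[rule_format, of "nat q" b] q by simp
    qed
  qed blast
  finally show ?thesis .
qed

theorem linear_products_iff_reg0:
  "linear_products n w I \<longleftrightarrow> reg0 (S_vars n w m) md rees = 0"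
proof -
  obtain xs zs where xs: "set xs = X_vars n" "distinct xs" and vs: "set (zs @ xs) = S_vars n w m" "distinct (zs @ xs)"
    and zs: "set zs \<subseteq> S_vars n w m - X_vars n" and xsS: "set xs \<subseteq> S_vars n w m"
    by (rule ex_var_lists)
  show ?thesis
    unfolding linear_products_iff_Koszul[OF xs zs vs] reg0_eq_0_iff_Koszul[OF vs]
    by (rule Koszul_linear_lists[OF zs xsS, symmetric])
qed

end

theorem theorem3p1:
  fixes n w :: nat
    and I :: "nat \<Rightarrow> 'k::field mpol set"
    and d m :: "nat \<Rightarrow> nat"
    and f :: "nat \<Rightarrow> nat \<Rightarrow> 'k mpol"
  assumes "\<And>i j. i \<in> {1..w} \<Longrightarrow> j \<in> {1..m i} \<Longrightarrow>
             f i j \<in> polys (X_vars n) \<and> homogeneous std_degree (int (d i)) (f i j)"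
    and "\<And>i. i \<in> {1..w} \<Longrightarrow> I i = Idl\<^bsub>poly_ring (X_vars n)\<^esub> (f i ` {1..m i})"
  shows "linear_products n w I \<longleftrightarrow>
         reg0 (S_vars n w m) (multi_degree d) (rees_module n w I d f) = 0"
proof -
  interpret rees_setting n w I d m f
    by (rule rees_setting.intro) (rule assms(1), assumption+, rule assms(2))
  show ?thesis by (rule linear_products_iff_reg0)
qed

end
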